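(* Let $Q\in\mathcal N_\kappa(\mathcal H)$ be regular, given with a minimal realization $$Q(z)=Q(z_0)^*+(z-\overline{z_0})\Gamma^+\big(I+(z-z_0)(A-z)^{-1}\big)\Gamma,$$ and assume that $\alpha\in\mathbb R$ is not a generalized zero of $Q$. If $\alpha$ is a generalized pole of $Q$ (i.e. $\alpha\in\sigma_p(A)$) and $x_0,x_1,\dots,x_{\ell-1}$ is a Jordan chain of $A$ at $\alpha$, then $$\vec\eta(z):=(z-\overline{z_0})\,Q(z)^{-1}\Gamma^+\big(x_0+(z-\alpha)x_1+\dots+(z-\alpha)^{\ell-1}x_{\ell-1}\big)$$ is a strong pole cancellation function of $Q$ at $\alpha$ of order at least $\ell$.
   Context: $(\mathcal H,(\cdot,\cdot))$ is a Hilbert space, $\mathbb C^+$ the open upper half plane. $Q:\mathcal D(Q)\subset\mathbb C\to\mathcal L(\mathcal H)$ is in the generalized Nevanlinna class $\mathcal N_\kappa(\mathcal H)$ if it is meromorphic in $\mathbb C\setminus\mathbb R$, $Q(\overline z)^*=Q(z)$, and the kernel $\frac{Q(z)-Q(w)^*}{z-\overline w}$ ($z,w\in\mathcal D(Q)\cap\mathbb C^+$) has exactly $\kappa$ negative squares. A minimal realization: Pontryagin space $(\mathcal K,[\cdot,\cdot])$, self-adjoint linear relation $A$ in $\mathcal K$ (the representing relation), $z_0\in\varrho(A)\cap\mathbb C^+$, bounded $\Gamma:\mathcal H\to\mathcal K$ with the displayed formula for all $z\in\mathcal D(Q)$ and $\mathcal K=\overline{\mathrm{span}}\{(I+(z-z_0)(A-z)^{-1})\Gamma\vec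 h:z\in\varrho(A),\vec h\in\mathcal H\}$; $\Gamma^+$ is the Pontryagin-space adjoint. $\alpha$ is a generalized pole of $Q$ if it is an eigenvalue of $A$. $Q$ is regular if $Q(\gamma)$ is boundedly invertible for some $\gamma\in\mathbb C^+$; then $\alpha$ is a generalized zero of $Q$ if it is a generalized pole of $\widehat Q(z):=-Q(z)^{-1}$. A Jordan chain of $A$ at $\alpha$: $x_0\neq0$, $\{x_0,\alpha x_0\}\in A$, $\{x_j,\alpha x_j+x_{j-1}\}\in A$ for $1\le j<\ell$. $z\hat\to\alpha$ denotes non-tangential limit from $\mathbb C^+$; w-lim is weak limit in $\mathcal H$. A function $\vec\eta:\mathcal U_\alpha\cap\mathbb C^+\to\mathcal H$ ($\mathcal U_\alpha$ a neighbourhood of $\alpha$) is a strong pole cancellation function of $Q$ at $\alpha$ of order at least $\ell$ if for all $0\le j<\ell$: (D) $\text{w-}\lim_{z\hat\to\alpha}(\vec\eta(z))^{(j)}=\vec0$; (E) $\text{w-}\lim_{z\hat\to\alpha}(Q(z)\vec\eta(z))^{(j)}=:\vec\eta_j$ exists and $\vec\eta_0\ne\vec0$; (F) $\frac{d^{2j}}{dz^jd\overline z^j}\left(\frac{Q(z)-Q(z)^*}{z-\overline z}\vec\eta(z),\vec\eta(z)\right)$ is bounded as $z\hat\to\alpha$; (F$_s$) $\lim_{z,w\hat\to\alpha}\frac{d^{2j}}{dz^jd\overline w^j}\left(\frac{Q(z)-Q(w)^*}{z-\overline w}\vec\eta(z),\vec\eta(w)\right)$ exists. (The order is the maximal such $\ell$.)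 *)

theory Defs
  imports "HOL-Analysis.Analysis" "Jordan_Normal_Form.Char_Poly"
begin

class cinner_space = real_normed_vector +
  fixes scaleC :: "complex \<Rightarrow> 'a \<Rightarrow> 'a" (infixr "\<cdot>\<^sub>C" 75)
    and cinner :: "'a \<Rightarrow> 'a \<Rightarrow> complex"
  assumes scaleC_add_right: "a \<cdot>\<^sub>C (x + y) = a \<cdot>\<^sub>C x + a \<cdot>\<^sub>C y"
    and scaleC_add_left: "(a + b) \<cdot>\<^sub>C x = a \<cdot>\<^sub>C x + b \<cdot>\<^sub>C x"
    and scaleC_scaleC: "a \<cdot>\<^sub>C (b \<cdot>\<^sub>C x) = (a * b) \<cdot>\<^sub>C x"
    and scaleC_one: "1 \<cdot>\<^sub>C x = x"
    and scaleR_scaleC: "scaleR r x = (complex_of_real r) \<cdot>\<^sub>C x"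
    and cinner_add_left: "cinner (x + y) z = cinner x z + cinner y z"
    and cinner_scaleC_left: "cinner (a \<cdot>\<^sub>C x) y = a * cinner x y"
    and cinner_commute: "cinner y x = cnj (cinner x y)"
    and cinner_ge_zero: "0 \<le> Re (cinner x x)"
    and cinner_eq_zero_iff: "cinner x x = 0 \<longleftrightarrow> x = 0"
    and norm_eq_sqrt_cinner: "norm x = sqrt (Re (cinner x x))"

class chilbert = cinner_space + complete_space

definition clinear :: "('a::cinner_space \<Rightarrow> 'b::cinner_space) \<Rightarrow> bool" where
  "clinear T \<longleftrightarrow> (\<forall>x y. T (x + y) = T x + T y) \<and> (\<forall>c x. T (c \<cdot>\<^sub>C x) = c \<cdot>\<^sub>C T x)"

definition cbounded :: "('a::cinner_space \<Rightarrow> 'b::cinner_space) \<Rightarrow> bool" where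
  "cbounded T \<longleftrightarrow> clinear T \<and> (\<exists>K. \<forall>x. norm (T x) \<le> K * norm x)"

definition cspan :: "'a::cinner_space set \<Rightarrow> 'a set" where
  "cspan S = {x. \<exists>F c. finite F \<and> F \<subseteq> S \<and> x = (\<Sum>s\<in>F. c s \<cdot>\<^sub>C s)}"

definition bdd_invertible :: "('a::cinner_space \<Rightarrow> 'a) \<Rightarrow> bool" where
  "bdd_invertible T \<longleftrightarrow> cbounded T \<and> bij T \<and> cbounded (inv_into UNIV T)"

definition op_holomorphic_on :: "(complex \<Rightarrow> 'h::cinner_space \<Rightarrow> 'h) \<Rightarrow> complex set \<Rightarrow> bool" where
  "op_holomorphic_on Q D \<longleftrightarrow> (\<forall>z\<in>D. cbounded (Q z) \<and> (\<exists>T. cbounded T \<and>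
     ((\<lambda>w. onorm (\<lambda>x. inverse (w - z) \<cdot>\<^sub>C (Q w x - Q z x) - T x)) \<longlongrightarrow> 0) (at z)))"

definition op_pole :: "(complex \<Rightarrow> 'h::cinner_space \<Rightarrow> 'h) \<Rightarrow> complex set \<Rightarrow> complex \<Rightarrow> bool" where
  "op_pole Q D p \<longleftrightarrow> p \<notin> D \<and>
     (\<exists>r>0. ball p r - {p} \<subseteq> D \<and>
        (\<exists>m::nat. \<exists>M. \<forall>z\<in>ball p r - {p}. onorm (\<lambda>x. ((z - p) ^ m) \<cdot>\<^sub>C Q z x) \<le> M)) \<and>
     \<not> (\<exists>r>0. \<exists>M. \<forall>z\<in>ball p r - {p}. onorm (Q z) \<le> M)"

definition op_meromorphic_nonreal :: "(complex \<Rightarrow> 'h::cinner_space \<Rightarrow> 'h) \<Rightarrow> complex set \<Rightarrow> bool" where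
  "op_meromorphic_nonreal Q D \<longleftrightarrow> open D \<and> op_holomorphic_on Q D \<and>
     (\<forall>p. Im p \<noteq> 0 \<and> p \<notin> D \<longrightarrow> op_pole Q D p)"

definition num_neg_eigenvalues :: "complex mat \<Rightarrow> nat" where
  "num_neg_eigenvalues M =
     (\<Sum>a\<in>{a. poly (char_poly M) a = 0 \<and> Im a = 0 \<and> Re a < 0}. order a (char_poly M))"

text \<open>Scalar value \<open>((Q(z) - Q(w)^*)/(z - \<bar>w) h, k)\<close> of the Nevanlinna kernel.\<close>
definition nev_kernel :: "(complex \<Rightarrow> 'h::cinner_space \<Rightarrow> 'h) \<Rightarrow> complex \<Rightarrow> complex \<Rightarrow> 'h \<Rightarrow> 'h \<Rightarrow> complex" where
  "nev_kernel Q z w h k = (cinner (Q z h) k - cinner h (Q w k)) / (z - cnj w)"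

definition kernel_matrix ::
  "(complex \<Rightarrow> 'h::cinner_space \<Rightarrow> 'h) \<Rightarrow> nat \<Rightarrow> (nat \<Rightarrow> complex) \<Rightarrow> (nat \<Rightarrow> 'h) \<Rightarrow> complex mat" where
  "kernel_matrix Q n zs hs = mat n n (\<lambda>(i, j). nev_kernel Q (zs i) (zs j) (hs i) (hs j))"

definition kernel_neg_squares :: "(complex \<Rightarrow> 'h::cinner_space \<Rightarrow> 'h) \<Rightarrow> complex set \<Rightarrow> nat \<Rightarrow> bool" where
  "kernel_neg_squares Q D \<kappa> \<longleftrightarrow>
     (\<forall>n zs hs. (\<forall>i<n. zs i \<in> D \<and> Im (zs i) > 0) \<longrightarrow> num_neg_eigenvalues (kernel_matrix Q n zs hs) \<le> \<kappa>) \<and>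
     (\<exists>n zs hs. (\<forall>i<n. zs i \<in> D \<and> Im (zs i) > 0) \<and> num_neg_eigenvalues (kernel_matrix Q n zs hs) = \<kappa>)"

text \<open>\<open>Q \<in> N_\<kappa>(H)\<close>; \<open>Q(\<bar>z)^* = Q(z)\<close> is written out via the inner product.\<close>
definition gen_nevanlinna :: "nat \<Rightarrow> (complex \<Rightarrow> 'h::cinner_space \<Rightarrow> 'h) \<Rightarrow> complex set \<Rightarrow> bool" where
  "gen_nevanlinna \<kappa> Q D \<longleftrightarrow> op_meromorphic_nonreal Q D \<and>
     (\<forall>z\<in>D. cnj z \<in> D \<and> (\<forall>x y. cinner (Q z x) y = cinner x (Q (cnj z) y))) \<and>
     kernel_neg_squares Q D \<kappa>"

definition regular_fn :: "(complex \<Rightarrow> 'h::cinner_space \<Rightarrow> 'h) \<Rightarrow> complex set \<Rightarrow> bool" where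
  "regular_fn Q D \<longleftrightarrow> (\<exists>\<gamma>\<in>D. Im \<gamma> > 0 \<and> bdd_invertible (Q \<gamma>))"

text \<open>A Pontryagin space is modelled as a Hilbert space \<open>K\<close> together with a fundamental
symmetry \<open>J\<close> (\<open>J = J^* = J^{-1}\<close>) whose negative eigenspace is finite dimensional;
the indefinite inner product is \<open>[x,y] = (Jx, y)\<close>.\<close>
definition fund_symmetry :: "('k::chilbert \<Rightarrow> 'k) \<Rightarrow> bool" where
  "fund_symmetry J \<longleftrightarrow> cbounded J \<and> (\<forall>x. J (J x) = x) \<and> (\<forall>x y. cinner (J x) y = cinner x (J y)) \<and>
     (\<exists>F. finite F \<and> {x. J x = - x} \<subseteq> cspan F)"

definition kinner :: "('k::chilbert \<Rightarrow> 'k) \<Rightarrow> 'k \<Rightarrow> 'k \<Rightarrow> complex" where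
  "kinner J x y = cinner (J x) y"

definition linear_relation :: "('k::cinner_space \<times> 'k) set \<Rightarrow> bool" where
  "linear_relation A \<longleftrightarrow> (0, 0) \<in> A \<and>
     (\<forall>x x' y y'. (x, x') \<in> A \<and> (y, y') \<in> A \<longrightarrow> (x + y, x' + y') \<in> A) \<and>
     (\<forall>c x x'. (x, x') \<in> A \<longrightarrow> (c \<cdot>\<^sub>C x, c \<cdot>\<^sub>C x') \<in> A)"

definition rel_adjoint :: "('k::chilbert \<Rightarrow> 'k) \<Rightarrow> ('k \<times> 'k) set \<Rightarrow> ('k \<times> 'k) set" where
  "rel_adjoint J A = {(y, y'). \<forall>x x'. (x, x') \<in> A \<longrightarrow> kinner J x' y = kinner J x y'}"

definition selfadjoint_relation :: "('k::chilbert \<Rightarrow> 'k) \<Rightarrow> ('k \<times> 'k) set \<Rightarrow> bool" where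
  "selfadjoint_relation J A \<longleftrightarrow> linear_relation A \<and> A = rel_adjoint J A"

definition resolvent :: "('k::cinner_space \<times> 'k) set \<Rightarrow> complex \<Rightarrow> 'k \<Rightarrow> 'k" where
  "resolvent A z y = (THE x. (x, y + z \<cdot>\<^sub>C x) \<in> A)"

definition resolvent_set :: "('k::cinner_space \<times> 'k) set \<Rightarrow> complex set" where
  "resolvent_set A = {z. (\<forall>y. \<exists>!x. (x, y + z \<cdot>\<^sub>C x) \<in> A) \<and> cbounded (resolvent A z)}"

definition is_eigenvalue :: "('k::cinner_space \<times> 'k) set \<Rightarrow> complex \<Rightarrow> bool" where
  "is_eigenvalue A a \<longleftrightarrow> (\<exists>x. x \<noteq> 0 \<and> (x, a \<cdot>\<^sub>C x) \<in> A)"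

definition jordan_chain :: "('k::cinner_space \<times> 'k) set \<Rightarrow> complex \<Rightarrow> (nat \<Rightarrow> 'k) \<Rightarrow> nat \<Rightarrow> bool" where
  "jordan_chain A a x l \<longleftrightarrow> 0 < l \<and> x 0 \<noteq> 0 \<and> (x 0, a \<cdot>\<^sub>C x 0) \<in> A \<and>
     (\<forall>j. 1 \<le> j \<and> j < l \<longrightarrow> (x j, a \<cdot>\<^sub>C x j + x (j - 1)) \<in> A)"

definition min_realization ::
  "(complex \<Rightarrow> 'h::chilbert \<Rightarrow> 'h) \<Rightarrow> complex set \<Rightarrow> ('k::chilbert \<Rightarrow> 'k) \<Rightarrow> ('k \<times> 'k) set \<Rightarrow> complex \<Rightarrow>
    ('h \<Rightarrow> 'k) \<Rightarrow> ('k \<Rightarrow> 'h) \<Rightarrow> bool" where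
  "min_realization Q D J A z0 \<Gamma> Gp \<longleftrightarrow>
     fund_symmetry J \<and> selfadjoint_relation J A \<and>
     z0 \<in> resolvent_set A \<and> Im z0 > 0 \<and> z0 \<in> D \<and>
     cbounded \<Gamma> \<and> (\<forall>h x. kinner J (\<Gamma> h) x = cinner h (Gp x)) \<and>
     D \<subseteq> resolvent_set A \<and>
     (\<exists>Qs. (\<forall>h k. cinner (Qs h) k = cinner h (Q z0 k)) \<and>
        (\<forall>z\<in>D. \<forall>h. Q z h = Qs h + (z - cnj z0) \<cdot>\<^sub>C Gp (\<Gamma> h + (z - z0) \<cdot>\<^sub>C resolvent A z (\<Gamma> h)))) \<and>
     closure (cspan {\<Gamma> h + (z - z0) \<cdot>\<^sub>C resolvent A z (\<Gamma> h) | z h. z \<in> resolvent_set A}) = UNIV"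

text \<open>Generalized pole: eigenvalue of the representing relation of a minimal realization
(independent of the chosen minimal realization; realizations taken in Pontryagin spaces
of type \<open>'k\<close>).\<close>
definition gen_pole :: "'k::chilbert itself \<Rightarrow> (complex \<Rightarrow> 'h::chilbert \<Rightarrow> 'h) \<Rightarrow> complex set \<Rightarrow> real \<Rightarrow> bool" where
  "gen_pole (T::'k itself) Q D \<alpha> \<longleftrightarrow>
     (\<forall>(J::'k \<Rightarrow> 'k) A z0 \<Gamma> Gp. min_realization Q D J A z0 \<Gamma> Gp \<longrightarrow> is_eigenvalue A (complex_of_real \<alpha>))"

definition Qhat :: "(complex \<Rightarrow> 'h::cinner_space \<Rightarrow> 'h) \<Rightarrow> complex \<Rightarrow> 'h \<Rightarrow> 'h" where
  "Qhat Q z h = - (inv_into UNIV (Q z) h)"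

definition Dhat :: "(complex \<Rightarrow> 'h::cinner_space \<Rightarrow> 'h) \<Rightarrow> complex set \<Rightarrow> complex set" where
  "Dhat Q D = {z\<in>D. bdd_invertible (Q z)}"

definition gen_zero :: "'k::chilbert itself \<Rightarrow> (complex \<Rightarrow> 'h::chilbert \<Rightarrow> 'h) \<Rightarrow> complex set \<Rightarrow> real \<Rightarrow> bool" where
  "gen_zero T Q D \<alpha> \<longleftrightarrow> gen_pole T (Qhat Q) (Dhat Q D) \<alpha>"

definition stolz :: "real \<Rightarrow> real \<Rightarrow> complex set" where
  "stolz \<alpha> c = {z. Im z > 0 \<and> \<bar>Re z - \<alpha>\<bar> \<le> c * Im z}"

definition nt_wlim :: "(complex \<Rightarrow> 'h::cinner_space) \<Rightarrow> real \<Rightarrow> 'h \<Rightarrow> bool" where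
  "nt_wlim f \<alpha> v \<longleftrightarrow> (\<forall>c>0. \<forall>h. ((\<lambda>z. cinner (f z) h) \<longlongrightarrow> cinner v h) (at (complex_of_real \<alpha>) within stolz \<alpha> c))"

definition nt_bounded :: "(complex \<Rightarrow> complex) \<Rightarrow> real \<Rightarrow> bool" where
  "nt_bounded f \<alpha> \<longleftrightarrow> (\<forall>c>0. \<exists>M. eventually (\<lambda>z. norm (f z) \<le> M) (at (complex_of_real \<alpha>) within stolz \<alpha> c))"

definition nt_lim2_exists :: "(complex \<Rightarrow> complex \<Rightarrow> complex) \<Rightarrow> real \<Rightarrow> bool" where
  "nt_lim2_exists F \<alpha> \<longleftrightarrow> (\<exists>L. \<forall>c>0. ((\<lambda>(z, w). F z w) \<longlongrightarrow> L)
     (at (complex_of_real \<alpha>, complex_of_real \<alpha>) within stolz \<alpha> c \<times> stolz \<alpha> c))"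

definition hderiv :: "(complex \<Rightarrow> 'h::cinner_space) \<Rightarrow> complex \<Rightarrow> 'h" where
  "hderiv f z = (SOME v. ((\<lambda>w. inverse (w - z) \<cdot>\<^sub>C (f w - f z)) \<longlongrightarrow> v) (at z))"

definition hholomorphic_on :: "(complex \<Rightarrow> 'h::cinner_space) \<Rightarrow> complex set \<Rightarrow> bool" where
  "hholomorphic_on f S \<longleftrightarrow> (\<forall>z\<in>S. \<exists>v. ((\<lambda>w. inverse (w - z) \<cdot>\<^sub>C (f w - f z)) \<longlongrightarrow> v) (at z))"

fun hderivs :: "nat \<Rightarrow> (complex \<Rightarrow> 'h::cinner_space) \<Rightarrow> complex \<Rightarrow> 'h" where
  "hderivs 0 f = f"
| "hderivs (Suc j) f = hderiv (hderivs j f)"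

text \<open>\<open>\<partial>^{2j} / \<partial>z^j \<partial>\<bar>w^j\<close> of a function holomorphic in \<open>z\<close> and antiholomorphic in \<open>w\<close>.\<close>
definition mixed_deriv :: "nat \<Rightarrow> (complex \<Rightarrow> complex \<Rightarrow> complex) \<Rightarrow> complex \<Rightarrow> complex \<Rightarrow> complex" where
  "mixed_deriv j F z w = (deriv ^^ j) (\<lambda>z'. cnj ((deriv ^^ j) (\<lambda>w'. cnj (F z' w')) w)) z"

definition pcf_form :: "(complex \<Rightarrow> 'h::cinner_space \<Rightarrow> 'h) \<Rightarrow> (complex \<Rightarrow> 'h) \<Rightarrow> complex \<Rightarrow> complex \<Rightarrow> complex" where
  "pcf_form Q \<eta> z w = nev_kernel Q z w (\<eta> z) (\<eta> w)"

definition strong_pcf :: "(complex \<Rightarrow> 'h::cinner_space \<Rightarrow> 'h) \<Rightarrow> complex set \<Rightarrow> (complex \<Rightarrow> 'h) \<Rightarrow> real \<Rightarrow> nat \<Rightarrow> bool" where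
  "strong_pcf Q D \<eta> \<alpha> l \<longleftrightarrow>
     (\<exists>U. open U \<and> complex_of_real \<alpha> \<in> U \<and> U \<inter> {z. Im z > 0} \<subseteq> D \<and>
        hholomorphic_on \<eta> (U \<inter> {z. Im z > 0}) \<and>
        (\<forall>j<l.
           nt_wlim (hderivs j \<eta>) \<alpha> 0 \<and>
           (\<exists>v. nt_wlim (hderivs j (\<lambda>z. Q z (\<eta> z))) \<alpha> v \<and> (j = 0 \<longrightarrow> v \<noteq> 0)) \<and>
           nt_bounded (\<lambda>z. mixed_deriv j (pcf_form Q \<eta>) z z) \<alpha> \<and>
           nt_lim2_exists (mixed_deriv j (pcf_form Q \<eta>)) \<alpha>))"

end

theory Submission
  imports Defs "HOL-Complex_Analysis.Complex_Analysis"
begin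

text \<open>
  Let \<open>A2\<close> be the representing relation of a minimal realization of \<open>- Q(z)^-1\<close> that does not have
  the eigenvalue \<open>\<alpha>\<close>. Minimality and the equality of the kernels of \<open>Q\<close> and \<open>- Q^-1\<close> give a bounded
  isometry \<open>V\<close> between the two state spaces. Writing \<open>X z\<close> for the polynomial of the Jordan chain,
  one has \<open>(A - z) X z = - (z - \<alpha>)^l x (l - 1)\<close>, and \<open>V\<close> turns this into
  \<open>\<gamma>2 z (Q z (\<eta> z)) = V (X z) + (z - \<alpha>)^l r z\<close>, where \<open>r\<close> is built from resolvents of \<open>A2\<close>; likewise
  \<open>\<eta>\<close> is \<open>(z - \<alpha>)^l\<close> times such terms. Since \<open>\<alpha>\<close> is not an eigenvalue of \<open>A2\<close>, \<open>(z - \<alpha>) r z\<close> tends to 0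
  nontangentially, and Cauchy estimates on discs inside Stolz angles carry this over to the first
  \<open>l - 1\<close> derivatives. The kernel of \<open>Q\<close> on \<open>\<eta>\<close> is the inner product of the values of \<open>\<gamma>2 z (Q z (\<eta> z))\<close>,
  so its mixed derivatives converge.
\<close>

section \<open>Complex inner product spaces\<close>

text \<open>\<open>\<alpha>\<close> is an eigenvalue of \<open>A\<close>, so the growth estimate for
  resolvents does not apply to \<open>A\<close> there; the negated hypothesis supplies a second
  realization, on another space and with no given link to the first. The inverse function fits
  because \<open>Q z (\<eta> z)\<close> is a polynomial in \<open>z\<close>, and the kernel of
  \<open>Q\<close> at \<open>\<eta>\<close> equals the kernel of \<open>- Q^-1\<close> at that
  polynomial.

  Two Hilbert space facts fail in Pontryagin spaces: the bound \<open>1 / |Im z|\<close> for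
  resolvents and the boundedness of isometries. Substitutes for both come from one device. The
  squared norm is the indefinite square plus twice the squared norm of the negative part; the latter
  has finite rank, and its finitely many functionals may be replaced, at the cost of
  \<open>\<epsilon> * norm x\<close>, by inner products with vectors of any prescribed dense set.

  A further obstacle is that points where \<open>Q\<close> is undefined or not invertible might
  accumulate at \<open>\<alpha>\<close>. In the upper half plane all such points turn out to be
  eigenvalues of \<open>A\<close> or \<open>A2\<close>, of which there are finitely many.\<close>

interpretation cvs: vector_space "scaleC :: complex \<Rightarrow> 'a::cinner_space \<Rightarrow> 'a"
  by unfold_locales
    (simp_all add: scaleC_add_right scaleC_add_left scaleC_scaleC scaleC_one)

lemma cspan_eq_span: "cspan S = cvs.span S"
  unfolding cspan_def cvs.span_explicit by blast

lemma cinner_add_right: "cinner x (y + z) = cinner x y + cinner x z"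
  by (metis cinner_add_left cinner_commute complex_cnj_add)

lemma cinner_scaleC_right: "cinner x (a \<cdot>\<^sub>C y) = cnj a * cinner x y"
  by (metis cinner_commute cinner_scaleC_left complex_cnj_mult)

lemma cinner_zero_left [simp]: "cinner 0 y = 0"
  by (metis add_cancel_right_left cinner_add_left)

lemma cinner_zero_right [simp]: "cinner y 0 = 0"
  by (metis add_cancel_right_left cinner_add_right)

lemma cinner_minus_left: "cinner (- x) y = - cinner x y"
  by (metis add.inverse_unique add.right_inverse cinner_add_left cinner_zero_left)

lemma cinner_minus_right: "cinner x (- y) = - cinner x y"
  by (metis add.inverse_unique add.right_inverse cinner_add_right cinner_zero_right)

lemma cinner_diff_left: "cinner (x - y) z = cinner x z - cinner y z"
  using cinner_add_left[of x "- y" z] by (simp add: cinner_minus_left)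

lemma cinner_diff_right: "cinner z (x - y) = cinner z x - cinner z y"
  using cinner_add_right[of z x "- y"] by (simp add: cinner_minus_right)

lemma cinner_sum_left: "cinner (\<Sum>i\<in>I. f i) y = (\<Sum>i\<in>I. cinner (f i) y)"
  by (induction I rule: infinite_finite_induct) (simp_all add: cinner_add_left)

lemma cinner_sum_right: "cinner y (\<Sum>i\<in>I. f i) = (\<Sum>i\<in>I. cinner y (f i))"
  by (induction I rule: infinite_finite_induct) (simp_all add: cinner_add_right)

lemmas cinner_simps = cinner_add_left cinner_add_right cinner_diff_left cinner_diff_right
  cinner_minus_left cinner_minus_right cinner_scaleC_left cinner_scaleC_right

lemma cinner_self: "cinner x x = complex_of_real ((norm x)\<^sup>2)"
proof -
  have "Im (cinner x x) = 0"
    using arg_cong[OF cinner_commute[of x x], of Im] by simp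
  then show ?thesis
    by (simp add: norm_eq_sqrt_cinner cinner_ge_zero complex_eq_iff)
qed

lemma norm_scaleC: "norm (a \<cdot>\<^sub>C x) = cmod a * norm x"
proof -
  have "complex_of_real ((norm (a \<cdot>\<^sub>C x))\<^sup>2) = complex_of_real ((cmod a * norm x)\<^sup>2)"
    unfolding cinner_self[symmetric] cinner_scaleC_left cinner_scaleC_right
    by (simp add: cinner_self power_mult_distrib complex_norm_square del: of_real_power)
  then show ?thesis
    using power2_eq_iff_nonneg[of "norm (a \<cdot>\<^sub>C x)" "cmod a * norm x"] of_real_eq_iff
    by (simp del: of_real_power)
qed

text \<open>Cauchy-Schwarz needs only that the left-hand side is nonnegative; for the projection
  theorem the identity measures the gain from correcting an approximation along
  \<open>y\<close>.\<close>

lemma norm_diff_projection: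
  assumes "y \<noteq> 0"
  shows "(norm (x - (cinner x y / (norm y)\<^sup>2) \<cdot>\<^sub>C y))\<^sup>2
      = (norm x)\<^sup>2 - (cmod (cinner x y))\<^sup>2 / (norm y)\<^sup>2"
proof -
  define c where "c = cinner x y / (norm y)\<^sup>2"
  have ny: "(norm y)\<^sup>2 > 0" using assms by simp
  have "complex_of_real ((norm (x - c \<cdot>\<^sub>C y))\<^sup>2)
      = cinner x x - cnj c * cinner x y - c * cnj (cinner x y) + c * cnj c * cinner y y"
    unfolding cinner_self[of "x - c \<cdot>\<^sub>C y", symmetric]
    by (simp add: cinner_simps cinner_commute[of y x] algebra_simps)
  also have "\<dots> = complex_of_real ((norm x)\<^sup>2 - (cmod (cinner x y))\<^sup>2 / (norm y)\<^sup>2)"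
    using ny unfolding c_def cinner_self
    by (simp add: field_simps power2_eq_square complex_norm_square[unfolded power2_eq_square, symmetric])
  finally show ?thesis unfolding c_def of_real_eq_iff .
qed

lemma cinner_cauchy_schwarz: "cmod (cinner x y) \<le> norm x * norm y"
proof (cases "y = 0")
  case False
  then have ny: "(norm y)\<^sup>2 > 0" by simp
  have "(cmod (cinner x y))\<^sup>2 / (norm y)\<^sup>2 \<le> (norm x)\<^sup>2"
    using norm_diff_projection[OF False, of x] by (smt (verit) zero_le_power2)
  then have "(cmod (cinner x y))\<^sup>2 \<le> (norm x * norm y)\<^sup>2"
    using ny by (simp add: field_simps power_mult_distrib)
  then show ?thesis by (rule power2_le_imp_le) simp
qed simp

lemma bounded_bilinear_cinner: "bounded_bilinear (cinner :: 'a::cinner_space \<Rightarrow> 'a \<Rightarrow> complex)"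
proof
  show "\<exists>K. \<forall>a b :: 'a. cmod (cinner a b) \<le> norm a * norm b * K"
    using cinner_cauchy_schwarz by (intro exI[of _ 1]) auto
qed (simp_all add: cinner_simps scaleR_scaleC scaleR_conv_of_real)

lemma bounded_bilinear_scaleC: "bounded_bilinear (scaleC :: complex \<Rightarrow> 'a::cinner_space \<Rightarrow> 'a)"
proof
  show "\<exists>K. \<forall>a. \<forall>b :: 'a. norm (a \<cdot>\<^sub>C b) \<le> norm a * norm b * K"
    by (intro exI[of _ 1]) (simp add: norm_scaleC)
qed (simp_all add: scaleC_add_right scaleC_add_left scaleR_scaleC scaleC_scaleC scaleR_conv_of_real
    mult.commute)

lemmas tendsto_cinner = bounded_bilinear.tendsto[OF bounded_bilinear_cinner]
lemmas tendsto_scaleC = bounded_bilinear.tendsto[OF bounded_bilinear_scaleC]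

lemma cinner_eqI:
  fixes x y :: "'a::cinner_space"
  assumes "\<And>k. cinner x k = cinner y k"
  shows "x = y"
proof -
  have "cinner (x - y) (x - y) = 0" using assms by (simp add: cinner_diff_left)
  then show ?thesis by (simp add: cinner_eq_zero_iff)
qed

text \<open>Transfers estimates from scalar components to vectors; scalar Cauchy estimates become
  norm estimates this way.\<close>

lemma norm_le_cinnerI:
  fixes x :: "'a::cinner_space"
  assumes "0 \<le> B" "\<And>k. cmod (cinner x k) \<le> B * norm k"
  shows "norm x \<le> B"
proof (cases "x = 0")
  case False
  have "(norm x)\<^sup>2 \<le> B * norm x"
    using assms(2)[of x] by (simp add: cinner_self norm_power)
  then show ?thesis using False by (simp add: power2_eq_square)
qed (use assms in simp)

section \<open>Linear and bounded maps\<close>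

lemma clinearD:
  assumes "clinear T"
  shows "T (x + y) = T x + T y" "T (c \<cdot>\<^sub>C x) = c \<cdot>\<^sub>C T x" "T 0 = 0" "T (- x) = - T x"
    "T (x - y) = T x - T y"
proof -
  show a: "T (x + y) = T x + T y" and s: "T (c \<cdot>\<^sub>C x) = c \<cdot>\<^sub>C T x" for x y c
    using assms unfolding clinear_def by auto
  show "T 0 = 0" using s[of 0 0] by simp
  show m: "T (- x) = - T x" for x using s[of "-1" x] by simp
  show "T (x - y) = T x - T y" using a[of x "- y"] m by simp
qed

lemma clinear_sum: "clinear T \<Longrightarrow> T (\<Sum>i\<in>I. f i) = (\<Sum>i\<in>I. T (f i))"
  by (induction I rule: infinite_finite_induct) (simp_all add: clinearD)

lemma cbounded_clinear: "cbounded T \<Longrightarrow> clinear T"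
  by (simp add: cbounded_def)

lemmas cboundedD = clinearD[OF cbounded_clinear]

lemma cboundedI:
  assumes "\<And>x y. T (x + y) = T x + T y" "\<And>c x. T (c \<cdot>\<^sub>C x) = c \<cdot>\<^sub>C T x"
    "\<And>x. norm (T x) \<le> K * norm x"
  shows "cbounded T"
  using assms unfolding cbounded_def clinear_def by blast

lemma cbounded_boundE:
  assumes "cbounded T"
  obtains K where "K > 0" "\<And>x. norm (T x) \<le> K * norm x"
proof -
  from assms obtain K where K: "\<And>x. norm (T x) \<le> K * norm x" unfolding cbounded_def by auto
  have "norm (T x) \<le> (\<bar>K\<bar> + 1) * norm x" for x
    using K[of x] by (smt (verit) mult_right_mono norm_ge_zero)
  then show ?thesis using that[of "\<bar>K\<bar> + 1"] by auto
qed

lemma cbounded_bounded_linear: "cbounded T \<Longrightarrow> bounded_linear T"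
proof -
  assume T: "cbounded T"
  obtain K where "\<And>x. norm (T x) \<le> K * norm x" using cbounded_boundE[OF T] by metis
  then show ?thesis
    by (intro bounded_linear_intro[of T K])
      (simp_all add: cboundedD[OF T] scaleR_scaleC mult.commute)
qed

lemma cbounded_tendsto: "cbounded T \<Longrightarrow> (f \<longlongrightarrow> l) F \<Longrightarrow> ((\<lambda>x. T (f x)) \<longlongrightarrow> T l) F"
  using bounded_linear.tendsto[OF cbounded_bounded_linear] by blast

lemma cbounded_compose:
  assumes "cbounded S" "cbounded T"
  shows "cbounded (\<lambda>x. S (T x))"
proof -
  obtain K where K: "K > 0" "\<And>x. norm (S x) \<le> K * norm x" using cbounded_boundE[OF assms(1)] by metis
  obtain L where L: "L > 0" "\<And>x. norm (T x) \<le> L * norm x" using cbounded_boundE[OF assms(2)] by metis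
  have "norm (S (T x)) \<le> (K * L) * norm x" for x
    using K(2)[of "T x"] mult_left_mono[OF L(2)[of x], of K] K(1)
    by (simp only: mult.assoc) linarith
  then show ?thesis
    by (intro cboundedI) (simp_all add: cboundedD[OF assms(1)] cboundedD[OF assms(2)])
qed

lemma cbounded_add:
  assumes "cbounded S" "cbounded T"
  shows "cbounded (\<lambda>x. S x + T x)"
proof -
  obtain K where K: "K > 0" "\<And>x. norm (S x) \<le> K * norm x" using cbounded_boundE[OF assms(1)] by metis
  obtain L where L: "L > 0" "\<And>x. norm (T x) \<le> L * norm x" using cbounded_boundE[OF assms(2)] by metis
  have "norm (S x + T x) \<le> (K + L) * norm x" for x
    using norm_triangle_ineq[of "S x" "T x"] K(2)[of x] L(2)[of x] by (simp add: distrib_right)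
  then show ?thesis
    by (intro cboundedI) (simp_all add: cboundedD[OF assms(1)] cboundedD[OF assms(2)] scaleC_add_right)
qed

lemma cbounded_scaleC: "cbounded T \<Longrightarrow> cbounded (\<lambda>x. a \<cdot>\<^sub>C T x)"
proof -
  assume T: "cbounded T"
  obtain K where K: "K > 0" "\<And>x. norm (T x) \<le> K * norm x" using cbounded_boundE[OF T] by metis
  have "norm (a \<cdot>\<^sub>C T x) \<le> (cmod a * K) * norm x" for x
    using mult_left_mono[OF K(2)[of x], of "cmod a"] by (simp add: norm_scaleC mult.assoc)
  then show ?thesis
    by (intro cboundedI[where K = "cmod a * K"])
      (simp_all add: cboundedD[OF T] scaleC_add_right scaleC_scaleC mult.commute)
qed

lemma cbounded_diff: "cbounded S \<Longrightarrow> cbounded T \<Longrightarrow> cbounded (\<lambda>x. S x - T x)"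
  using cbounded_add[of S "\<lambda>x. (-1) \<cdot>\<^sub>C T x"] cbounded_scaleC[of T "-1"] by simp

section \<open>Orthogonality and Riesz representation\<close>

lemma parallelogram_law:
  fixes x y :: "'a::cinner_space"
  shows "(norm (x + y))\<^sup>2 + (norm (x - y))\<^sup>2 = 2 * (norm x)\<^sup>2 + 2 * (norm y)\<^sup>2"
proof -
  have "complex_of_real ((norm (x + y))\<^sup>2 + (norm (x - y))\<^sup>2)
      = complex_of_real (2 * (norm x)\<^sup>2 + 2 * (norm y)\<^sup>2)"
    unfolding of_real_add of_real_mult cinner_self[symmetric] by (simp add: cinner_simps)
  then show ?thesis unfolding of_real_eq_iff .
qed

lemma exists_orthogonal_to_closed_subspace:
  fixes S :: "'a::chilbert set"
  assumes cl: "closed S" and sub: "cvs.subspace S" and xS: "x \<notin> S"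
  obtains y where "y \<noteq> 0" "x - y \<in> S" "\<And>s. s \<in> S \<Longrightarrow> cinner s y = 0"
proof -
  have 0: "0 \<in> S" using sub cvs.subspace_0 by blast
  define d where "d = infdist x S"
  have dle: "d \<le> dist x s" if "s \<in> S" for s unfolding d_def using that by (rule infdist_le)
  have d0: "d \<ge> 0" unfolding d_def by (rule infdist_nonneg)
  have "\<exists>s\<in>S. dist x s < d + 1 / Suc n" for n
  proof -
    have "d = Inf (dist x ` S)" using 0 by (auto simp: d_def infdist_def)
    then have "Inf (dist x ` S) < d + 1 / Suc n" by simp
    then show ?thesis using cInf_lessD[of "dist x ` S"] 0 by blast
  qed
  then obtain s where s: "\<And>n. s n \<in> S" "\<And>n. dist x (s n) < d + 1 / Suc n" by metis
  \<comment> \<open>Parallelogram law for \<open>x - s m\<close> and \<open>x - s n\<close>: their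
    sum is twice the difference of \<open>x\<close> and a midpoint, which lies in \<open>S\<close>
    and hence has distance at least \<open>d\<close> from \<open>x\<close>.\<close>
  have key: "(dist (s m) (s n))\<^sup>2 \<le> 2 * (dist x (s m))\<^sup>2 + 2 * (dist x (s n))\<^sup>2 - 4 * d\<^sup>2" for m n
  proof -
    have mid: "(1/2) \<cdot>\<^sub>C (s m + s n) \<in> S" using s(1) sub by (simp add: cvs.subspace_add cvs.subspace_scale)
    have "(x - s m) + (x - s n) = 2 \<cdot>\<^sub>C (x - (1/2) \<cdot>\<^sub>C (s m + s n))"
      using scaleC_add_left[of 1 1 x]
      by (simp add: cvs.scale_right_diff_distrib scaleC_scaleC scaleC_one)
    then have "norm ((x - s m) + (x - s n)) = 2 * dist x ((1/2) \<cdot>\<^sub>C (s m + s n))"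
      by (simp add: norm_scaleC dist_norm)
    then have "norm ((x - s m) + (x - s n)) \<ge> 2 * d" using dle[OF mid] by simp
    then have "(2 * d)\<^sup>2 \<le> (norm ((x - s m) + (x - s n)))\<^sup>2" using d0 by (intro power_mono) auto
    moreover have "(x - s m) - (x - s n) = s n - s m" by simp
    ultimately show ?thesis
      using parallelogram_law[of "x - s m" "x - s n"]
      by (simp add: dist_norm norm_minus_commute power_mult_distrib)
  qed
  have lim: "(\<lambda>n. dist x (s n)) \<longlonglongrightarrow> d"
  proof (rule tendsto_sandwich[of "\<lambda>_. d" _ _ "\<lambda>n. d + 1 / Suc n"])
    show "(\<lambda>n. d + 1 / real (Suc n)) \<longlonglongrightarrow> d"
      using tendsto_add[OF tendsto_const[of d] LIMSEQ_Suc[OF lim_1_over_n]] by simp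
  qed (use dle s in \<open>auto intro!: always_eventually less_imp_le\<close>)
  have "Cauchy s"
  proof (rule metric_CauchyI)
    fix e :: real assume e: "e > 0"
    have "(\<lambda>n. (dist x (s n))\<^sup>2) \<longlonglongrightarrow> d\<^sup>2" using lim by (rule tendsto_power)
    moreover have "d\<^sup>2 < d\<^sup>2 + e\<^sup>2 / 4" using e by simp
    ultimately have "eventually (\<lambda>n. (dist x (s n))\<^sup>2 < d\<^sup>2 + e\<^sup>2 / 4) sequentially"
      by (rule order_tendstoD(2))
    then obtain M where M: "\<And>n. n \<ge> M \<Longrightarrow> (dist x (s n))\<^sup>2 < d\<^sup>2 + e\<^sup>2 / 4"
      unfolding eventually_sequentially by blast
    have "dist (s m) (s n) < e" if "m \<ge> M" "n \<ge> M" for m n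
    proof -
      have "(dist (s m) (s n))\<^sup>2 < e\<^sup>2" using key[of m n] M[OF that(1)] M[OF that(2)] by simp
      then show ?thesis using e by (simp add: power_less_imp_less_base)
    qed
    then show "\<exists>M. \<forall>m\<ge>M. \<forall>n\<ge>M. dist (s m) (s n) < e" by blast
  qed
  then obtain t where t: "s \<longlonglongrightarrow> t" using Cauchy_convergent_iff convergent_def by metis
  have tS: "t \<in> S" using closed_sequentially[OF cl] s(1) t by blast
  have "(\<lambda>n. dist x (s n)) \<longlonglongrightarrow> dist x t" using t by (intro tendsto_dist tendsto_const)
  then have dt: "dist x t = d" using lim LIMSEQ_unique by blast
  define y where "y = x - t"
  have orth: "cinner v y = 0" if v: "v \<in> S" for v
  proof (cases "v = 0")
    case False
    \<comment> \<open>This \<open>c\<close> gives the best correction of \<open>t\<close> along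
      \<open>v\<close>. As \<open>t\<close> is already optimal in \<open>S\<close>, the gain in
      \<open>norm_diff_projection\<close> must vanish.\<close>
    define c where "c = cinner y v / (norm v)\<^sup>2"
    have nv: "(norm v)\<^sup>2 > 0" using False by simp
    have "t + c \<cdot>\<^sub>C v \<in> S" using tS v sub by (simp add: cvs.subspace_add cvs.subspace_scale)
    then have "norm y \<le> norm (y - c \<cdot>\<^sub>C v)"
      using dle dt unfolding y_def dist_norm by (metis diff_diff_eq)
    then have le: "(norm y)\<^sup>2 \<le> (norm (y - c \<cdot>\<^sub>C v))\<^sup>2" by (intro power_mono) auto
    have "(norm (y - c \<cdot>\<^sub>C v))\<^sup>2 = (norm y)\<^sup>2 - (cmod (cinner y v))\<^sup>2 / (norm v)\<^sup>2"
      unfolding c_def by (rule norm_diff_projection[OF False])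
    then have "(cmod (cinner y v))\<^sup>2 / (norm v)\<^sup>2 \<le> 0" using le by simp
    then have "cinner y v = 0" using nv by (simp add: divide_le_0_iff)
    then show ?thesis by (metis cinner_commute complex_cnj_zero)
  qed simp
  show ?thesis
  proof (rule that[of y])
    show "y \<noteq> 0" using tS xS unfolding y_def by auto
    show "x - y \<in> S" using tS unfolding y_def by simp
  qed (rule orth)
qed

lemma subspace_closure:
  fixes S :: "'a::cinner_space set"
  assumes "cvs.subspace S"
  shows "cvs.subspace (closure S)"
  unfolding cvs.subspace_def
proof (intro conjI ballI allI)
  show "0 \<in> closure S" using assms cvs.subspace_0 closure_subset by blast
next
  fix x y assume "x \<in> closure S" "y \<in> closure S"
  then obtain f g where "\<forall>n. f n \<in> S" "f \<longlonglongrightarrow> x" "\<forall>n. g n \<in> S" "g \<longlonglongrightarrow> y"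
    unfolding closure_sequential by blast
  then have "(\<forall>n. f n + g n \<in> S) \<and> (\<lambda>n. f n + g n) \<longlonglongrightarrow> x + y"
    using assms by (simp add: cvs.subspace_add tendsto_add)
  then show "x + y \<in> closure S" unfolding closure_sequential by - (rule exI[of _ "\<lambda>n. f n + g n"])
next
  fix c x assume "x \<in> closure S"
  then obtain f where "\<forall>n. f n \<in> S" "f \<longlonglongrightarrow> x" unfolding closure_sequential by blast
  then have "(\<forall>n. c \<cdot>\<^sub>C f n \<in> S) \<and> (\<lambda>n. c \<cdot>\<^sub>C f n) \<longlonglongrightarrow> c \<cdot>\<^sub>C x"
    using assms by (simp add: cvs.subspace_scale tendsto_scaleC)
  then show "c \<cdot>\<^sub>C x \<in> closure S" unfolding closure_sequential
    by - (rule exI[of _ "\<lambda>n. c \<cdot>\<^sub>C f n"])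
qed

lemma closure_subspace_eq_UNIV:
  fixes S :: "'a::chilbert set"
  assumes sub: "cvs.subspace S" and orth: "\<And>y. (\<And>s. s \<in> S \<Longrightarrow> cinner s y = 0) \<Longrightarrow> y = 0"
  shows "closure S = UNIV"
proof (rule ccontr)
  assume "closure S \<noteq> UNIV"
  then obtain x where x: "x \<notin> closure S" by blast
  obtain y where "y \<noteq> 0" "\<And>s. s \<in> closure S \<Longrightarrow> cinner s y = 0"
    using exists_orthogonal_to_closed_subspace[OF closed_closure subspace_closure[OF sub] x]
    by metis
  then show False using orth closure_subset by blast
qed

lemma orthogonal_dense_eq_0:
  fixes S :: "'a::cinner_space set"
  assumes "closure S = UNIV" "\<And>s. s \<in> S \<Longrightarrow> cinner s y = 0"
  shows "y = 0"
proof -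
  have "y \<in> closure S" using assms by simp
  then obtain f where f: "\<forall>n. f n \<in> S" "f \<longlonglongrightarrow> y" unfolding closure_sequential by blast
  have "(\<lambda>n. cinner (f n) y) \<longlonglongrightarrow> cinner y y" using f by (intro tendsto_cinner tendsto_const)
  moreover have "(\<lambda>n. cinner (f n) y) = (\<lambda>_. 0)" using f assms by auto
  ultimately have "cinner y y = 0" by (metis LIMSEQ_const_iff)
  then show ?thesis by (simp add: cinner_eq_zero_iff)
qed

lemma riesz_representation:
  fixes \<phi> :: "'a::chilbert \<Rightarrow> complex"
  assumes add: "\<And>x y. \<phi> (x + y) = \<phi> x + \<phi> y" and sc: "\<And>c x. \<phi> (c \<cdot>\<^sub>C x) = c * \<phi> x"
    and bd: "\<And>x. cmod (\<phi> x) \<le> K * norm x"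
  obtains v where "\<And>x. \<phi> x = cinner x v"
proof (cases "\<forall>x. \<phi> x = 0")
  case True
  then show ?thesis using that[of 0] by simp
next
  case False
  then obtain a where a: "\<phi> a \<noteq> 0" by blast
  define S where "S = {x. \<phi> x = 0}"
  have "bounded_linear \<phi>"
    using bd by (intro bounded_linear_intro[of _ K])
      (simp_all add: add sc scaleR_scaleC scaleR_conv_of_real mult.commute)
  then have cont: "continuous_on UNIV \<phi>" by (rule linear_continuous_on)
  have "closed S" unfolding S_def using cont by (intro closed_Collect_eq) auto
  moreover have "cvs.subspace S" unfolding cvs.subspace_def S_def
    using sc[of 0 0] by (auto simp: add sc)
  moreover have "a \<notin> S" using a by (simp add: S_def)
  ultimately obtain y where y: "y \<noteq> 0" "a - y \<in> S" "\<And>s. s \<in> S \<Longrightarrow> cinner s y = 0"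
    using exists_orthogonal_to_closed_subspace by metis
  have py: "\<phi> y = \<phi> a" using y(2) add[of "a - y" y] by (simp add: S_def)
  \<comment> \<open>The kernel of \<open>\<phi>\<close> has codimension one and \<open>y\<close>
    spans its orthogonal complement; the factor is conjugated because \<open>cinner\<close> is
    antilinear in its second argument.\<close>
  define v where "v = cnj (\<phi> y / cinner y y) \<cdot>\<^sub>C y"
  have yy: "cinner y y \<noteq> 0" using y(1) by (simp add: cinner_eq_zero_iff)
  have "\<phi> x = cinner x v" for x
  proof -
    have diff: "\<phi> (p - q) = \<phi> p - \<phi> q" for p q using add[of "p - q" q] by simp
    have "x - (\<phi> x / \<phi> y) \<cdot>\<^sub>C y \<in> S" using a py by (simp add: S_def diff sc)
    from y(3)[OF this] have "cinner x y = (\<phi> x / \<phi> y) * cinner y y"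
      unfolding cinner_diff_left cinner_scaleC_left by simp
    then show ?thesis using yy a py unfolding v_def by (simp add: cinner_scaleC_right)
  qed
  then show ?thesis by (rule that)
qed

lemma cbounded_adjoint_exists:
  fixes T :: "'a::chilbert \<Rightarrow> 'b::cinner_space"
  assumes T: "cbounded T"
  obtains T' where "cbounded T'" "\<And>x y. cinner (T x) y = cinner x (T' y)"
proof -
  obtain K where K: "K > 0" "\<And>x. norm (T x) \<le> K * norm x" using cbounded_boundE[OF T] by metis
  have bd: "cmod (cinner (T x) y) \<le> (K * norm y) * norm x" for x y
    using cinner_cauchy_schwarz[of "T x" y] mult_right_mono[OF K(2)[of x], of "norm y"]
    by (simp add: mult_ac)
  have "\<exists>v. \<forall>x. cinner (T x) y = cinner x v" for y
    by (rule riesz_representation[of "\<lambda>x. cinner (T x) y" "K * norm y"])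
      (use bd in \<open>auto simp: cboundedD[OF T] cinner_simps\<close>)
  then obtain T' where T': "\<And>x y. cinner (T x) y = cinner x (T' y)" by metis
  have eq: "u = v" if "\<And>x. cinner x u = cinner x v" for u v :: 'a
    by (rule cinner_eqI) (metis that cinner_commute)
  have "cbounded T'"
  proof (rule cboundedI)
    show "T' (x + y) = T' x + T' y" for x y
      by (rule eq) (simp add: cinner_add_right flip: T')
    show "T' (c \<cdot>\<^sub>C x) = c \<cdot>\<^sub>C T' x" for c x
      by (rule eq) (simp add: cinner_scaleC_right flip: T')
    show "norm (T' y) \<le> K * norm y" for y
    proof (rule norm_le_cinnerI)
      show "cmod (cinner (T' y) k) \<le> K * norm y * norm k" for k
        using bd[of k y] cinner_commute[of "T' y" k] by (simp add: T')
    qed (use K in simp)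
  qed
  then show ?thesis using that T' by blast
qed

section \<open>Self-adjoint relations in Pontryagin spaces\<close>

lemma orthonormal_expansion:
  assumes "finite E" "\<And>e f. e \<in> E \<Longrightarrow> f \<in> E \<Longrightarrow> cinner e f = (if e = f then 1 else 0)"
    and "v \<in> cspan E"
  shows "v = (\<Sum>e\<in>E. cinner v e \<cdot>\<^sub>C e)"
proof -
  obtain c where c: "v = (\<Sum>e\<in>E. c e \<cdot>\<^sub>C e)"
    using assms(1,3) unfolding cspan_eq_span cvs.span_finite[OF assms(1)] by blast
  have "cinner v e = c e" if "e \<in> E" for e
    using that assms(1,2) unfolding c
    by (simp add: cinner_sum_left cinner_scaleC_left if_distrib[of "(*) _"] cong: if_cong)
  then show ?thesis using c by simp
qed

lemma gram_schmidt:
  fixes F :: "'a::cinner_space set"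
  assumes "finite F"
  shows "\<exists>E. finite E \<and> F \<subseteq> cspan E \<and> (\<forall>e\<in>E. \<forall>f\<in>E. cinner e f = (if e = f then 1 else 0))"
  using assms
proof (induction F)
  case empty
  show ?case by (intro exI[of _ "{}"]) simp
next
  case (insert v F)
  then obtain E where E: "finite E" "F \<subseteq> cspan E"
    "\<And>e f. e \<in> E \<Longrightarrow> f \<in> E \<Longrightarrow> cinner e f = (if e = f then 1 else 0)" by blast
  define p where "p = (\<Sum>e\<in>E. cinner v e \<cdot>\<^sub>C e)"
  define u where "u = v - p"
  have p: "p \<in> cspan E" unfolding p_def cspan_eq_span
    by (intro cvs.span_sum cvs.span_scale cvs.span_base)
  have ort: "cinner u e = 0" if "e \<in> E" for e
    using that E(1,3) unfolding u_def p_def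
    by (simp add: cinner_diff_left cinner_sum_left cinner_scaleC_left if_distrib[of "(*) _"] cong: if_cong)
  then have ort': "cinner e u = 0" if "e \<in> E" for e using that by (metis cinner_commute complex_cnj_zero)
  show ?case
  proof (cases "u = 0")
    case True
    then show ?thesis using E p unfolding u_def by (intro exI[of _ E]) auto
  next
    case False
    define w where "w = complex_of_real (inverse (norm u)) \<cdot>\<^sub>C u"
    have ww: "cinner w w = 1"
      using False unfolding w_def cinner_simps by (simp add: cinner_self power2_eq_square field_simps)
    have "u = complex_of_real (norm u) \<cdot>\<^sub>C w"
      using False by (simp add: w_def scaleC_scaleC scaleC_one flip: of_real_mult)
    then have v: "v = complex_of_real (norm u) \<cdot>\<^sub>C w + p" by (simp add: u_def)
    have "v \<in> cspan (insert w E)" unfolding cspan_eq_span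
    proof (subst v, rule cvs.span_add)
      show "complex_of_real (norm u) \<cdot>\<^sub>C w \<in> cvs.span (insert w E)"
        by (intro cvs.span_scale cvs.span_base) simp
      show "p \<in> cvs.span (insert w E)"
        using p cvs.span_mono[of E "insert w E"] unfolding cspan_eq_span by blast
    qed
    moreover have "F \<subseteq> cspan (insert w E)"
      using E(2) cvs.span_mono[of E "insert w E"] unfolding cspan_eq_span by blast
    moreover have "cinner w e = 0" "cinner e w = 0" if "e \<in> E" for e
      using that ort ort' by (simp_all add: w_def cinner_simps)
    moreover have "w \<notin> E" using ww \<open>\<And>e. e \<in> E \<Longrightarrow> cinner w e = 0\<close> by force
    ultimately show ?thesis
      using E(1,3) ww by (intro exI[of _ "insert w E"]) auto
  qed
qed

text \<open>Formulated for indexed families because different indices may a priori give the same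
  vector; here they will be negative parts of different eigenvectors.\<close>

lemma independent_family_card_le:
  fixes v :: "'i \<Rightarrow> 'a::cinner_space"
  assumes I: "finite I" and F: "finite F" "v ` I \<subseteq> cspan F"
    and ind: "\<And>c. (\<Sum>i\<in>I. c i \<cdot>\<^sub>C v i) = 0 \<Longrightarrow> \<forall>i\<in>I. c i = 0"
  shows "card I \<le> card F"
proof -
  have inj: "inj_on v I"
  proof (rule inj_onI, rule ccontr)
    fix i j assume ij: "i \<in> I" "j \<in> I" "v i = v j" "i \<noteq> j"
    define c :: "'i \<Rightarrow> complex" where "c k = (if k = i then 1 else if k = j then - 1 else 0)" for k
    have "(\<Sum>k\<in>I. c k \<cdot>\<^sub>C v k) = (\<Sum>k\<in>I. (if k = i then v i else 0) - (if k = j then v j else 0))"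
      using ij by (intro sum.cong) (auto simp: c_def scaleC_one)
    also have "\<dots> = 0" using I ij by (simp add: sum_subtractf)
    finally have "c i = 0" using ind ij by blast
    then show False by (simp add: c_def)
  qed
  have "cvs.independent (v ` I)"
  proof
    assume "cvs.dependent (v ` I)"
    then obtain c i where c: "(\<Sum>x\<in>v ` I. c x \<cdot>\<^sub>C x) = 0" "i \<in> I" "c (v i) \<noteq> 0"
      using cvs.dependent_finite[of "v ` I"] I by auto
    then show False using ind[of "\<lambda>i. c (v i)"] by (simp add: sum.reindex[OF inj])
  qed
  then have "card (v ` I) \<le> card F"
    using cvs.independent_span_bound[OF F(1)] F(2) unfolding cspan_eq_span by blast
  then show ?thesis by (simp add: card_image[OF inj])
qed

section \<open>The indefinite inner product and its finite-rank negative part\<close>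

locale pontryagin_space =
  fixes J :: "'k::chilbert \<Rightarrow> 'k"
  assumes fund: "fund_symmetry J"
begin

lemma J: "cbounded J" "J (J x) = x" "cinner (J x) y = cinner x (J y)"
  using fund unfolding fund_symmetry_def by auto

lemma norm_J [simp]: "norm (J x) = norm x"
  using J(2,3) by (simp add: norm_eq_sqrt_cinner)

lemma kinner_simps:
  "kinner J (x + y) z = kinner J x z + kinner J y z"
  "kinner J z (x + y) = kinner J z x + kinner J z y"
  "kinner J (x - y) z = kinner J x z - kinner J y z"
  "kinner J z (x - y) = kinner J z x - kinner J z y"
  "kinner J (a \<cdot>\<^sub>C x) z = a * kinner J x z"
  "kinner J z (a \<cdot>\<^sub>C x) = cnj a * kinner J z x"
  "kinner J 0 z = 0" "kinner J z 0 = 0"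
  by (simp_all add: kinner_def cboundedD[OF J(1)] cinner_simps)

lemma kinner_sum_left: "kinner J (\<Sum>i\<in>I. f i) y = (\<Sum>i\<in>I. kinner J (f i) y)"
  by (simp add: kinner_def clinear_sum[OF cbounded_clinear[OF J(1)]] cinner_sum_left)

lemma kinner_sum_right: "kinner J y (\<Sum>i\<in>I. f i) = (\<Sum>i\<in>I. kinner J y (f i))"
  by (simp add: kinner_def cinner_sum_right)

lemma kinner_commute: "kinner J y x = cnj (kinner J x y)"
  unfolding kinner_def by (metis J(3) cinner_commute)

lemma kinner_bound: "cmod (kinner J x y) \<le> norm x * norm y"
  unfolding kinner_def using cinner_cauchy_schwarz[of "J x" y] by simp

lemma cinner_eq_kinner: "cinner x y = kinner J x (J y)"
  by (simp add: kinner_def J)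

lemma tendsto_kinner:
  "(f \<longlongrightarrow> x) F \<Longrightarrow> (g \<longlongrightarrow> y) F \<Longrightarrow> ((\<lambda>t. kinner J (f t) (g t)) \<longlongrightarrow> kinner J x y) F"
  unfolding kinner_def by (intro tendsto_cinner cbounded_tendsto[OF J(1)])

text \<open>Nondegeneracy of the form, since \<open>J\<close> is invertible. Vector identities in
  the state spaces are verified by testing against a family with dense span.\<close>

lemma kinner_dense_eqI:
  assumes "closure (cspan S) = UNIV" "\<And>s. s \<in> S \<Longrightarrow> kinner J x s = kinner J y s"
  shows "x = y"
proof -
  have "cinner s (J (x - y)) = 0" if "s \<in> cspan S" for s
  proof -
    from that obtain F c where F: "F \<subseteq> S" "s = (\<Sum>s\<in>F. c s \<cdot>\<^sub>C s)" unfolding cspan_def by blast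
    have "kinner J (x - y) s = 0"
      unfolding F(2) kinner_sum_right using F(1) assms(2)
      by (intro sum.neutral) (auto simp: kinner_simps)
    then show ?thesis using kinner_commute[of s "x - y"] J by (simp add: kinner_def)
  qed
  from orthogonal_dense_eq_0[OF assms(1) this] have "J (J (x - y)) = J 0" by simp
  then show ?thesis by (simp add: J cboundedD[OF J(1)])
qed

text \<open>The orthogonal projection onto the eigenspace of \<open>J\<close> at \<open>-1\<close>,
  which is finite dimensional.\<close>

definition neg_part :: "'k \<Rightarrow> 'k" where
  "neg_part x = (1/2) \<cdot>\<^sub>C (x - J x)"

lemma kinner_self: "kinner J x x = complex_of_real ((norm x)\<^sup>2 - 2 * (norm (neg_part x))\<^sup>2)"
proof -
  have "complex_of_real ((norm (neg_part x))\<^sup>2) = (1/4) * (cinner x x - kinner J x x - kinner J x x + cinner x x)"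
    unfolding cinner_self[of "neg_part x", symmetric]
    using J(3)[of x x] J(3)[of x "J x"] J(2)[of x]
    by (simp add: neg_part_def cinner_simps kinner_def field_simps)
  moreover have "kinner J x x
      = cinner x x - 2 * ((1/4) * (cinner x x - kinner J x x - kinner J x x + cinner x x))"
    by (simp add: field_simps)
  ultimately have "kinner J x x = cinner x x - 2 * complex_of_real ((norm (neg_part x))\<^sup>2)"
    by (simp only:)
  then show ?thesis by (simp add: cinner_self)
qed

lemma norm_eq_kinner_neg_part: "(norm x)\<^sup>2 = Re (kinner J x x) + 2 * (norm (neg_part x))\<^sup>2"
  by (simp add: kinner_self)

text \<open>The negative part is expanded in an orthonormal set whose span contains the negative
  eigenspace; \<open>g e\<close> turns each coefficient into an indefinite inner product with
  \<open>x\<close>.\<close>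

lemma neg_part_finite:
  obtains E :: "'k set" and g :: "'k \<Rightarrow> 'k" where "finite E"
    "\<And>x. norm (neg_part x) \<le> (\<Sum>e\<in>E. cmod (kinner J x (g e)))"
proof -
  obtain F where F: "finite F" "{x. J x = - x} \<subseteq> cspan F"
    using fund unfolding fund_symmetry_def by blast
  obtain E where E: "finite E" "F \<subseteq> cspan E"
    "\<And>e f. e \<in> E \<Longrightarrow> f \<in> E \<Longrightarrow> cinner e f = (if e = f then 1 else 0)"
    using gram_schmidt[OF F(1)] by blast
  have FE: "cspan F \<subseteq> cspan E"
    using E(2) unfolding cspan_eq_span by (simp add: cvs.span_minimal)
  define g where "g e = J (neg_part e)" for e
  have "norm (neg_part x) \<le> (\<Sum>e\<in>E. cmod (kinner J x (g e)))" for x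
  proof -
    have "J (neg_part x) = - neg_part x"
      by (simp add: neg_part_def cboundedD[OF J(1)] J flip: cvs.scale_minus_right)
    then have "neg_part x = (\<Sum>e\<in>E. cinner (neg_part x) e \<cdot>\<^sub>C e)"
      using orthonormal_expansion[OF E(1,3)] F(2) FE by blast
    also have "norm \<dots> \<le> (\<Sum>e\<in>E. norm (cinner (neg_part x) e \<cdot>\<^sub>C e))" by (rule norm_sum)
    also have "\<dots> = (\<Sum>e\<in>E. cmod (kinner J x (g e)))"
    proof (rule sum.cong)
      fix e assume "e \<in> E"
      then have "norm e = 1" using E(3)[of e e] by (simp add: norm_eq_sqrt_cinner)
      moreover have "cinner (neg_part x) e = kinner J x (g e)"
        by (simp add: neg_part_def g_def kinner_def cinner_simps J cboundedD[OF J(1)])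
      ultimately show "norm (cinner (neg_part x) e \<cdot>\<^sub>C e) = cmod (kinner J x (g e))"
        by (simp add: norm_scaleC)
    qed simp
    finally show ?thesis .
  qed
  then show ?thesis by (rule that[OF E(1)])
qed

text \<open>Each of the finitely many vectors \<open>g e\<close> is approximated from
  \<open>L\<close>. The benefit is that \<open>L\<close> can be chosen so that inner products with
  its vectors are computable.\<close>

lemma neg_part_dense_bound:
  assumes L: "closure L = UNIV" and \<epsilon>: "\<epsilon> > 0"
  obtains E :: "'k set" and b :: "'k \<Rightarrow> 'k" where "finite E" "\<And>e. e \<in> E \<Longrightarrow> b e \<in> L"
    "\<And>x. norm (neg_part x) \<le> \<epsilon> * norm x + (\<Sum>e\<in>E. cmod (kinner J x (b e)))"
proof -
  obtain E :: "'k set" and g where E: "finite E"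
    "\<And>x. norm (neg_part x) \<le> (\<Sum>e\<in>E. cmod (kinner J x (g e)))" using neg_part_finite by metis
  \<comment> \<open>An equal share of \<open>\<epsilon>\<close> for each vector of \<open>E\<close>;
    the \<open>+ 1\<close> covers an empty \<open>E\<close>.\<close>
  define \<delta> where "\<delta> = \<epsilon> / (card E + 1)"
  have \<delta>: "\<delta> > 0" using \<epsilon> by (simp add: \<delta>_def)
  have "\<exists>b\<in>L. dist b (g e) < \<delta>" for e
    using L \<delta> closure_approachable[of "g e" L] by auto
  then obtain b where b: "\<And>e. b e \<in> L" "\<And>e. dist (b e) (g e) < \<delta>" by metis
  have "norm (neg_part x) \<le> \<epsilon> * norm x + (\<Sum>e\<in>E. cmod (kinner J x (b e)))" for x
  proof -
    have "cmod (kinner J x (g e)) \<le> \<delta> * norm x + cmod (kinner J x (b e))" for e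
    proof -
      have "kinner J x (g e) = kinner J x (g e - b e) + kinner J x (b e)" by (simp add: kinner_simps)
      then have "cmod (kinner J x (g e)) \<le> cmod (kinner J x (g e - b e)) + cmod (kinner J x (b e))"
        by (metis norm_triangle_ineq)
      moreover have "cmod (kinner J x (g e - b e)) \<le> norm x * \<delta>"
        using kinner_bound[of x "g e - b e"] mult_left_mono[of "norm (g e - b e)" \<delta> "norm x"] b(2)[of e]
        by (auto simp: dist_norm norm_minus_commute)
      ultimately show ?thesis by (simp add: mult.commute)
    qed
    then have "norm (neg_part x) \<le> (\<Sum>e\<in>E. \<delta> * norm x + cmod (kinner J x (b e)))"
      by (intro order_trans[OF E(2)] sum_mono)
    also have "\<dots> = (card E * \<delta>) * norm x + (\<Sum>e\<in>E. cmod (kinner J x (b e)))"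
      by (simp add: sum.distrib)
    also have "card E * \<delta> \<le> \<epsilon>" using \<epsilon> by (simp add: \<delta>_def field_simps)
    finally show ?thesis by (simp add: mult_right_mono)
  qed
  then show ?thesis using that E(1) b(1) by blast
qed

end

text \<open>Meant for \<open>X\<close> the norm of a vector: the first summand bounds its indefinite
  square, the second twice the squared norm of its negative part. The weight \<open>1 / 4\<close> on
  \<open>X\<close> is small enough for absorption: if the claim failed, the right-hand side would be
  at most \<open>17 / 32\<close> of the square of \<open>X\<close>.\<close>

lemma quadratic_bound:
  fixes X Y t b :: real
  assumes "X \<ge> 0" "Y \<ge> 0" "t \<ge> 0" "b \<ge> 0" and q: "X\<^sup>2 \<le> t * Y * X + 2 * (X / 4 + b * Y)\<^sup>2"
  shows "X \<le> (4 * t + 8 * b + 1) * Y"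
proof (rule ccontr)
  assume "\<not> ?thesis"
  then have X: "X > (4 * t + 8 * b + 1) * Y" by simp
  moreover have nn: "t * Y \<ge> 0" "b * Y \<ge> 0" using assms by simp_all
  moreover have "(4 * t + 8 * b + 1) * Y = 4 * (t * Y) + 8 * (b * Y) + Y"
    by (simp add: algebra_simps)
  ultimately have "4 * (t * Y) \<le> X" "8 * (b * Y) \<le> X" "X > 0"
    using assms(2) by linarith+
  have "t * Y * X \<le> X / 4 * X"
    using \<open>4 * (t * Y) \<le> X\<close> \<open>X > 0\<close> by (intro mult_right_mono) linarith+
  moreover have "(X / 4 + b * Y)\<^sup>2 \<le> (3 / 8 * X)\<^sup>2"
    using \<open>8 * (b * Y) \<le> X\<close> \<open>X > 0\<close> nn by (intro power_mono) linarith+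
  ultimately have "X\<^sup>2 \<le> X\<^sup>2 / 4 + 2 * (9 / 64 * X\<^sup>2)"
    using q by (simp add: power2_eq_square)
  then show False using \<open>X > 0\<close> by simp
qed

section \<open>Resolvents and eigenvalues of self-adjoint relations\<close>

lemma resolvent_mem:
  assumes "z \<in> resolvent_set A"
  shows "(resolvent A z y, y + z \<cdot>\<^sub>C resolvent A z y) \<in> A"
  unfolding resolvent_def by (rule theI') (use assms in \<open>auto simp: resolvent_set_def\<close>)

lemma resolvent_eqI:
  assumes "z \<in> resolvent_set A" "(x, y + z \<cdot>\<^sub>C x) \<in> A"
  shows "resolvent A z y = x"
  using assms resolvent_mem[OF assms(1), of y] unfolding resolvent_set_def by blast

lemma resolvent_cbounded: "z \<in> resolvent_set A \<Longrightarrow> cbounded (resolvent A z)"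
  unfolding resolvent_set_def by blast

locale selfadjoint_rel = pontryagin_space J for J :: "'k::chilbert \<Rightarrow> 'k" +
  fixes A :: "('k \<times> 'k) set"
  assumes sa: "selfadjoint_relation J A"
begin

lemma A_add: "(x, x') \<in> A \<Longrightarrow> (y, y') \<in> A \<Longrightarrow> (x + y, x' + y') \<in> A"
  and A_scaleC: "(x, x') \<in> A \<Longrightarrow> (c \<cdot>\<^sub>C x, c \<cdot>\<^sub>C x') \<in> A"
  and A_zero: "(0, 0) \<in> A"
  using sa unfolding selfadjoint_relation_def linear_relation_def by auto

lemma A_diff: "(x, x') \<in> A \<Longrightarrow> (y, y') \<in> A \<Longrightarrow> (x - y, x' - y') \<in> A"
  using A_add[of x x' "- y" "- y'"] A_scaleC[of y y' "-1"] by simp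

lemma A_sym: "(x, x') \<in> A \<Longrightarrow> (y, y') \<in> A \<Longrightarrow> kinner J x' y = kinner J x y'"
  and A_adjoint: "(y, y') \<in> rel_adjoint J A \<Longrightarrow> (y, y') \<in> A"
proof -
  have eq: "A = rel_adjoint J A" using sa unfolding selfadjoint_relation_def by blast
  then show "(y, y') \<in> rel_adjoint J A \<Longrightarrow> (y, y') \<in> A" by blast
  assume "(x, x') \<in> A" "(y, y') \<in> A"
  moreover from this(2) have "(y, y') \<in> rel_adjoint J A" using eq by blast
  ultimately show "kinner J x' y = kinner J x y'" unfolding rel_adjoint_def by blast
qed

lemma A_memI: "(\<And>x x'. (x, x') \<in> A \<Longrightarrow> kinner J x' y = kinner J x y') \<Longrightarrow> (y, y') \<in> A"
  by (rule A_adjoint) (simp add: rel_adjoint_def)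

text \<open>If \<open>y\<close> is orthogonal to the range, then \<open>J y\<close> together with
  its \<open>\<nu>\<close>-multiple lies in the adjoint relation, hence in \<open>A\<close>, and so
  must vanish.\<close>

lemma range_dense:
  assumes "\<not> is_eigenvalue A \<nu>"
  shows "closure {a' - cnj \<nu> \<cdot>\<^sub>C a | a a'. (a, a') \<in> A} = UNIV"
proof (rule closure_subspace_eq_UNIV)
  show "cvs.subspace {a' - cnj \<nu> \<cdot>\<^sub>C a | a a'. (a, a') \<in> A}" (is "cvs.subspace ?S")
    unfolding cvs.subspace_def
  proof (intro conjI ballI allI)
    have "0 = 0 - cnj \<nu> \<cdot>\<^sub>C 0" by simp
    then show "0 \<in> ?S" using A_zero by blast
  next
    fix x y assume "x \<in> ?S" "y \<in> ?S"
    then obtain a a' b b' where *: "(a, a') \<in> A" "x = a' - cnj \<nu> \<cdot>\<^sub>C a"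
      "(b, b') \<in> A" "y = b' - cnj \<nu> \<cdot>\<^sub>C b" by blast
    then have "x + y = (a' + b') - cnj \<nu> \<cdot>\<^sub>C (a + b)" by (simp add: scaleC_add_right)
    then show "x + y \<in> ?S" using A_add[OF *(1,3)] by blast
  next
    fix c x assume "x \<in> ?S"
    then obtain a a' where *: "(a, a') \<in> A" "x = a' - cnj \<nu> \<cdot>\<^sub>C a" by blast
    then have "c \<cdot>\<^sub>C x = c \<cdot>\<^sub>C a' - cnj \<nu> \<cdot>\<^sub>C (c \<cdot>\<^sub>C a)"
      by (simp add: cvs.scale_right_diff_distrib scaleC_scaleC mult.commute)
    then show "c \<cdot>\<^sub>C x \<in> ?S" using A_scaleC[OF *(1)] by blast
  qed
next
  fix y assume y: "\<And>s. s \<in> {a' - cnj \<nu> \<cdot>\<^sub>C a | a a'. (a, a') \<in> A} \<Longrightarrow> cinner s y = 0"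
  have "(J y, \<nu> \<cdot>\<^sub>C J y) \<in> A"
  proof (rule A_memI)
    fix a a' assume "(a, a') \<in> A"
    then have "cinner (a' - cnj \<nu> \<cdot>\<^sub>C a) y = 0" using y by blast
    then show "kinner J a' (J y) = kinner J a (\<nu> \<cdot>\<^sub>C J y)"
      by (simp add: cinner_eq_kinner kinner_simps)
  qed
  then have "J y = 0" using assms unfolding is_eigenvalue_def by blast
  then show "y = 0" by (metis norm_J norm_eq_zero)
qed

text \<open>The test vectors are taken from the dense range of \<open>A - cnj \<nu>\<close>.
  Symmetry moves the relation to the other side, so that pairing \<open>x\<close> with such a vector
  is pairing \<open>x' - \<nu> x\<close> with a fixed one.\<close>

lemma neg_part_rel_bound:
  assumes ne: "\<not> is_eigenvalue A \<nu>" and \<epsilon>: "\<epsilon> > 0"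
  obtains C where "C \<ge> 0"
    "\<And>x x'. (x, x') \<in> A \<Longrightarrow> norm (neg_part x) \<le> \<epsilon> * norm x + C * norm (x' - \<nu> \<cdot>\<^sub>C x)"
proof -
  define L where "L = {a' - cnj \<nu> \<cdot>\<^sub>C a | a a'. (a, a') \<in> A}"
  have dense: "closure L = UNIV" unfolding L_def by (rule range_dense[OF ne])
  obtain E :: "'k set" and b where E: "finite E" and b: "\<And>e. e \<in> E \<Longrightarrow> b e \<in> L" and
    N: "\<And>x. norm (neg_part x) \<le> \<epsilon> * norm x + (\<Sum>e\<in>E. cmod (kinner J x (b e)))"
    using neg_part_dense_bound[OF dense \<epsilon>] by blast
  have "\<forall>e\<in>E. \<exists>a a'. (a, a') \<in> A \<and> b e = a' - cnj \<nu> \<cdot>\<^sub>C a"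
    using b unfolding L_def by fast
  then obtain a a' where a: "\<And>e. e \<in> E \<Longrightarrow> (a e, a' e) \<in> A \<and> b e = a' e - cnj \<nu> \<cdot>\<^sub>C a e"
    unfolding bchoice_iff by blast
  define C where "C = (\<Sum>e\<in>E. norm (a e))"
  show ?thesis
  proof (rule that[of C])
    show "C \<ge> 0" unfolding C_def by (intro sum_nonneg) simp
    fix x x' assume x: "(x, x') \<in> A"
    have "cmod (kinner J x (b e)) \<le> norm (a e) * norm (x' - \<nu> \<cdot>\<^sub>C x)" if "e \<in> E" for e
    proof -
      have "kinner J x (b e) = kinner J (x' - \<nu> \<cdot>\<^sub>C x) (a e)"
        using a[OF that] A_sym[OF x, of "a e" "a' e"] by (simp add: kinner_simps)
      then show ?thesis using kinner_bound[of "x' - \<nu> \<cdot>\<^sub>C x" "a e"] by (simp add: mult.commute)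
    qed
    then have "(\<Sum>e\<in>E. cmod (kinner J x (b e))) \<le> (\<Sum>e\<in>E. norm (a e) * norm (x' - \<nu> \<cdot>\<^sub>C x))"
      by (rule sum_mono)
    then show "norm (neg_part x) \<le> \<epsilon> * norm x + C * norm (x' - \<nu> \<cdot>\<^sub>C x)"
      using N[of x] unfolding C_def sum_distrib_right by linarith
  qed
qed

text \<open>By symmetry the pairing of \<open>y + z x\<close> with \<open>x\<close> is real, so its
  two imaginary contributions cancel. This controls the indefinite square only, where in a Hilbert
  space it would already bound the norm.\<close>

lemma abs_Im_kinner_bound:
  assumes "(x, y + z \<cdot>\<^sub>C x) \<in> A"
  shows "\<bar>Im z\<bar> * \<bar>Re (kinner J x x)\<bar> \<le> norm y * norm x"
proof -
  have "kinner J (y + z \<cdot>\<^sub>C x) x = kinner J x (y + z \<cdot>\<^sub>C x)" using A_sym[OF assms assms] .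
  also have "\<dots> = cnj (kinner J (y + z \<cdot>\<^sub>C x) x)" by (rule kinner_commute)
  finally have "Im (kinner J (y + z \<cdot>\<^sub>C x) x) = 0" by (metis Im_complex_of_real Reals_cases Reals_cnj_iff)
  moreover have "Im (kinner J x x) = 0" by (simp add: kinner_self)
  ultimately have "Im z * Re (kinner J x x) = - Im (kinner J y x)" by (simp add: kinner_simps)
  then have "\<bar>Im z\<bar> * \<bar>Re (kinner J x x)\<bar> = \<bar>Im (kinner J y x)\<bar>" by (simp flip: abs_mult)
  also have "\<dots> \<le> cmod (kinner J y x)" by (rule abs_Im_le_cmod)
  also have "\<dots> \<le> norm y * norm x" by (rule kinner_bound)
  finally show ?thesis .
qed

text \<open>Away from eigenvalues the resolvent grows like that of a self-adjoint operator in a Hilbert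
  space: the finite-rank negative part of \<open>x\<close> is controlled through the dense range of
  \<open>A - cnj \<nu>\<close>, the indefinite square of \<open>x\<close> through symmetry.\<close>

lemma resolvent_growth:
  assumes ne: "\<not> is_eigenvalue A \<nu>"
  obtains e C where "e > 0" "C \<ge> 0"
    "\<And>z x y. dist z \<nu> < e \<Longrightarrow> Im z \<noteq> 0 \<Longrightarrow> (x, y + z \<cdot>\<^sub>C x) \<in> A \<Longrightarrow>
       norm x \<le> (4 / \<bar>Im z\<bar> + C) * norm y"
proof -
  obtain C where C: "C \<ge> 0"
    "\<And>x x'. (x, x') \<in> A \<Longrightarrow> norm (neg_part x) \<le> 1/8 * norm x + C * norm (x' - \<nu> \<cdot>\<^sub>C x)"
    using neg_part_rel_bound[OF ne, of "1/8"] by auto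
  \<comment> \<open>Passing from \<open>\<nu>\<close> to \<open>z\<close> costs at most another
    \<open>1/8\<close> of \<open>norm x\<close>; together with the \<open>1/8\<close> above this is
    the \<open>1/4\<close> that \<open>quadratic_bound\<close> tolerates.\<close>
  define e where "e = 1 / (8 * (C + 1))"
  show ?thesis
  proof (rule that[of e "8 * C + 1"])
    show "e > 0" "8 * C + 1 \<ge> 0" using C(1) by (simp_all add: e_def)
    fix z x y assume z: "dist z \<nu> < e" "Im z \<noteq> 0" and x: "(x, y + z \<cdot>\<^sub>C x) \<in> A"
    have "C * dist z \<nu> \<le> (C + 1) * e" using z(1) C(1) by (intro mult_mono) auto
    also have "\<dots> = 1/8" using C(1) by (simp add: e_def)
    finally have Ce: "C * dist z \<nu> \<le> 1/8" .
    have eq: "y + z \<cdot>\<^sub>C x - \<nu> \<cdot>\<^sub>C x = y + (z - \<nu>) \<cdot>\<^sub>C x" by (simp add: cvs.scale_left_diff_distrib)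
    have "norm (y + z \<cdot>\<^sub>C x - \<nu> \<cdot>\<^sub>C x) \<le> norm y + dist z \<nu> * norm x"
      unfolding eq using norm_triangle_ineq[of y "(z - \<nu>) \<cdot>\<^sub>C x"] by (simp add: norm_scaleC dist_norm)
    then have "C * norm (y + z \<cdot>\<^sub>C x - \<nu> \<cdot>\<^sub>C x) \<le> C * norm y + (C * dist z \<nu>) * norm x"
      using C(1) mult_left_mono[of _ _ C] by (fastforce simp: distrib_left mult.assoc)
    also have "(C * dist z \<nu>) * norm x \<le> 1/8 * norm x" using Ce by (intro mult_right_mono) auto
    finally have N: "norm (neg_part x) \<le> norm x / 4 + C * norm y" using C(2)[OF x] by simp
    have "Re (kinner J x x) \<le> (1 / \<bar>Im z\<bar>) * norm y * norm x"
      using abs_Im_kinner_bound[OF x] z(2) by (simp add: field_simps) (smt (verit) mult_left_mono abs_ge_zero)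
    moreover have "(norm (neg_part x))\<^sup>2 \<le> (norm x / 4 + C * norm y)\<^sup>2" using N by (intro power_mono) auto
    ultimately have "(norm x)\<^sup>2 \<le> (1 / \<bar>Im z\<bar>) * norm y * norm x + 2 * (norm x / 4 + C * norm y)\<^sup>2"
      unfolding norm_eq_kinner_neg_part[of x] by linarith
    from quadratic_bound[OF _ _ _ C(1) this] show "norm x \<le> (4 / \<bar>Im z\<bar> + (8 * C + 1)) * norm y"
      by (simp add: add.assoc)
  qed
qed

lemma resolvent_adjoint:
  assumes "z \<in> resolvent_set A" "cnj z \<in> resolvent_set A"
  shows "kinner J (resolvent A z x) y = kinner J x (resolvent A (cnj z) y)"
  using A_sym[OF resolvent_mem[OF assms(1), of x] resolvent_mem[OF assms(2), of y]]
  by (simp add: kinner_simps)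

lemma resolvent_identity:
  assumes "z \<in> resolvent_set A" "w \<in> resolvent_set A"
  shows "resolvent A z y - resolvent A w y = (z - w) \<cdot>\<^sub>C resolvent A z (resolvent A w y)"
proof -
  have "resolvent A z ((z - w) \<cdot>\<^sub>C resolvent A w y) = resolvent A z y - resolvent A w y"
  proof (rule resolvent_eqI[OF assms(1)])
    show "(resolvent A z y - resolvent A w y, (z - w) \<cdot>\<^sub>C resolvent A w y +
       z \<cdot>\<^sub>C (resolvent A z y - resolvent A w y)) \<in> A"
      using A_diff[OF resolvent_mem[OF assms(1), of y] resolvent_mem[OF assms(2), of y]]
      by (simp add: cvs.scale_right_diff_distrib cvs.scale_left_diff_distrib algebra_simps)
  qed
  then show ?thesis by (simp add: cboundedD[OF resolvent_cbounded[OF assms(1)]])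
qed

lemma resolvent_eigenvector:
  assumes "z \<in> resolvent_set A" "(x, \<nu> \<cdot>\<^sub>C x) \<in> A"
  shows "(\<nu> - z) \<cdot>\<^sub>C resolvent A z x = x"
proof -
  have "resolvent A z ((\<nu> - z) \<cdot>\<^sub>C x) = x"
    using assms by (intro resolvent_eqI) (simp_all add: cvs.scale_left_diff_distrib)
  then show ?thesis by (simp add: cboundedD[OF resolvent_cbounded[OF assms(1)]])
qed

text \<open>\<open>A\<close> may be multivalued, so the usual induction is run with the bounded
  operator \<open>resolvent A z0\<close>, for which the vectors have the distinct eigenvalues
  \<open>1 / (\<nu> - z0)\<close>.\<close>

lemma eigenvectors_independent:
  assumes z0: "z0 \<in> resolvent_set A" and I: "finite I"
    and x: "\<And>\<nu>. \<nu> \<in> I \<Longrightarrow> x \<nu> \<noteq> 0 \<and> (x \<nu>, \<nu> \<cdot>\<^sub>C x \<nu>) \<in> A"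
  shows "(\<Sum>\<nu>\<in>I. c \<nu> \<cdot>\<^sub>C x \<nu>) = 0 \<Longrightarrow> \<forall>\<nu>\<in>I. c \<nu> = 0"
  using I x
proof (induction I arbitrary: c)
  case (insert \<mu> I)
  note R = cbounded_clinear[OF resolvent_cbounded[OF z0]]
  have ev: "resolvent A z0 (x \<nu>) = (1 / (\<nu> - z0)) \<cdot>\<^sub>C x \<nu>" and ne: "\<nu> \<noteq> z0" if "\<nu> \<in> insert \<mu> I" for \<nu>
  proof -
    have e: "(\<nu> - z0) \<cdot>\<^sub>C resolvent A z0 (x \<nu>) = x \<nu>"
      using resolvent_eigenvector[OF z0] insert.prems(2)[OF that] by blast
    then show "\<nu> \<noteq> z0" using insert.prems(2)[OF that] by auto
    then show "resolvent A z0 (x \<nu>) = (1 / (\<nu> - z0)) \<cdot>\<^sub>C x \<nu>"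
      by (subst (2) e[symmetric]) (simp add: scaleC_scaleC scaleC_one \<open>\<nu> \<noteq> z0\<close>)
  qed
  have s: "c \<mu> \<cdot>\<^sub>C x \<mu> = - (\<Sum>\<nu>\<in>I. c \<nu> \<cdot>\<^sub>C x \<nu>)"
    using insert.prems(1) insert.hyps by (simp add: eq_neg_iff_add_eq_0)
  from arg_cong[OF this, of "resolvent A z0"]
  have "(c \<mu> / (\<mu> - z0)) \<cdot>\<^sub>C x \<mu> = - (\<Sum>\<nu>\<in>I. (c \<nu> / (\<nu> - z0)) \<cdot>\<^sub>C x \<nu>)"
    using ev by (simp add: clinearD[OF R] clinear_sum[OF R] scaleC_scaleC)
  moreover have "(c \<mu> / (\<mu> - z0)) \<cdot>\<^sub>C x \<mu> = - (\<Sum>\<nu>\<in>I. (c \<nu> / (\<mu> - z0)) \<cdot>\<^sub>C x \<nu>)"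
    using arg_cong[OF s, of "\<lambda>v. (1 / (\<mu> - z0)) \<cdot>\<^sub>C v"]
    by (simp add: scaleC_scaleC cvs.scale_sum_right)
  ultimately have "(\<Sum>\<nu>\<in>I. (c \<nu> / (\<nu> - z0) - c \<nu> / (\<mu> - z0)) \<cdot>\<^sub>C x \<nu>) = 0"
    by (simp add: cvs.scale_left_diff_distrib sum_subtractf)
  then have "\<forall>\<nu>\<in>I. c \<nu> / (\<nu> - z0) - c \<nu> / (\<mu> - z0) = 0"
    by (rule insert.IH) (use insert.prems(2) in auto)
  moreover have "1 / (\<nu> - z0) \<noteq> 1 / (\<mu> - z0)" if "\<nu> \<in> I" for \<nu>
    using that insert.hyps(2) ne by (auto simp: field_simps)
  ultimately have c: "\<forall>\<nu>\<in>I. c \<nu> = 0" by (auto simp: divide_inverse)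
  then have "c \<mu> \<cdot>\<^sub>C x \<mu> = 0" using s by (simp add: sum.neutral)
  then show ?case using c insert.prems(2)[of \<mu>] by simp
qed simp

text \<open>The eigenvectors for eigenvalues in the upper half plane span a neutral subspace, on which
  the projection to the finite-dimensional negative part is injective.\<close>

lemma finite_upper_eigenvalues:
  assumes z0: "z0 \<in> resolvent_set A"
  shows "finite {\<nu>. Im \<nu> > 0 \<and> is_eigenvalue A \<nu>}" (is "finite ?S")
proof (rule ccontr)
  assume inf: "infinite ?S"
  obtain F where F: "finite F" "{x. J x = - x} \<subseteq> cspan F"
    using fund unfolding fund_symmetry_def by blast
  obtain I where I: "I \<subseteq> ?S" "finite I" "card I = Suc (card F)"
    using infinite_arbitrarily_large[OF inf] by blast
  have "\<forall>\<nu>\<in>I. \<exists>x. x \<noteq> 0 \<and> (x, \<nu> \<cdot>\<^sub>C x) \<in> A" using I(1) unfolding is_eigenvalue_def by blast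
  then obtain x where x: "\<And>\<nu>. \<nu> \<in> I \<Longrightarrow> x \<nu> \<noteq> 0 \<and> (x \<nu>, \<nu> \<cdot>\<^sub>C x \<nu>) \<in> A" by metis
  have ort: "kinner J (x \<nu>) (x \<mu>) = 0" if "\<nu> \<in> I" "\<mu> \<in> I" for \<nu> \<mu>
  proof -
    have "\<nu> * kinner J (x \<nu>) (x \<mu>) = cnj \<mu> * kinner J (x \<nu>) (x \<mu>)"
      using A_sym[of "x \<nu>" "\<nu> \<cdot>\<^sub>C x \<nu>" "x \<mu>" "\<mu> \<cdot>\<^sub>C x \<mu>"] x that by (simp add: kinner_simps)
    moreover have "Im \<nu> > 0" "Im \<mu> > 0" using that I(1) by auto
    then have "\<nu> \<noteq> cnj \<mu>" by (auto simp: complex_eq_iff)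
    ultimately show ?thesis by simp
  qed
  have lin: "clinear neg_part"
    unfolding clinear_def neg_part_def
    by (auto simp: cboundedD[OF J(1)] scaleC_scaleC algebra_simps scaleC_add_right cvs.scale_right_diff_distrib)
  have "card I \<le> card F"
  proof (rule independent_family_card_le[OF I(2) F(1)])
    show "(\<lambda>\<nu>. neg_part (x \<nu>)) ` I \<subseteq> cspan F"
      using F(2) by (force simp: neg_part_def cboundedD[OF J(1)] J simp flip: cvs.scale_minus_right)
    fix c assume "(\<Sum>\<nu>\<in>I. c \<nu> \<cdot>\<^sub>C neg_part (x \<nu>)) = 0"
    then have N: "neg_part (\<Sum>\<nu>\<in>I. c \<nu> \<cdot>\<^sub>C x \<nu>) = 0"
      by (simp add: clinear_sum[OF lin] clinearD[OF lin])
    have "kinner J (\<Sum>\<nu>\<in>I. c \<nu> \<cdot>\<^sub>C x \<nu>) (\<Sum>\<nu>\<in>I. c \<nu> \<cdot>\<^sub>C x \<nu>) = 0"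
      using ort by (simp add: kinner_sum_left kinner_sum_right kinner_simps)
    then have "(\<Sum>\<nu>\<in>I. c \<nu> \<cdot>\<^sub>C x \<nu>) = 0"
      using norm_eq_kinner_neg_part[of "\<Sum>\<nu>\<in>I. c \<nu> \<cdot>\<^sub>C x \<nu>"] N by simp
    then show "\<forall>\<nu>\<in>I. c \<nu> = 0"
      using eigenvectors_independent[OF z0 I(2), of x c] x by blast
  qed
  then show False using I(3) by simp
qed

end

section \<open>Realizations\<close>

lemma bdd_invertibleI:
  assumes "cbounded T" "cbounded S" "\<And>x. S (T x) = x" "\<And>x. T (S x) = x"
  shows "bdd_invertible T" "inv_into UNIV T = S"
proof -
  have b: "bij T" using assms(3,4) by (intro o_bij[of S]) auto
  show i: "inv_into UNIV T = S"
    using assms(3,4) by (intro inv_equality)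
  then show "bdd_invertible T" using assms b unfolding bdd_invertible_def by simp
qed

lemma bdd_invertibleD:
  assumes "bdd_invertible T"
  shows "cbounded T" "cbounded (inv_into UNIV T)" "inv_into UNIV T (T x) = x" "T (inv_into UNIV T x) = x"
  using assms unfolding bdd_invertible_def
  by (auto simp: bij_is_inj bij_is_surj surj_f_inv_f)

text \<open>With \<open>S\<close> the inverse of \<open>T\<close>, the equation
  \<open>T' x = y\<close> is the fixed point equation \<open>x = S (T x - T' x + y)\<close>, a
  contraction with constant \<open>M * d\<close>. The explicit smallness condition allows a
  perturbation whose starting point varies, given a uniform \<open>M\<close>.\<close>

lemma bdd_invertible_perturb:
  fixes T T' :: "'a::chilbert \<Rightarrow> 'a"
  assumes T: "bdd_invertible T" and M: "\<And>x. norm (inv_into UNIV T x) \<le> M * norm x"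
    and T': "cbounded T'" and d: "\<And>x. norm (T' x - T x) \<le> d * norm x" "M \<ge> 0" "d \<ge> 0" "M * d < 1"
  shows "bdd_invertible T'"
proof -
  define S where "S = inv_into UNIV T"
  note S = bdd_invertibleD[OF T, folded S_def]
  have Mb: "norm (S x) \<le> M * norm x" for x using M by (simp add: S_def)
  have SM: "norm (S (T x - T' x)) \<le> (M * d) * norm x" for x
  proof -
    have "norm (S (T x - T' x)) \<le> M * norm (T' x - T x)"
      using Mb[of "T x - T' x"] by (simp add: norm_minus_commute)
    also have "\<dots> \<le> M * (d * norm x)" using d by (intro mult_left_mono) auto
    finally show ?thesis by (simp add: mult.assoc)
  qed
  have "\<exists>!x. S (T x - T' x + y) = x" for y
  proof (rule banach_fix_type[of "M * d"])
    show "\<forall>u v. dist (S (T u - T' u + y)) (S (T v - T' v + y)) \<le> M * d * dist u v"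
    proof (intro allI)
      fix u v
      have "S (T u - T' u + y) - S (T v - T' v + y) = S (T (u - v) - T' (u - v))"
        by (simp add: cboundedD[OF S(1)] cboundedD[OF S(2)] cboundedD[OF T'])
      then show "dist (S (T u - T' u + y)) (S (T v - T' v + y)) \<le> M * d * dist u v"
        using SM[of "u - v"] by (simp add: dist_norm)
    qed
  qed (use d in auto)
  moreover have "S (T x - T' x + y) = x \<longleftrightarrow> T' x = y" for x y
  proof
    assume "S (T x - T' x + y) = x"
    from arg_cong[OF this, of T] show "T' x = y" by (simp add: S)
  qed (use S in auto)
  ultimately have ex1: "\<exists>!x. T' x = y" for y by simp
  then have bij: "bij T'" by (metis bij_iff)
  define R where "R = inv_into UNIV T'"
  have R: "T' (R y) = y" "R (T' y) = y" for y
    using bij unfolding R_def by (simp_all add: bij_is_surj surj_f_inv_f bij_is_inj)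
  have "cbounded R"
  proof (rule cboundedI)
    show "R (x + y) = R x + R y" for x y
      using R cboundedD(1)[OF T', of "R x" "R y"] by metis
    show "R (c \<cdot>\<^sub>C x) = c \<cdot>\<^sub>C R x" for c x
      using R cboundedD(2)[OF T', of c "R x"] by metis
    show "norm (R y) \<le> (M / (1 - M * d)) * norm y" for y
    proof -
      have "S (T (R y) - T' (R y)) = S (T (R y)) - S (T' (R y))"
        by (simp add: cboundedD[OF S(2)])
      then have "R y = S (T (R y) - T' (R y)) + S y" using S R by simp
      then have "norm (R y) \<le> norm (S (T (R y) - T' (R y))) + norm (S y)"
        by (metis norm_triangle_ineq)
      then have "norm (R y) \<le> (M * d) * norm (R y) + M * norm y" using SM[of "R y"] Mb[of y] by simp
      then show ?thesis using d(4) by (simp add: field_simps)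
    qed
  qed
  then show ?thesis using bij T' unfolding bdd_invertible_def R_def by simp
qed

lemma op_holomorphic_lipschitz:
  fixes Q :: "complex \<Rightarrow> 'h::cinner_space \<Rightarrow> 'h"
  assumes D: "open D" and hol: "op_holomorphic_on Q D" and p: "p \<in> D"
  obtains e C where "e > 0" "C \<ge> 0" "ball p e \<subseteq> D"
    "\<And>w x. dist w p < e \<Longrightarrow> norm (Q w x - Q p x) \<le> C * dist w p * norm x"
proof -
  have cb: "\<And>z. z \<in> D \<Longrightarrow> cbounded (Q z)" using hol unfolding op_holomorphic_on_def by blast
  obtain T where T: "cbounded T"
    "((\<lambda>w. onorm (\<lambda>x. inverse (w - p) \<cdot>\<^sub>C (Q w x - Q p x) - T x)) \<longlongrightarrow> 0) (at p)"
    using hol p unfolding op_holomorphic_on_def by blast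
  obtain K where K: "K > 0" "\<And>x. norm (T x) \<le> K * norm x" using cbounded_boundE[OF T(1)] by metis
  obtain e1 where e1: "e1 > 0" "\<And>w. w \<noteq> p \<Longrightarrow> dist w p < e1 \<Longrightarrow>
      onorm (\<lambda>x. inverse (w - p) \<cdot>\<^sub>C (Q w x - Q p x) - T x) < 1"
    using order_tendstoD(2)[OF T(2), of 1] unfolding eventually_at by auto
  obtain e2 where e2: "e2 > 0" "ball p e2 \<subseteq> D" using D p openE by blast
  show ?thesis
  proof (rule that[of "min e1 e2" "K + 1"])
    show "min e1 e2 > 0" "0 \<le> K + 1" "ball p (min e1 e2) \<subseteq> D" using e1 e2 K by auto
    fix w x assume w: "dist w p < min e1 e2"
    show "norm (Q w x - Q p x) \<le> (K + 1) * dist w p * norm x"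
    proof (cases "w = p")
      case False
      have wD: "w \<in> D" using w e2(2) by (auto simp: dist_commute)
      define F where "F = (\<lambda>x. inverse (w - p) \<cdot>\<^sub>C (Q w x - Q p x) - T x)"
      \<comment> \<open>\<open>onorm\<close> controls individual values only once the map is known
        to be bounded.\<close>
      have "cbounded F" unfolding F_def
        by (intro cbounded_diff cbounded_scaleC cb wD p T(1))
      from onorm[OF cbounded_bounded_linear[OF this], of x]
      have "norm (F x) \<le> onorm F * norm x" .
      also have "\<dots> \<le> 1 * norm x"
        using e1(2)[OF False] w unfolding F_def by (intro mult_right_mono) auto
      finally have F: "norm (F x) \<le> norm x" by simp
      have "Q w x - Q p x = (w - p) \<cdot>\<^sub>C (F x + T x)"
        using False by (simp add: F_def scaleC_scaleC scaleC_one)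
      then have "norm (Q w x - Q p x) = dist w p * norm (F x + T x)"
        by (simp add: norm_scaleC dist_norm)
      also have "\<dots> \<le> dist w p * ((K + 1) * norm x)"
        using norm_triangle_ineq[of "F x" "T x"] F K(2)[of x]
        by (intro mult_left_mono) (auto simp: algebra_simps)
      finally show ?thesis by (simp add: mult_ac)
    qed simp
  qed
qed

text \<open>The resolvent identity bounds the norm at \<open>z\<close> by that at \<open>p\<close>
  plus a correction; within radius \<open>1 / (2 * K)\<close> the correction is at most half of the
  quantity being estimated and is absorbed.\<close>

lemma (in selfadjoint_rel) resolvent_locally_bounded:
  assumes p: "p \<in> resolvent_set A"
  obtains e M where "e > 0" "M \<ge> 0"
    "\<And>z y. z \<in> resolvent_set A \<Longrightarrow> dist z p < e \<Longrightarrow> norm (resolvent A z y) \<le> M * norm y"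
proof -
  obtain K where K: "K > 0" "\<And>y. norm (resolvent A p y) \<le> K * norm y"
    using cbounded_boundE[OF resolvent_cbounded[OF p]] by metis
  show ?thesis
  proof (rule that[of "1 / (2 * K)" "2 * K"])
    fix z y assume z: "z \<in> resolvent_set A" "dist z p < 1 / (2 * K)"
    have "resolvent A z y = resolvent A p y - (p - z) \<cdot>\<^sub>C resolvent A p (resolvent A z y)"
      by (subst resolvent_identity[OF p z(1), symmetric]) simp
    then have "norm (resolvent A z y) \<le> norm (resolvent A p y) + dist z p * norm (resolvent A p (resolvent A z y))"
      using norm_triangle_ineq4[of "resolvent A p y" "(p - z) \<cdot>\<^sub>C resolvent A p (resolvent A z y)"]
      by (simp add: norm_scaleC dist_norm norm_minus_commute)
    also have "\<dots> \<le> K * norm y + (1 / (2 * K)) * (K * norm (resolvent A z y))"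
      using z(2) K by (intro add_mono mult_mono) auto
    finally show "norm (resolvent A z y) \<le> 2 * K * norm y" using K(1) by simp
  qed (use K in auto)
qed

text \<open>The assumptions on \<open>Q\<close> are those that can be carried over directly to the
  inverse function, so that the locale can be interpreted for both realizations.\<close>

locale nev_realization =
  fixes Q :: "complex \<Rightarrow> 'h::chilbert \<Rightarrow> 'h" and D :: "complex set"
    and J :: "'k::chilbert \<Rightarrow> 'k" and A :: "('k \<times> 'k) set"
    and z0 :: complex and \<Gamma> :: "'h \<Rightarrow> 'k" and Gp :: "'k \<Rightarrow> 'h"
  assumes real: "min_realization Q D J A z0 \<Gamma> Gp"
    and D_cnj: "z \<in> D \<Longrightarrow> cnj z \<in> D"
    and Q_adj: "z \<in> D \<Longrightarrow> cinner (Q z x) y = cinner x (Q (cnj z) y)"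
    and Q_cbounded: "z \<in> D \<Longrightarrow> cbounded (Q z)"
begin

sublocale selfadjoint_rel J A
  by unfold_locales (use real in \<open>auto simp: min_realization_def\<close>)

lemma D_resolvent: "z \<in> D \<Longrightarrow> z \<in> resolvent_set A"
  and z0_resolvent: "z0 \<in> resolvent_set A"
  and z0_upper: "Im z0 > 0"
  and z0_D: "z0 \<in> D"
  and \<Gamma>_cbounded: "cbounded \<Gamma>"
  and kinner_\<Gamma>: "kinner J (\<Gamma> h) x = cinner h (Gp x)"
  using real by (auto simp: min_realization_def)

lemma cinner_Gp: "cinner (Gp x) h = kinner J x (\<Gamma> h)"
  by (metis kinner_\<Gamma> kinner_commute cinner_commute)

lemma Gp_cbounded: "cbounded Gp"
proof -
  obtain K where K: "K > 0" "\<And>h. norm (\<Gamma> h) \<le> K * norm h" using cbounded_boundE[OF \<Gamma>_cbounded] by metis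
  show ?thesis
  proof (rule cboundedI)
    show "Gp (x + y) = Gp x + Gp y" for x y
      by (rule cinner_eqI) (simp add: cinner_Gp cinner_add_left kinner_simps)
    show "Gp (c \<cdot>\<^sub>C x) = c \<cdot>\<^sub>C Gp x" for c x
      by (rule cinner_eqI) (simp add: cinner_Gp cinner_scaleC_left kinner_simps)
    show "norm (Gp x) \<le> K * norm x" for x
    proof (rule norm_le_cinnerI)
      fix k
      have "cmod (cinner (Gp x) k) \<le> norm x * norm (\<Gamma> k)" by (simp add: cinner_Gp kinner_bound)
      also have "\<dots> \<le> norm x * (K * norm k)" by (intro mult_left_mono K) simp
      finally show "cmod (cinner (Gp x) k) \<le> K * norm x * norm k" by (simp add: mult_ac)
    qed (use K in simp)
  qed
qed

text \<open>The gamma field of the realization: its values span the state space densely, and their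
  inner products reproduce the kernel.\<close>

definition \<gamma> :: "complex \<Rightarrow> 'h \<Rightarrow> 'k" where
  "\<gamma> z h = \<Gamma> h + (z - z0) \<cdot>\<^sub>C resolvent A z (\<Gamma> h)"

lemma \<gamma>_cbounded: "z \<in> resolvent_set A \<Longrightarrow> cbounded (\<gamma> z)"
  unfolding \<gamma>_def
  by (intro cbounded_add cbounded_scaleC \<Gamma>_cbounded cbounded_compose[OF resolvent_cbounded])

lemma span_\<gamma>: "closure (cspan {\<gamma> z h | z h. z \<in> resolvent_set A}) = UNIV"
  using real unfolding \<gamma>_def min_realization_def by blast

lemma Q_formula:
  assumes z: "z \<in> D"
  shows "Q z h = Q (cnj z0) h + (z - cnj z0) \<cdot>\<^sub>C Gp (\<gamma> z h)"
proof -
  obtain Qs where Qs: "\<And>h k. cinner (Qs h) k = cinner h (Q z0 k)"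
    "\<And>z h. z \<in> D \<Longrightarrow> Q z h = Qs h + (z - cnj z0) \<cdot>\<^sub>C Gp (\<gamma> z h)"
    using real unfolding min_realization_def \<gamma>_def by blast
  have "Qs h = Q (cnj z0) h"
    by (rule cinner_eqI) (simp add: Qs(1) Q_adj[OF D_cnj[OF z0_D]])
  then show ?thesis using Qs(2)[OF z] by simp
qed

lemma \<gamma>_diff:
  assumes "z \<in> resolvent_set A" "w \<in> resolvent_set A"
  shows "\<gamma> z h - \<gamma> w h = (z - w) \<cdot>\<^sub>C resolvent A z (\<gamma> w h)"
proof -
  define g where "g = \<Gamma> h"
  have "(z - w) \<cdot>\<^sub>C resolvent A z (\<gamma> w h) = (z - w) \<cdot>\<^sub>C resolvent A z g
      + (w - z0) \<cdot>\<^sub>C ((z - w) \<cdot>\<^sub>C resolvent A z (resolvent A w g))"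
    by (simp add: \<gamma>_def g_def cboundedD[OF resolvent_cbounded[OF assms(1)]] scaleC_add_right
        scaleC_scaleC mult.commute)
  also have "\<dots> = (z - w) \<cdot>\<^sub>C resolvent A z g + (w - z0) \<cdot>\<^sub>C (resolvent A z g - resolvent A w g)"
    by (simp add: resolvent_identity[OF assms])
  also have "\<dots> = \<gamma> z h - \<gamma> w h"
    by (simp add: \<gamma>_def g_def[symmetric] cvs.scale_right_diff_distrib cvs.scale_left_diff_distrib)
  finally show ?thesis by simp
qed

lemma kinner_\<gamma>:
  assumes "w \<in> resolvent_set A" "cnj w \<in> resolvent_set A"
  shows "kinner J x (\<gamma> w h) = cinner (Gp (x + (cnj w - cnj z0) \<cdot>\<^sub>C resolvent A (cnj w) x)) h"
  using resolvent_adjoint[of "cnj w" x "\<Gamma> h"] assms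
  by (simp add: \<gamma>_def cinner_Gp kinner_simps)

text \<open>After multiplication by \<open>z - cnj w\<close> the resolvent at \<open>cnj w\<close>
  disappears through \<open>\<gamma>_diff\<close>, and \<open>Q_formula\<close> identifies what is
  left. At \<open>z = cnj w\<close> the kernel would be a division by zero.\<close>

lemma kinner_\<gamma>_\<gamma>:
  assumes z: "z \<in> D" and w: "w \<in> D" and zw: "z \<noteq> cnj w"
  shows "kinner J (\<gamma> z h) (\<gamma> w k) = nev_kernel Q z w h k"
proof -
  have w': "cnj w \<in> D" using w by (rule D_cnj)
  note r = D_resolvent[OF z] D_resolvent[OF w] D_resolvent[OF w']
  define g where "g = \<gamma> z h"
  define g' where "g' = \<gamma> (cnj w) h"
  have 1: "(z - cnj w) \<cdot>\<^sub>C resolvent A (cnj w) g = g - g'"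
    using \<gamma>_diff[OF r(3,1), of h] unfolding g_def g'_def
    by (metis minus_diff_eq cvs.scale_minus_left)
  have "(z - cnj w) * kinner J g (\<gamma> w k)
      = cinner (Gp ((z - cnj w) \<cdot>\<^sub>C g + (cnj w - cnj z0) \<cdot>\<^sub>C ((z - cnj w) \<cdot>\<^sub>C resolvent A (cnj w) g))) k"
    by (simp add: kinner_\<gamma>[OF r(2,3)] cboundedD[OF Gp_cbounded] cinner_simps scaleC_scaleC algebra_simps)
  also have "\<dots> = (z - cnj z0) * cinner (Gp g) k - (cnj w - cnj z0) * cinner (Gp g') k"
    unfolding 1 by (simp add: cboundedD[OF Gp_cbounded] cinner_simps algebra_simps)
  also have "\<dots> = cinner (Q z h) k - cinner (Q (cnj w) h) k"
    by (simp add: Q_formula[OF z] Q_formula[OF w'] g_def g'_def cinner_simps)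
  also have "\<dots> = cinner (Q z h) k - cinner h (Q w k)" by (simp add: Q_adj[OF w'])
  finally show ?thesis
    using zw by (simp add: nev_kernel_def g_def field_simps)
qed

lemma \<gamma>_tendsto:
  assumes p: "p \<in> resolvent_set A" and f: "(f \<longlongrightarrow> p) F" "eventually (\<lambda>t. f t \<in> resolvent_set A) F"
    and g: "(g \<longlongrightarrow> h) F"
  shows "((\<lambda>t. \<gamma> (f t) (g t)) \<longlongrightarrow> \<gamma> p h) F"
proof -
  obtain e M where M: "e > 0" "M \<ge> 0"
    "\<And>z y. z \<in> resolvent_set A \<Longrightarrow> dist z p < e \<Longrightarrow> norm (resolvent A z y) \<le> M * norm y"
    using resolvent_locally_bounded[OF p] by metis
  have gp: "((\<lambda>t. \<gamma> p (g t)) \<longlongrightarrow> \<gamma> p h) F" by (rule cbounded_tendsto[OF \<gamma>_cbounded[OF p] g])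
  have "((\<lambda>t. \<gamma> (f t) (g t) - \<gamma> p (g t)) \<longlongrightarrow> 0) F"
  proof (rule Lim_null_comparison)
    show "eventually (\<lambda>t. norm (\<gamma> (f t) (g t) - \<gamma> p (g t)) \<le> dist (f t) p * (M * norm (\<gamma> p (g t)))) F"
      using f(2) tendstoD[OF f(1) M(1)]
    proof eventually_elim
      case (elim t)
      show ?case
        unfolding \<gamma>_diff[OF elim(1) p] norm_scaleC
        using M(3)[OF elim(1,2), of "\<gamma> p (g t)"] by (simp add: dist_norm mult_left_mono)
    qed
    have "((\<lambda>t. dist (f t) p * (M * norm (\<gamma> p (g t)))) \<longlongrightarrow> dist p p * (M * norm (\<gamma> p h))) F"
      by (intro tendsto_intros f(1) gp)
    then show "((\<lambda>t. dist (f t) p * (M * norm (\<gamma> p (g t)))) \<longlongrightarrow> 0) F" by simp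
  qed
  from tendsto_add[OF this gp] show ?thesis by simp
qed

lemma Q_tendsto:
  assumes p: "p \<in> D" and f: "(f \<longlongrightarrow> p) F" "eventually (\<lambda>t. f t \<in> D) F"
  shows "((\<lambda>t. Q (f t) h) \<longlongrightarrow> Q p h) F"
proof -
  have ev: "eventually (\<lambda>t. f t \<in> resolvent_set A) F" using f(2) by eventually_elim (rule D_resolvent)
  have "((\<lambda>t. Q (cnj z0) h + (f t - cnj z0) \<cdot>\<^sub>C Gp (\<gamma> (f t) h))
      \<longlongrightarrow> Q (cnj z0) h + (p - cnj z0) \<cdot>\<^sub>C Gp (\<gamma> p h)) F"
    by (intro tendsto_add tendsto_scaleC tendsto_diff tendsto_const f(1) cbounded_tendsto[OF Gp_cbounded]
        \<gamma>_tendsto D_resolvent p ev)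
  moreover have "eventually (\<lambda>t. Q (cnj z0) h + (f t - cnj z0) \<cdot>\<^sub>C Gp (\<gamma> (f t) h) = Q (f t) h) F"
    using f(2) by eventually_elim (rule Q_formula[symmetric])
  ultimately show ?thesis
    unfolding Q_formula[OF p, symmetric] by (rule Lim_transform_eventually)
qed

text \<open>Minimality survives restriction to a dense set of parameters because
  \<open>\<gamma>\<close> is strongly continuous on the resolvent set. This permits testing only at
  convenient points.\<close>

lemma span_\<gamma>_dense:
  assumes S: "S \<subseteq> resolvent_set A" "closure S = UNIV"
  shows "closure (cspan {\<gamma> z h | z h. z \<in> S}) = UNIV"
proof (rule closure_subspace_eq_UNIV)
  show "cvs.subspace (cspan {\<gamma> z h | z h. z \<in> S})" by (simp add: cspan_eq_span)
  fix y assume y: "\<And>s. s \<in> cspan {\<gamma> z h | z h. z \<in> S} \<Longrightarrow> cinner s y = 0"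
  have y0: "cinner (\<gamma> z h) y = 0" if "z \<in> S" for z h
    by (rule y) (use that in \<open>auto simp: cspan_eq_span intro: cvs.span_base\<close>)
  have y1: "cinner (\<gamma> p h) y = 0" if p: "p \<in> resolvent_set A" for p h
  proof -
    obtain f where f: "\<And>n. f n \<in> S" "f \<longlonglongrightarrow> p" using S(2) closure_sequential[of p S] by auto
    have "(\<lambda>n. \<gamma> (f n) h) \<longlonglongrightarrow> \<gamma> p h" 

      using f(1) S(1) by (intro \<gamma>_tendsto p f(2) tendsto_const always_eventually) auto
    then have "(\<lambda>n. cinner (\<gamma> (f n) h) y) \<longlonglongrightarrow> cinner (\<gamma> p h) y" by (intro tendsto_cinner tendsto_const)
    then show ?thesis using y0[OF f(1)] by (simp add: LIMSEQ_const_iff)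
  qed
  show "y = 0"
  proof (rule orthogonal_dense_eq_0[OF span_\<gamma>])
    fix s assume "s \<in> cspan {\<gamma> z h | z h. z \<in> resolvent_set A}"
    then obtain F c where F: "F \<subseteq> {\<gamma> z h | z h. z \<in> resolvent_set A}" "s = (\<Sum>s\<in>F. c s \<cdot>\<^sub>C s)"
      unfolding cspan_def by blast
    have "cinner t y = 0" if "t \<in> F" for t using that F(1) y1 by auto
    then show "cinner s y = 0" unfolding F(2) by (simp add: cinner_sum_left cinner_scaleC_left)
  qed
qed

text \<open>The point \<open>p\<close> may lie outside \<open>D\<close> and outside the resolvent
  set. The bound comes from \<open>resolvent_growth\<close>, with \<open>Im z\<close> kept away from
  0 by \<open>r\<close>, while \<open>L\<close> bounds the distances of \<open>z\<close> from
  \<open>z0\<close> and \<open>cnj z0\<close>.\<close>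

lemma Q_locally_bounded:
  assumes p: "Im p \<noteq> 0" "\<not> is_eigenvalue A p"
  obtains e M where "e > 0" "M \<ge> 0"
    "\<And>z h. z \<in> D \<Longrightarrow> dist z p < e \<Longrightarrow> norm (Q z h) \<le> M * norm h"
proof -
  obtain e C where e: "e > 0" "C \<ge> 0"
    "\<And>z x y. dist z p < e \<Longrightarrow> Im z \<noteq> 0 \<Longrightarrow> (x, y + z \<cdot>\<^sub>C x) \<in> A \<Longrightarrow>
       norm x \<le> (4 / \<bar>Im z\<bar> + C) * norm y" using resolvent_growth[OF p(2)] by metis
  obtain K1 where K1: "K1 > 0" "\<And>h. norm (\<Gamma> h) \<le> K1 * norm h" using cbounded_boundE[OF \<Gamma>_cbounded] by metis
  obtain K2 where K2: "K2 > 0" "\<And>h. norm (Gp h) \<le> K2 * norm h" using cbounded_boundE[OF Gp_cbounded] by metis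
  obtain K3 where K3: "K3 > 0" "\<And>h. norm (Q (cnj z0) h) \<le> K3 * norm h"
    using cbounded_boundE[OF Q_cbounded[OF D_cnj[OF z0_D]]] by metis
  define r where "r = \<bar>Im p\<bar> / 2"
  define B where "B = 4 / r + C"
  define e' where "e' = min e (min r 1)"
  define L where "L = 1 + cmod p + cmod z0"
  have r: "r > 0" using p(1) by (simp add: r_def)
  have B: "B \<ge> 0" using r e(2) by (simp add: B_def)
  have L: "L \<ge> 0" by (simp add: L_def)
  show ?thesis
  proof (rule that[of e' "K3 + L * (K2 * ((1 + L * B) * K1))"])
    show "e' > 0" using e(1) r by (simp add: e'_def)
    show "0 \<le> K3 + L * (K2 * ((1 + L * B) * K1))" using K1 K2 K3 L B by simp
    fix z h assume z: "z \<in> D" "dist z p < e'"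
    have "\<bar>Im p - Im z\<bar> \<le> dist z p"
      using abs_Im_le_cmod[of "p - z"] by (simp add: dist_norm norm_minus_commute)
    moreover have "dist z p < \<bar>Im p\<bar> / 2" using z(2) by (simp add: e'_def r_def)
    ultimately have im: "\<bar>Im z\<bar> \<ge> r" unfolding r_def by linarith
    have R: "norm (resolvent A z y) \<le> B * norm y" for y
    proof -
      have "norm (resolvent A z y) \<le> (4 / \<bar>Im z\<bar> + C) * norm y"
        using z im r by (intro e(3)[OF _ _ resolvent_mem[OF D_resolvent]]) (auto simp: e'_def)
      also have "\<dots> \<le> B * norm y"
        unfolding B_def using im r by (intro mult_right_mono add_mono divide_left_mono) auto
      finally show ?thesis .
    qed
    have zL: "cmod (z - z0) \<le> L" "cmod (z - cnj z0) \<le> L"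
    proof -
      have "cmod z \<le> cmod p + 1"
        using z(2) norm_triangle_ineq[of p "z - p"] by (simp add: e'_def dist_norm)
      then show "cmod (z - z0) \<le> L" "cmod (z - cnj z0) \<le> L"
        using norm_triangle_ineq4[of z z0] norm_triangle_ineq4[of z "cnj z0"] by (simp_all add: L_def)
    qed
    have "norm (\<gamma> z h) \<le> norm (\<Gamma> h) + cmod (z - z0) * norm (resolvent A z (\<Gamma> h))"
      unfolding \<gamma>_def by (metis norm_triangle_ineq norm_scaleC)
    also have "\<dots> \<le> norm (\<Gamma> h) + L * (B * norm (\<Gamma> h))"
      using zL(1) R L by (intro add_left_mono mult_mono) auto
    also have "\<dots> = (1 + L * B) * norm (\<Gamma> h)" by (simp add: algebra_simps)
    also have "\<dots> \<le> (1 + L * B) * (K1 * norm h)" using L B by (intro mult_left_mono K1) auto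
    finally have g: "norm (\<gamma> z h) \<le> (1 + L * B) * (K1 * norm h)" .
    have "norm (Q z h) \<le> norm (Q (cnj z0) h) + cmod (z - cnj z0) * norm (Gp (\<gamma> z h))"
      unfolding Q_formula[OF z(1)] by (metis norm_triangle_ineq norm_scaleC)
    also have "\<dots> \<le> K3 * norm h + L * (K2 * ((1 + L * B) * (K1 * norm h)))"
      using zL(2) L K2 order_trans[OF K2(2) mult_left_mono[OF g, of K2]]
      by (intro add_mono K3 mult_mono) auto
    finally show "norm (Q z h) \<le> (K3 + L * (K2 * ((1 + L * B) * K1))) * norm h"
      by (simp add: algebra_simps)
  qed
qed

text \<open>A nonreal point outside \<open>D\<close> is a pole, near which the operator norms are
  unbounded; this contradicts \<open>Q_locally_bounded\<close> unless \<open>p\<close> is an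
  eigenvalue.\<close>

lemma not_in_domain_eigenvalue:
  assumes mer: "op_meromorphic_nonreal Q D" and p: "Im p \<noteq> 0" "p \<notin> D"
  shows "is_eigenvalue A p"
proof (rule ccontr)
  assume ne: "\<not> is_eigenvalue A p"
  obtain e M where e: "e > 0" "M \<ge> 0"
    "\<And>z h. z \<in> D \<Longrightarrow> dist z p < e \<Longrightarrow> norm (Q z h) \<le> M * norm h"
    using Q_locally_bounded[OF p(1) ne] by metis
  have "op_pole Q D p" using mer p unfolding op_meromorphic_nonreal_def by blast
  then obtain r where r: "r > 0" "ball p r - {p} \<subseteq> D"
    and nb: "\<And>s M. s > 0 \<Longrightarrow> \<not> (\<forall>z\<in>ball p s - {p}. onorm (Q z) \<le> M)"
    unfolding op_pole_def by blast
  have "\<forall>z\<in>ball p (min e r) - {p}. onorm (Q z) \<le> M"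
  proof
    fix z assume "z \<in> ball p (min e r) - {p}"
    then have "z \<in> D" "dist z p < e" using r(2) by (auto simp: dist_commute)
    then show "onorm (Q z) \<le> M" using e(2,3) by (intro onorm_bound) auto
  qed
  then show False using nb[of "min e r" M] e(1) r(1) by simp
qed

end

section \<open>Inverse functions and intertwining of minimal realizations\<close>

text \<open>An isometric relation with dense domain and dense range between Pontryagin spaces is
  bounded: the negative part of a vector of the range is controlled by finitely many inner
  products with vectors of the range, which are inner products in the domain.\<close>

lemma isometry_extension:
  fixes J1 :: "'k1::chilbert \<Rightarrow> 'k1" and J2 :: "'k2::chilbert \<Rightarrow> 'k2"
    and I :: "'i set" and a :: "'i \<Rightarrow> 'k1" and b :: "'i \<Rightarrow> 'k2"
  assumes J1: "fund_symmetry J1" and J2: "fund_symmetry J2"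
    and iso: "\<And>i j. i \<in> I \<Longrightarrow> j \<in> I \<Longrightarrow> kinner J1 (a i) (a j) = kinner J2 (b i) (b j)"
    and a: "closure (cspan (a ` I)) = UNIV" and b: "closure (cspan (b ` I)) = UNIV"
  obtains v where "\<And>i. i \<in> I \<Longrightarrow> kinner J2 v (b i) = kinner J1 x (a i)"
proof -
  interpret K1: pontryagin_space J1 by unfold_locales (rule J1)
  interpret K2: pontryagin_space J2 by unfold_locales (rule J2)
  \<comment> \<open>The graph sending combinations of the \<open>a i\<close> to those of the
    \<open>b i\<close>. It is kept as a relation: that it is a function follows only from the norm
    bound below.\<close>
  define G where "G u v \<longleftrightarrow> (\<exists>F c. finite F \<and> F \<subseteq> I \<and> u = (\<Sum>i\<in>F. c i \<cdot>\<^sub>C a i) \<and> v = (\<Sum>i\<in>F. c i \<cdot>\<^sub>C b i))"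
    for u v
  have G_iso: "kinner J1 u u' = kinner J2 v v'" if "G u v" "G u' v'" for u v u' v'
  proof -
    from that obtain F c F' c' where F: "F \<subseteq> I" "u = (\<Sum>i\<in>F. c i \<cdot>\<^sub>C a i)" "v = (\<Sum>i\<in>F. c i \<cdot>\<^sub>C b i)"
      and F': "F' \<subseteq> I" "u' = (\<Sum>i\<in>F'. c' i \<cdot>\<^sub>C a i)" "v' = (\<Sum>i\<in>F'. c' i \<cdot>\<^sub>C b i)"
      unfolding G_def by blast
    show ?thesis
      unfolding F F' K1.kinner_sum_left K1.kinner_sum_right K2.kinner_sum_left K2.kinner_sum_right
        K1.kinner_simps K2.kinner_simps
      using F(1) F'(1) by (intro sum.cong refl) (simp add: iso subset_iff)
  qed
  have G_gen: "G (a i) (b i)" if "i \<in> I" for i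
    unfolding G_def using that
    by (intro exI[of _ "{i}"] exI[of _ "\<lambda>_. 1"]) (simp add: scaleC_one)
  have G_diff: "G (u - u') (v - v')" if "G u v" "G u' v'" for u v u' v'
  proof -
    from that obtain F c F' c' where F: "finite F" "F \<subseteq> I" "u = (\<Sum>i\<in>F. c i \<cdot>\<^sub>C a i)" "v = (\<Sum>i\<in>F. c i \<cdot>\<^sub>C b i)"
      and F': "finite F'" "F' \<subseteq> I" "u' = (\<Sum>i\<in>F'. c' i \<cdot>\<^sub>C a i)" "v' = (\<Sum>i\<in>F'. c' i \<cdot>\<^sub>C b i)"
      unfolding G_def by blast
    define d where "d i = (if i \<in> F then c i else 0) - (if i \<in> F' then c' i else 0)" for i
    have s: "(\<Sum>i\<in>F. c i \<cdot>\<^sub>C f i) - (\<Sum>i\<in>F'. c' i \<cdot>\<^sub>C f i) = (\<Sum>i\<in>F \<union> F'. d i \<cdot>\<^sub>C f i)"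
      for f :: "'i \<Rightarrow> 'd::cinner_space"
    proof -
      have "(\<Sum>i\<in>F. c i \<cdot>\<^sub>C f i) = (\<Sum>i\<in>F \<union> F'. (if i \<in> F then c i else 0) \<cdot>\<^sub>C f i)"
        using F(1) F'(1) by (intro sum.mono_neutral_cong_left) auto
      moreover have "(\<Sum>i\<in>F'. c' i \<cdot>\<^sub>C f i) = (\<Sum>i\<in>F \<union> F'. (if i \<in> F' then c' i else 0) \<cdot>\<^sub>C f i)"
        using F(1) F'(1) by (intro sum.mono_neutral_cong_left) auto
      ultimately show ?thesis by (simp add: d_def cvs.scale_left_diff_distrib sum_subtractf)
    qed
    show ?thesis
      unfolding G_def F(3,4) F'(3,4) s
      using F(1,2) F'(1,2) by (intro exI[of _ "F \<union> F'"] exI[of _ d]) auto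
  qed
  have idx: "\<exists>F c. finite F \<and> F \<subseteq> I \<and> u = (\<Sum>i\<in>F. c i \<cdot>\<^sub>C f i)"
    if "u \<in> cspan (f ` I)" for u and f :: "'i \<Rightarrow> 'd::cinner_space"
  proof -
    from that obtain F c where F: "finite F" "F \<subseteq> f ` I" "u = (\<Sum>s\<in>F. c s \<cdot>\<^sub>C s)"
      unfolding cspan_def by blast
    have "\<exists>U\<subseteq>I. inj_on f U \<and> F = f ` U" using F(2) by (rule subset_image_inj[THEN iffD1])
    then obtain F' where F': "F' \<subseteq> I" "inj_on f F'" "F = f ` F'" by metis
    have "finite F'" using F(1) F'(2,3) finite_imageD by metis
    moreover have "u = (\<Sum>i\<in>F'. c (f i) \<cdot>\<^sub>C f i)"
      unfolding F(3) F'(3) by (simp add: sum.reindex[OF F'(2)])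
    ultimately show ?thesis
      using F'(1) by (intro exI[of _ F'] exI[of _ "\<lambda>i. c (f i)"] conjI)
  qed
  have G_I: "G (\<Sum>i\<in>F. c i \<cdot>\<^sub>C a i) (\<Sum>i\<in>F. c i \<cdot>\<^sub>C b i)" if "finite F" "F \<subseteq> I" for F c
    unfolding G_def using that by (intro exI[of _ F] exI[of _ c] conjI refl)
  have dom: "\<exists>v. G u v" if "u \<in> cspan (a ` I)" for u
    using idx[OF that] G_I by metis
  have ran: "\<exists>u. G u v" if "v \<in> cspan (b ` I)" for v
    using idx[OF that] G_I by metis
  obtain E :: "'k2 set" and e where E: "finite E" "\<And>t. t \<in> E \<Longrightarrow> e t \<in> cspan (b ` I)"
    "\<And>v. norm (K2.neg_part v) \<le> 1/4 * norm v + (\<Sum>t\<in>E. cmod (kinner J2 v (e t)))"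
    using K2.neg_part_dense_bound[OF b, of "1/4"] by auto
  have "\<forall>t\<in>E. \<exists>d. G d (e t)" using E(2) ran by blast
  then obtain d where d: "\<And>t. t \<in> E \<Longrightarrow> G (d t) (e t)" by metis
  define C where "C = (\<Sum>t\<in>E. norm (d t))"
  have C: "C \<ge> 0" unfolding C_def by (intro sum_nonneg) simp
  \<comment> \<open>The constant is \<open>8 * (C + 1) + 1\<close>, the one in
    \<open>quadratic_bound\<close> with \<open>t = 0\<close> and \<open>b = C + 1\<close>.\<close>
  have G_bound: "norm v \<le> (8 * C + 9) * norm u" if uv: "G u v" for u v
  proof -
    have "cmod (kinner J2 v (e t)) \<le> norm (d t) * norm u" if "t \<in> E" for t
      using K1.kinner_bound[of u "d t"] G_iso[OF uv d[OF that]] by (simp add: mult.commute)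
    then have "(\<Sum>t\<in>E. cmod (kinner J2 v (e t))) \<le> C * norm u"
      unfolding C_def sum_distrib_right by (intro sum_mono)
    then have "norm (K2.neg_part v) \<le> norm v / 4 + C * norm u" using E(3)[of v] by simp
    then have "(norm (K2.neg_part v))\<^sup>2 \<le> (norm v / 4 + C * norm u)\<^sup>2" by (intro power_mono) auto
    moreover have "Re (kinner J2 v v) \<le> (norm u)\<^sup>2"
      using complex_Re_le_cmod[of "kinner J1 u u"] K1.kinner_bound[of u u] G_iso[OF uv uv]
      by (simp add: power2_eq_square)
    ultimately have "(norm v)\<^sup>2 \<le> (norm u)\<^sup>2 + 2 * (norm v / 4 + C * norm u)\<^sup>2"
      unfolding K2.norm_eq_kinner_neg_part[of v] by linarith
    \<comment> \<open>The loose square of \<open>norm u\<close> is absorbed by raising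
      \<open>C\<close> to \<open>C + 1\<close>, which gives the shape that
      \<open>quadratic_bound\<close> expects.\<close>
    also have "\<dots> \<le> 0 * norm u * norm v + 2 * (norm v / 4 + (C + 1) * norm u)\<^sup>2"
    proof -
      have "(norm v / 4 + (C + 1) * norm u)\<^sup>2
          = (norm v / 4 + C * norm u)\<^sup>2 + (norm u)\<^sup>2 + 2 * ((norm v / 4 + C * norm u) * norm u)"
        by (simp add: power2_eq_square algebra_simps)
      moreover have "(norm v / 4 + C * norm u) * norm u \<ge> 0" using C by simp
      ultimately show ?thesis by simp
    qed
    finally show ?thesis using quadratic_bound[of "norm v" "norm u" 0 "C + 1"] C by (simp add: add.commute)
  qed
  obtain u where u: "\<And>n. u n \<in> cspan (a ` I)" "u \<longlonglongrightarrow> x"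
    using a closure_sequential[of x "cspan (a ` I)"] by auto
  obtain v where v: "\<And>n. G (u n) (v n)" using dom[OF u(1)] by metis
  have "Cauchy v"
  proof (rule metric_CauchyI)
    fix \<epsilon> :: real assume \<epsilon>: "\<epsilon> > 0"
    have K: "8 * C + 9 > 0" using C by simp
    have "Cauchy u" using u(2) by (rule LIMSEQ_imp_Cauchy)
    then obtain M where M: "\<And>m n. m \<ge> M \<Longrightarrow> n \<ge> M \<Longrightarrow> dist (u m) (u n) < \<epsilon> / (8 * C + 9)"
      using \<epsilon> K unfolding Cauchy_def by (metis divide_pos_pos)
    have "dist (v m) (v n) < \<epsilon>" if "m \<ge> M" "n \<ge> M" for m n
    proof -
      have "dist (v m) (v n) \<le> (8 * C + 9) * dist (u m) (u n)"
        using G_bound[OF G_diff[OF v v]] by (simp add: dist_norm)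
      also have "\<dots> < (8 * C + 9) * (\<epsilon> / (8 * C + 9))" using M[OF that] K by (intro mult_strict_left_mono)
      finally show ?thesis using K by simp
    qed
    then show "\<exists>M. \<forall>m\<ge>M. \<forall>n\<ge>M. dist (v m) (v n) < \<epsilon>" by blast
  qed
  then obtain y where y: "v \<longlonglongrightarrow> y" using Cauchy_convergent_iff convergent_def by metis
  show ?thesis
  proof (rule that)
    fix i assume i: "i \<in> I"
    have "(\<lambda>n. kinner J2 (v n) (b i)) \<longlonglongrightarrow> kinner J2 y (b i)" by (intro K2.tendsto_kinner y tendsto_const)
    moreover have "(\<lambda>n. kinner J1 (u n) (a i)) \<longlonglongrightarrow> kinner J1 x (a i)"
      by (intro K1.tendsto_kinner u(2) tendsto_const)
    moreover have "kinner J1 (u n) (a i) = kinner J2 (v n) (b i)" for n by (rule G_iso[OF v G_gen[OF i]])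
    ultimately show "kinner J2 y (b i) = kinner J1 x (a i)" using LIMSEQ_unique by auto
  qed
qed

lemma (in selfadjoint_rel) resolvent_not_eigenvalue:
  "z \<in> resolvent_set A \<Longrightarrow> \<not> is_eigenvalue A z"
  using resolvent_eigenvector[of z _ z] unfolding is_eigenvalue_def by auto

section \<open>The inverse function\<close>

context nev_realization
begin

lemma Qhat_cbounded: "z \<in> Dhat Q D \<Longrightarrow> cbounded (Qhat Q z)"
  using cbounded_scaleC[OF bdd_invertibleD(2), of "Q z" "-1"] by (simp add: Dhat_def Qhat_def[abs_def])

text \<open>The Hilbert space adjoint of the inverse of \<open>Q z\<close> is a bounded two-sided
  inverse of \<open>Q (cnj z)\<close>.\<close>

lemma Dhat_cnj_Qhat_adj:
  assumes z: "z \<in> Dhat Q D"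
  shows "cnj z \<in> Dhat Q D" "cinner (Qhat Q z x) y = cinner x (Qhat Q (cnj z) y)"
proof -
  have zD: "z \<in> D" and inv: "bdd_invertible (Q z)" using z by (auto simp: Dhat_def)
  note S = bdd_invertibleD[OF inv]
  obtain S' where S': "cbounded S'" "\<And>x y. cinner (inv_into UNIV (Q z) x) y = cinner x (S' y)"
    using cbounded_adjoint_exists[OF S(2)] by metis
  have eq: "u = v" if "\<And>x. cinner x u = cinner x v" for u v :: 'h
    by (rule cinner_eqI) (metis that cinner_commute)
  have "S' (Q (cnj z) y) = y" for y
    by (rule eq) (simp add: S'(2)[symmetric] Q_adj[OF zD, symmetric] S)
  moreover have "Q (cnj z) (S' y) = y" for y
    by (rule eq) (simp add: S'(2)[symmetric] Q_adj[OF zD, symmetric] S)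
  ultimately have "bdd_invertible (Q (cnj z))" "inv_into UNIV (Q (cnj z)) = S'"
    using bdd_invertibleI[OF Q_cbounded[OF D_cnj[OF zD]] S'(1)] by auto
  then show "cnj z \<in> Dhat Q D" "cinner (Qhat Q z x) y = cinner x (Qhat Q (cnj z) y)"
    using D_cnj[OF zD] S'(2) by (auto simp: Dhat_def Qhat_def cinner_simps)
qed

lemma open_Dhat:
  assumes mer: "op_meromorphic_nonreal Q D"
  shows "open (Dhat Q D)"
  unfolding open_contains_ball
proof
  fix z assume z: "z \<in> Dhat Q D"
  then have zD: "z \<in> D" and inv: "bdd_invertible (Q z)" by (auto simp: Dhat_def)
  obtain M where M: "M > 0" "\<And>x. norm (inv_into UNIV (Q z) x) \<le> M * norm x"
    using cbounded_boundE[OF bdd_invertibleD(2)[OF inv]] by metis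
  have "open D" "op_holomorphic_on Q D" using mer by (auto simp: op_meromorphic_nonreal_def)
  then obtain e C where e: "e > 0" "C \<ge> 0" "ball z e \<subseteq> D"
    "\<And>w x. dist w z < e \<Longrightarrow> norm (Q w x - Q z x) \<le> C * dist w z * norm x"
    using op_holomorphic_lipschitz[OF _ _ zD] by metis
  define r where "r = min e (1 / (M * (C + 1)))"
  have "w \<in> Dhat Q D" if w: "w \<in> ball z r" for w
  proof -
    have d: "dist w z < e" "dist w z < 1 / (M * (C + 1))" using w by (auto simp: r_def dist_commute)
    have wD: "w \<in> D" using d(1) e(3) by (auto simp: dist_commute)
    have "M * (C * dist w z) \<le> (M * (C + 1)) * dist w z"
      using M(1) by (simp add: algebra_simps)
    also have "\<dots> < (M * (C + 1)) * (1 / (M * (C + 1)))"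
      using d(2) M(1) e(2) by (intro mult_strict_left_mono) auto
    also have "\<dots> = 1" using M(1) e(2) by simp
    finally have "M * (C * dist w z) < 1" .
    then have "bdd_invertible (Q w)"
      using bdd_invertible_perturb[OF inv M(2) Q_cbounded[OF wD] e(4)[OF d(1)]] M(1) e(2) by simp
    then show ?thesis using wD by (simp add: Dhat_def)
  qed
  moreover have "r > 0" using e(1,2) M(1) by (simp add: r_def)
  ultimately show "\<exists>e>0. ball z e \<subseteq> Dhat Q D" by blast
qed

lemma kinner_resolvent_\<gamma>:
  assumes "z \<in> resolvent_set A" "cnj z \<in> resolvent_set A" "w \<in> resolvent_set A"
  shows "(z - cnj w) * kinner J (resolvent A z u) (\<gamma> w k) = kinner J u (\<gamma> (cnj z) k) - kinner J u (\<gamma> w k)"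
  using arg_cong[OF \<gamma>_diff[OF assms(2,3), of k], of "kinner J u"]
  by (simp add: resolvent_adjoint[OF assms(1,2)] kinner_simps)

text \<open>What matters is that the right-hand side does not depend on \<open>w\<close>: pairings
  at different points can be compared through one vector of \<open>'h\<close>.\<close>

lemma kinner_\<gamma>_rel:
  assumes "(x, x') \<in> A" "w \<in> resolvent_set A" "cnj w \<in> resolvent_set A"
  shows "kinner J (x' - cnj w \<cdot>\<^sub>C x) (\<gamma> w h) = cinner (Gp (x' - cnj z0 \<cdot>\<^sub>C x)) h"
proof -
  have "resolvent A (cnj w) (x' - cnj w \<cdot>\<^sub>C x) = x"
    by (rule resolvent_eqI[OF assms(3)]) (simp add: assms(1))
  then have "kinner J (x' - cnj w \<cdot>\<^sub>C x) (\<gamma> w h)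
      = cinner (Gp (x' - cnj w \<cdot>\<^sub>C x + (cnj w - cnj z0) \<cdot>\<^sub>C x)) h"
    unfolding kinner_\<gamma>[OF assms(2,3)] by simp
  then show ?thesis by (simp add: cvs.scale_left_diff_distrib)
qed

end

section \<open>Minimal realizations of the function and of its inverse\<close>

locale nev_pair = nev_realization Q D J A z0 \<Gamma> Gp
  for Q :: "complex \<Rightarrow> 'h::chilbert \<Rightarrow> 'h" and D :: "complex set"
    and J :: "'k::chilbert \<Rightarrow> 'k" and A :: "('k \<times> 'k) set"
    and z0 :: complex and \<Gamma> :: "'h \<Rightarrow> 'k" and Gp :: "'k \<Rightarrow> 'h" +
  fixes J2 :: "'k2::chilbert \<Rightarrow> 'k2" and A2 :: "('k2 \<times> 'k2) set"
    and z2 :: complex and \<Gamma>2 :: "'h \<Rightarrow> 'k2" and Gp2 :: "'k2 \<Rightarrow> 'h"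
  assumes real2: "min_realization (Qhat Q) (Dhat Q D) J2 A2 z2 \<Gamma>2 Gp2"
    and mer: "op_meromorphic_nonreal Q D"
begin

sublocale inv: nev_realization "Qhat Q" "Dhat Q D" J2 A2 z2 \<Gamma>2 Gp2
  by unfold_locales (use real2 Dhat_cnj_Qhat_adj Qhat_cbounded in blast)+

abbreviation "\<gamma>2 \<equiv> inv.\<gamma>"

lemma Dhat_D: "z \<in> Dhat Q D \<Longrightarrow> z \<in> D"
  by (simp add: Dhat_def)

text \<open>On \<open>W\<close>, the upper half plane without the eigenvalues of \<open>A\<close>
  and \<open>A2\<close>, invertibility of \<open>Q\<close> is an open and relatively closed
  condition. \<open>W\<close> stays connected because only finitely many points are removed, and
  \<open>z2\<close> is a point of \<open>W\<close> where \<open>Q\<close> is invertible.\<close>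

lemma Dhat_cofinite:
  obtains F where "finite F" "F \<subseteq> {z. Im z > 0}" "{z. Im z > 0} - F \<subseteq> Dhat Q D"
proof -
  define F where "F = {z. Im z > 0 \<and> is_eigenvalue A z} \<union> {z. Im z > 0 \<and> is_eigenvalue A2 z}"
  define W where "W = {z. Im z > 0} - F"
  have F: "finite F" unfolding F_def
    using finite_upper_eigenvalues[OF z0_resolvent] inv.finite_upper_eigenvalues[OF inv.z0_resolvent] by simp
  have opW: "open W" unfolding W_def using F by (intro open_Diff open_halfspace_Im_gt finite_imp_closed)
  have conW: "connected W" unfolding W_def
    using F by (intro connected_open_delete_finite open_halfspace_Im_gt convex_connected convex_halfspace_Im_gt) auto
  have WD: "W \<subseteq> D"
    using not_in_domain_eigenvalue[OF mer] unfolding W_def F_def by fastforce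
  have op2: "open (W - Dhat Q D)"
    unfolding open_contains_ball
  proof
    fix p assume p: "p \<in> W - Dhat Q D"
    then have pD: "p \<in> D" and "Im p \<noteq> 0" "\<not> is_eigenvalue A2 p" using WD by (auto simp: W_def F_def)
    then obtain e M where e: "e > 0" "M \<ge> 0"
      "\<And>z h. z \<in> Dhat Q D \<Longrightarrow> dist z p < e \<Longrightarrow> norm (Qhat Q z h) \<le> M * norm h"
      using inv.Q_locally_bounded[of p] by metis
    have "open D" "op_holomorphic_on Q D" using mer by (auto simp: op_meromorphic_nonreal_def)
    then obtain d C where d: "d > 0" "C \<ge> 0" "ball p d \<subseteq> D"
      "\<And>w x. dist w p < d \<Longrightarrow> norm (Q w x - Q p x) \<le> C * dist w p * norm x"
      using op_holomorphic_lipschitz[OF _ _ pD] by metis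
    obtain r0 where r0: "r0 > 0" "ball p r0 \<subseteq> W" using opW p openE by blast
    \<comment> \<open>The bound \<open>M\<close> on inverses is uniform near \<open>p\<close>, so
      the perturbation runs from \<open>z\<close> to \<open>p\<close>: a single invertible
      \<open>Q z\<close> in this ball would make \<open>Q p\<close> invertible.\<close>
    define r where "r = min r0 (min (min e d) (1 / ((M + 1) * (C + 1))))"
    have "z \<notin> Dhat Q D" if z: "z \<in> ball p r" for z
    proof
      assume zh: "z \<in> Dhat Q D"
      have dz: "dist z p < e" "dist z p < d" "dist z p < 1 / ((M + 1) * (C + 1))"
        using z by (auto simp: r_def dist_commute)
      have "M * (C * dist z p) \<le> ((M + 1) * (C + 1)) * dist z p"
        unfolding mult.assoc using e(2) d(2) by (intro mult_mono) auto
      also have "\<dots> < ((M + 1) * (C + 1)) * (1 / ((M + 1) * (C + 1)))"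
        using dz(3) e(2) d(2) by (intro mult_strict_left_mono) auto
      also have "\<dots> = 1" using e(2) d(2) by simp
      finally have lt: "M * (C * dist z p) < 1" .
      have "bdd_invertible (Q p)"
      proof (rule bdd_invertible_perturb)
        show "bdd_invertible (Q z)" using zh by (simp add: Dhat_def)
        show "norm (inv_into UNIV (Q z) x) \<le> M * norm x" for x using e(3)[OF zh dz(1), of x] by (simp add: Qhat_def)
        show "cbounded (Q p)" by (rule Q_cbounded[OF pD])
        show "norm (Q p x - Q z x) \<le> (C * dist z p) * norm x" for x
          using d(4)[OF dz(2), of x] by (simp add: norm_minus_commute)
      qed (use e(2) d(2) lt in auto)
      then show False using p pD by (simp add: Dhat_def)
    qed
    moreover have "ball p r \<subseteq> W" using r0(2) by (auto simp: r_def)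
    moreover have "r > 0" using r0 e d by (simp add: r_def)
    ultimately show "\<exists>e>0. ball p e \<subseteq> W - Dhat Q D" by blast
  qed
  have "z2 \<in> Dhat Q D \<inter> W"
    using inv.z0_D inv.z0_upper resolvent_not_eigenvalue[OF D_resolvent[OF Dhat_D]]
      inv.resolvent_not_eigenvalue[OF inv.z0_resolvent] by (auto simp: W_def F_def)
  then have "(W - Dhat Q D) \<inter> W = {}"
    using connectedD[OF conW open_Dhat[OF mer] op2] by blast
  then have "W \<subseteq> Dhat Q D" by blast
  then show ?thesis using that[OF F] unfolding W_def F_def by blast
qed

lemma Dhat_diff_finite_dense:
  assumes B: "finite B"
  shows "closure (Dhat Q D - B) = UNIV"
proof -
  obtain F where F: "finite F" "{z. Im z > 0} - F \<subseteq> Dhat Q D" using Dhat_cofinite by metis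
  have "\<exists>z\<in>Dhat Q D - B. dist z p < e" if e: "e > 0" for p e
  proof -
    define f where "f t = p + \<i> * complex_of_real t" for t
    \<comment> \<open>Excluded are \<open>F\<close> and its mirror image, \<open>B\<close>, and the
      only real point on the vertical line through \<open>p\<close>. A short segment of that line is
      infinite and so contains a point outside.\<close>
    define X where "X = F \<union> cnj ` F \<union> B \<union> {complex_of_real (Re p)}"
    have "inj_on f {0<..<e}" unfolding f_def by (intro inj_onI) simp
    then have "infinite (f ` {0<..<e})"
      using e by (simp add: finite_image_iff)
    then obtain z where z: "z \<in> f ` {0<..<e}" "z \<notin> X"
      using F(1) B finite_subset[of "f ` {0<..<e}" X] unfolding X_def by blast
    then obtain t where t: "t > 0" "t < e" "z = f t" by auto
    have "Im z \<noteq> 0" using z(2) t(3) by (auto simp: X_def f_def complex_eq_iff)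
    moreover have "cnj z \<notin> F" using z(2) by (force simp: X_def)
    ultimately have "z \<in> {z. Im z > 0} - F \<or> cnj z \<in> {z. Im z > 0} - F"
      using z(2) by (auto simp: X_def)
    then have "z \<in> Dhat Q D"
      using subsetD[OF F(2), of z] subsetD[OF F(2), of "cnj z"] inv.D_cnj[of "cnj z"]
      by (elim disjE) simp_all
    then show ?thesis using z(2) t by (intro bexI[of _ z]) (auto simp: X_def f_def dist_norm norm_mult)
  qed
  then show ?thesis by (auto simp: closure_approachable)
qed

text \<open>The map taking \<open>\<gamma> z (inv_into UNIV (Q z) h)\<close> to
  \<open>\<gamma>2 z h\<close>. It is specified by its inner products with the vectors
  \<open>\<gamma>2 w k\<close>: \<open>isometry_extension\<close> yields existence and density
  yields uniqueness.\<close>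

definition V :: "'k \<Rightarrow> 'k2" where
  "V x = (SOME v. \<forall>w\<in>Dhat Q D. \<forall>k. kinner J2 v (\<gamma>2 w k) = kinner J x (\<gamma> w (inv_into UNIV (Q w) k)))"

text \<open>The kernel of the inverse function at \<open>h\<close>, \<open>k\<close> is the kernel
  of \<open>Q\<close> at the preimages of \<open>h\<close>, \<open>k\<close>: the numerators agree
  term by term.\<close>

lemma kinner_\<gamma>_inverse:
  assumes z: "z \<in> Dhat Q D" and w: "w \<in> Dhat Q D"
  shows "kinner J (\<gamma> z (inv_into UNIV (Q z) h)) (\<gamma> w (inv_into UNIV (Q w) k)) = kinner J2 (\<gamma>2 z h) (\<gamma>2 w k)"
proof -
  let ?q = "\<lambda>z. inv_into UNIV (Q z)"
  have ne: "kinner J (\<gamma> z (?q z h)) (\<gamma> w (?q w k)) = kinner J2 (\<gamma>2 z h) (\<gamma>2 w k)"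
    if "z \<in> Dhat Q D" "z \<noteq> cnj w" for z
  proof -
    have "Q z (?q z h) = h" "Q w (?q w k) = k"
      using that(1) w by (auto simp: Dhat_def bdd_invertibleD)
    then show ?thesis
      using kinner_\<gamma>_\<gamma>[OF Dhat_D Dhat_D, OF that(1) w that(2)] inv.kinner_\<gamma>_\<gamma>[OF that(1) w that(2)]
      by (simp add: nev_kernel_def Qhat_def cinner_simps)
  qed
  show ?thesis
  proof (cases "z = cnj w")
    case True
    have ev: "eventually (\<lambda>t. t \<in> Dhat Q D) (at z)"
      using eventually_at_in_open'[OF open_Dhat[OF mer] z] .
    have ev': "eventually (\<lambda>t. t \<in> resolvent_set A) (at z)"
      "eventually (\<lambda>t. t \<in> resolvent_set A2) (at z)"
      using ev by (auto elim!: eventually_mono intro: D_resolvent Dhat_D inv.D_resolvent)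
    have "((\<lambda>t. - Qhat Q t h) \<longlongrightarrow> - Qhat Q z h) (at z)"
      by (intro tendsto_minus inv.Q_tendsto z tendsto_ident_at ev)
    then have "((\<lambda>t. ?q t h) \<longlongrightarrow> ?q z h) (at z)" by (simp add: Qhat_def)
    then have lim1: "((\<lambda>t. kinner J (\<gamma> t (?q t h)) (\<gamma> w (?q w k)))
        \<longlongrightarrow> kinner J (\<gamma> z (?q z h)) (\<gamma> w (?q w k))) (at z)"
      by (intro tendsto_kinner tendsto_const \<gamma>_tendsto tendsto_ident_at ev' D_resolvent Dhat_D z)
    have lim2: "((\<lambda>t. kinner J2 (\<gamma>2 t h) (\<gamma>2 w k)) \<longlongrightarrow> kinner J2 (\<gamma>2 z h) (\<gamma>2 w k)) (at z)"
      by (intro inv.tendsto_kinner tendsto_const inv.\<gamma>_tendsto tendsto_ident_at ev' inv.D_resolvent z)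
    have "((\<lambda>t. kinner J (\<gamma> t (?q t h)) (\<gamma> w (?q w k))) \<longlongrightarrow> kinner J2 (\<gamma>2 z h) (\<gamma>2 w k)) (at z)"
    proof (rule Lim_transform_eventually[OF lim2])
      show "eventually (\<lambda>t. kinner J2 (\<gamma>2 t h) (\<gamma>2 w k) = kinner J (\<gamma> t (?q t h)) (\<gamma> w (?q w k))) (at z)"
        using ev eventually_neq_at_within[of z z UNIV]
      proof eventually_elim
        case (elim t)
        then show ?case using ne[of t] True by simp
      qed
    qed
    from tendsto_unique[OF trivial_limit_at lim1 this] show ?thesis .
  qed (rule ne[OF z])
qed

lemma V:
  assumes "w \<in> Dhat Q D"
  shows "kinner J2 (V x) (\<gamma>2 w k) = kinner J x (\<gamma> w (inv_into UNIV (Q w) k))"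
proof -
  define I where "I = Dhat Q D \<times> (UNIV :: 'h set)"
  define a where "a = (\<lambda>(w, k). \<gamma> w (inv_into UNIV (Q w) k))"
  define b where "b = (\<lambda>(w, k). \<gamma>2 w k)"
  have a: "a ` I = {\<gamma> z h | z h. z \<in> Dhat Q D}"
  proof -
    have "\<exists>k. h = inv_into UNIV (Q z) k" if "z \<in> Dhat Q D" for z h
      using that bdd_invertibleD(3)[of "Q z" h] by (auto simp: Dhat_def intro: exI[of _ "Q z h"])
    then have q: "range (inv_into UNIV (Q z)) = UNIV" if "z \<in> Dhat Q D" for z
      using that by blast
    have "a ` I = (\<Union>z\<in>Dhat Q D. \<gamma> z ` range (inv_into UNIV (Q z)))"
      by (auto simp: a_def I_def)
    also have "\<dots> = (\<Union>z\<in>Dhat Q D. range (\<gamma> z))" by (intro SUP_cong refl) (simp add: q)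
    finally show ?thesis by auto
  qed
  have b: "b ` I = {\<gamma>2 z h | z h. z \<in> Dhat Q D}" by (auto simp: b_def I_def)
  have dense: "closure (Dhat Q D) = UNIV" using Dhat_diff_finite_dense[of "{}"] by simp
  have sub: "Dhat Q D \<subseteq> resolvent_set A" "Dhat Q D \<subseteq> resolvent_set A2"
    using D_resolvent Dhat_D inv.D_resolvent by blast+
  obtain v where "\<And>i. i \<in> I \<Longrightarrow> kinner J2 v (b i) = kinner J x (a i)"
  proof (rule isometry_extension[OF fund inv.fund, of I a b x])
    show "kinner J (a i) (a j) = kinner J2 (b i) (b j)" if "i \<in> I" "j \<in> I" for i j
      using that kinner_\<gamma>_inverse by (auto simp: a_def b_def I_def)
    show "closure (cspan (a ` I)) = UNIV" unfolding a by (rule span_\<gamma>_dense[OF sub(1) dense])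
    show "closure (cspan (b ` I)) = UNIV" unfolding b by (rule inv.span_\<gamma>_dense[OF sub(2) dense])
    fix v assume "\<And>i. i \<in> I \<Longrightarrow> kinner J2 v (b i) = kinner J x (a i)"
    then show thesis by (rule that)
  qed
  then have "\<forall>w\<in>Dhat Q D. \<forall>k. kinner J2 v (\<gamma>2 w k) = kinner J x (\<gamma> w (inv_into UNIV (Q w) k))"
    by (auto simp: a_def b_def I_def)
  then have "\<forall>w\<in>Dhat Q D. \<forall>k. kinner J2 (V x) (\<gamma>2 w k) = kinner J x (\<gamma> w (inv_into UNIV (Q w) k))"
    unfolding V_def by (rule someI)
  then show ?thesis using assms by blast
qed

lemma kinner_\<gamma>2_eqI:
  assumes "finite B" "\<And>w k. w \<in> Dhat Q D - B \<Longrightarrow> kinner J2 x (\<gamma>2 w k) = kinner J2 y (\<gamma>2 w k)"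
  shows "x = y"
proof (rule inv.kinner_dense_eqI)
  show "closure (cspan {\<gamma>2 w k | w k. w \<in> Dhat Q D - B}) = UNIV"
    using inv.D_resolvent by (intro inv.span_\<gamma>_dense Dhat_diff_finite_dense assms(1)) blast
qed (use assms(2) in auto)

lemma V_add: "V (x + y) = V x + V y" and V_scaleC: "V (c \<cdot>\<^sub>C x) = c \<cdot>\<^sub>C V x"
  by (rule kinner_\<gamma>2_eqI[of "{}"]; simp add: V kinner_simps inv.kinner_simps)+

lemma V_diff: "V (x - y) = V x - V y"
  using V_add[of x "(-1) \<cdot>\<^sub>C y"] V_scaleC[of "-1" y] by simp

text \<open>The \<open>\<gamma>2\<close> term measures how far \<open>V\<close> is from intertwining
  \<open>A\<close> with \<open>A2\<close>. Tested against \<open>\<gamma>2 w k\<close> and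
  multiplied by \<open>z - cnj w\<close>, the left-hand side becomes a difference of two pairings of
  \<open>x' - z x\<close>. By \<open>kinner_\<gamma>_rel\<close> both involve the same vector
  \<open>g\<close>, and what remains besides a pairing of \<open>x\<close> is a kernel value of
  \<open>Qhat Q\<close>.\<close>

lemma V_resolvent:
  assumes xA: "(x, x') \<in> A" and z: "z \<in> Dhat Q D"
  shows "resolvent A2 z (V x' - z \<cdot>\<^sub>C V x) = V x - \<gamma>2 z (Gp (x' - cnj z0 \<cdot>\<^sub>C x))"
proof (rule kinner_\<gamma>2_eqI[of "{cnj z}"])
  define g where "g = Gp (x' - cnj z0 \<cdot>\<^sub>C x)"
  let ?q = "\<lambda>z. inv_into UNIV (Q z)"
  fix w k assume w: "w \<in> Dhat Q D - {cnj z}"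
  then have wh: "w \<in> Dhat Q D" and zw: "z \<noteq> cnj w" by auto
  note res = D_resolvent[OF Dhat_D] inv.D_resolvent inv.D_cnj
  have zc: "cnj z \<in> Dhat Q D" and wc: "cnj w \<in> Dhat Q D" using z wh by (auto intro: inv.D_cnj)
  have e1: "kinner J (x' - z \<cdot>\<^sub>C x) (\<gamma> (cnj z) h) = cinner g h" for h
    using kinner_\<gamma>_rel[OF xA, of "cnj z" h] res z zc by (simp add: g_def)
  have e2: "kinner J (x' - z \<cdot>\<^sub>C x) (\<gamma> w h) = cinner g h - (z - cnj w) * kinner J x (\<gamma> w h)" for h
    using kinner_\<gamma>_rel[OF xA, of w h] res wh wc by (simp add: g_def kinner_simps algebra_simps)
  have "(z - cnj w) * kinner J2 (resolvent A2 z (V (x' - z \<cdot>\<^sub>C x))) (\<gamma>2 w k)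
      = kinner J (x' - z \<cdot>\<^sub>C x) (\<gamma> (cnj z) (?q (cnj z) k)) - kinner J (x' - z \<cdot>\<^sub>C x) (\<gamma> w (?q w k))"
    using res z zc wh by (simp add: inv.kinner_resolvent_\<gamma> V)
  also have "\<dots> = (z - cnj w) * kinner J x (\<gamma> w (?q w k)) - (cinner g (Qhat Q (cnj z) k) - cinner g (Qhat Q w k))"
    by (simp add: e1 e2 Qhat_def cinner_simps)
  also have "cinner g (Qhat Q (cnj z) k) - cinner g (Qhat Q w k) = (z - cnj w) * nev_kernel (Qhat Q) z w g k"
    using zw by (simp add: nev_kernel_def inv.Q_adj[OF z])
  also have "(z - cnj w) * kinner J x (\<gamma> w (?q w k)) - \<dots> = (z - cnj w) * kinner J2 (V x - \<gamma>2 z g) (\<gamma>2 w k)"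
    by (simp add: inv.kinner_simps V[OF wh] inv.kinner_\<gamma>_\<gamma>[OF z wh zw] algebra_simps)
  finally show "kinner J2 (resolvent A2 z (V x' - z \<cdot>\<^sub>C V x)) (\<gamma>2 w k)
      = kinner J2 (V x - \<gamma>2 z (Gp (x' - cnj z0 \<cdot>\<^sub>C x))) (\<gamma>2 w k)"
    using zw by (simp add: V_diff V_scaleC g_def)
qed simp

text \<open>At the base point \<open>\<gamma>2 z2\<close> is \<open>\<Gamma>2\<close>, so the
  defining property of \<open>V\<close> at \<open>z2\<close> determines \<open>Gp2\<close> on this
  vector.\<close>

lemma V_Gp:
  assumes xA: "(x, x') \<in> A"
  shows "Gp2 (V x' - cnj z2 \<cdot>\<^sub>C V x) = - Qhat Q (cnj z2) (Gp (x' - cnj z0 \<cdot>\<^sub>C x))"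
proof (rule cinner_eqI)
  fix k
  note z2 = inv.z0_D
  have z2c: "cnj z2 \<in> Dhat Q D" by (rule inv.D_cnj[OF z2])
  have "cinner (Gp2 (V x' - cnj z2 \<cdot>\<^sub>C V x)) k = kinner J2 (V (x' - cnj z2 \<cdot>\<^sub>C x)) (\<gamma>2 z2 k)"
    by (simp add: inv.cinner_Gp inv.\<gamma>_def V_diff V_scaleC)
  also have "\<dots> = cinner (Gp (x' - cnj z0 \<cdot>\<^sub>C x)) (inv_into UNIV (Q z2) k)"
    using kinner_\<gamma>_rel[OF xA D_resolvent[OF Dhat_D[OF z2]] D_resolvent[OF Dhat_D[OF z2c]]]
    by (simp add: V[OF z2])
  also have "\<dots> = cinner (- Qhat Q (cnj z2) (Gp (x' - cnj z0 \<cdot>\<^sub>C x))) k"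
    by (simp add: cinner_simps inv.Q_adj[OF z2c]) (simp add: Qhat_def cinner_simps)
  finally show "cinner (Gp2 (V x' - cnj z2 \<cdot>\<^sub>C V x)) k
      = cinner (- Qhat Q (cnj z2) (Gp (x' - cnj z0 \<cdot>\<^sub>C x))) k" .
qed

text \<open>By \<open>kinner_\<gamma>_rel\<close> an eigenvector with \<open>Gp x = 0\<close> is
  orthogonal to all gamma field values, which minimality excludes. This yields the nonzero leading
  limit of a pole cancellation function.\<close>

lemma Gp_eigenvector_nonzero:
  assumes x: "x \<noteq> 0" "(x, \<nu> \<cdot>\<^sub>C x) \<in> A"
  shows "Gp x \<noteq> 0"
proof
  assume G: "Gp x = 0"
  have 0: "kinner J x (\<gamma> w k) = 0" if w: "w \<in> Dhat Q D" for w k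
  proof -
    note r = D_resolvent[OF Dhat_D[OF w]] D_resolvent[OF Dhat_D[OF inv.D_cnj[OF w]]]
    have "\<nu> \<noteq> cnj w"
      using resolvent_not_eigenvalue[OF r(2)] x unfolding is_eigenvalue_def by blast
    moreover have "(\<nu> - cnj w) * kinner J x (\<gamma> w k) = 0"
      using kinner_\<gamma>_rel[OF x(2) r, of k] G
      by (simp add: kinner_simps cboundedD[OF Gp_cbounded] left_diff_distrib)
    ultimately show ?thesis by simp
  qed
  have "Dhat Q D \<subseteq> resolvent_set A" using D_resolvent Dhat_D by blast
  moreover have "closure (Dhat Q D) = UNIV" using Dhat_diff_finite_dense[of "{}"] by simp
  ultimately have "closure (cspan {\<gamma> w k | w k. w \<in> Dhat Q D}) = UNIV" by (rule span_\<gamma>_dense)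
  then have "x = 0"
    by (rule kinner_dense_eqI) (auto simp: 0 kinner_simps)
  then show False using x(1) by simp
qed

end

section \<open>Vector-valued holomorphic functions\<close>

definition has_hderiv :: "(complex \<Rightarrow> 'h::cinner_space) \<Rightarrow> 'h \<Rightarrow> complex \<Rightarrow> bool" where
  "has_hderiv f v z \<longleftrightarrow> ((\<lambda>w. inverse (w - z) \<cdot>\<^sub>C (f w - f z)) \<longlongrightarrow> v) (at z)"

lemma hholomorphic_onI: "(\<And>z. z \<in> S \<Longrightarrow> has_hderiv f (f' z) z) \<Longrightarrow> hholomorphic_on f S"
  unfolding hholomorphic_on_def has_hderiv_def by blast

lemma hholomorphic_onD: "hholomorphic_on f S \<Longrightarrow> z \<in> S \<Longrightarrow> has_hderiv f (hderiv f z) z"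
  unfolding hholomorphic_on_def has_hderiv_def hderiv_def by (rule someI_ex) blast

lemma has_hderiv_transform:
  assumes S: "open S" "z \<in> S" "\<And>w. w \<in> S \<Longrightarrow> f w = g w"
  shows "has_hderiv f v z \<longleftrightarrow> has_hderiv g v z"
proof -
  have "eventually (\<lambda>w. w \<in> S) (at z)" using eventually_at_in_open'[OF S(1,2)] .
  then have "eventually (\<lambda>w. inverse (w - z) \<cdot>\<^sub>C (f w - f z) = inverse (w - z) \<cdot>\<^sub>C (g w - g z)) (at z)"
    by eventually_elim (use S in simp)
  then show ?thesis unfolding has_hderiv_def by (rule tendsto_cong)
qed

lemma hderiv_cong:
  assumes "open S" "z \<in> S" "\<And>w. w \<in> S \<Longrightarrow> f w = g w"
  shows "hderiv f z = hderiv g z"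
  unfolding hderiv_def has_hderiv_def[symmetric]
  by (rule arg_cong[of _ _ Eps]) (rule ext, rule has_hderiv_transform[OF assms])

lemma hholomorphic_on_cong:
  assumes "open S" "\<And>w. w \<in> S \<Longrightarrow> f w = g w"
  shows "hholomorphic_on f S \<longleftrightarrow> hholomorphic_on g S"
  unfolding hholomorphic_on_def has_hderiv_def[symmetric]
  by (intro ball_cong refl ex_cong1 has_hderiv_transform[OF assms(1) _ assms(2)])

lemma hderivs_cong:
  assumes "open S" "\<And>w. w \<in> S \<Longrightarrow> f w = g w" "z \<in> S"
  shows "hderivs j f z = hderivs j g z"
  using assms(3)
proof (induction j arbitrary: z)
  case (Suc j)
  then show ?case using hderiv_cong[OF assms(1) Suc.prems, of "hderivs j f" "hderivs j g"] by simp
qed (use assms(2) in simp)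

lemma has_hderiv_tendsto:
  assumes "has_hderiv f v z"
  shows "(f \<longlongrightarrow> f z) (at z)"
proof -
  have "((\<lambda>w. f z + (w - z) \<cdot>\<^sub>C (inverse (w - z) \<cdot>\<^sub>C (f w - f z))) \<longlongrightarrow> f z + (z - z) \<cdot>\<^sub>C v) (at z)"
    using assms unfolding has_hderiv_def by (intro tendsto_add tendsto_scaleC tendsto_intros)
  moreover have "eventually (\<lambda>w. f z + (w - z) \<cdot>\<^sub>C (inverse (w - z) \<cdot>\<^sub>C (f w - f z)) = f w) (at z)"
    using eventually_neq_at_within[of z z UNIV]
    by eventually_elim (simp add: scaleC_scaleC scaleC_one)
  ultimately show ?thesis by (simp add: Lim_transform_eventually)
qed

lemma hholomorphic_on_continuous_on: "hholomorphic_on f S \<Longrightarrow> continuous_on S f"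
  unfolding continuous_on_def
  using has_hderiv_tendsto[OF hholomorphic_onD] tendsto_within_subset[OF _ subset_UNIV] by blast

lemma has_hderiv_const: "has_hderiv (\<lambda>_. c) 0 z"
  unfolding has_hderiv_def by simp

lemma has_hderiv_add:
  assumes "has_hderiv f u z" "has_hderiv g v z"
  shows "has_hderiv (\<lambda>z. f z + g z) (u + v) z"
  using tendsto_add[OF assms[unfolded has_hderiv_def]] unfolding has_hderiv_def
  by (simp add: cvs.scale_right_diff_distrib scaleC_add_right algebra_simps)

lemma has_hderiv_cbounded:
  assumes T: "cbounded T" and f: "has_hderiv f u z"
  shows "has_hderiv (\<lambda>z. T (f z)) (T u) z"
  using cbounded_tendsto[OF T f[unfolded has_hderiv_def]] unfolding has_hderiv_def
  by (simp add: cboundedD[OF T])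

lemma has_hderiv_scaleC:
  assumes c: "(c has_field_derivative c') (at z)" and f: "has_hderiv f u z"
  shows "has_hderiv (\<lambda>z. c z \<cdot>\<^sub>C f z) (c' \<cdot>\<^sub>C f z + c z \<cdot>\<^sub>C u) z"
proof -
  have "((\<lambda>w. ((c w - c z) / (w - z)) \<cdot>\<^sub>C f w + c z \<cdot>\<^sub>C (inverse (w - z) \<cdot>\<^sub>C (f w - f z)))
      \<longlongrightarrow> c' \<cdot>\<^sub>C f z + c z \<cdot>\<^sub>C u) (at z)"
    using c f has_hderiv_tendsto[OF f] unfolding has_hderiv_def has_field_derivative_iff
    by (intro tendsto_add tendsto_scaleC tendsto_const)
  moreover have "((c w - c z) / (w - z)) \<cdot>\<^sub>C f w + c z \<cdot>\<^sub>C (inverse (w - z) \<cdot>\<^sub>C (f w - f z))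
      = inverse (w - z) \<cdot>\<^sub>C (c w \<cdot>\<^sub>C f w - c z \<cdot>\<^sub>C f z)" for w
  proof -
    have e: "(c w - c z) / (w - z) = inverse (w - z) * c w - inverse (w - z) * c z"
      by (simp add: divide_inverse algebra_simps)
    show ?thesis unfolding e
      by (simp add: cvs.scale_right_diff_distrib cvs.scale_left_diff_distrib scaleC_scaleC mult.commute)
  qed
  ultimately show ?thesis unfolding has_hderiv_def by simp
qed

lemma has_field_derivative_cinner:
  assumes "has_hderiv f v z"
  shows "((\<lambda>w. cinner (f w) k) has_field_derivative cinner v k) (at z)"
  using tendsto_cinner[OF assms[unfolded has_hderiv_def] tendsto_const[of k]]
  unfolding has_field_derivative_iff by (simp add: cinner_simps divide_inverse mult.commute)

lemma holomorphic_on_cinner: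
  assumes "hholomorphic_on f S"
  shows "(\<lambda>w. cinner (f w) k) holomorphic_on S"
  unfolding holomorphic_on_def field_differentiable_def
  using has_field_derivative_cinner[OF hholomorphic_onD[OF assms]] has_field_derivative_at_within by blast

lemma deriv_cinner:
  assumes "hholomorphic_on f S" "z \<in> S"
  shows "deriv (\<lambda>w. cinner (f w) k) z = cinner (hderiv f z) k"
  by (rule DERIV_imp_deriv[OF has_field_derivative_cinner[OF hholomorphic_onD[OF assms]]])

text \<open>Cauchy estimates for \<open>cinner (f _) k\<close>, uniform in unit vectors \<open>k\<close>, make the difference
  quotients of the derivative a Cauchy net.\<close>

lemma hderiv_hholomorphic_on:
  fixes f :: "complex \<Rightarrow> 'h::chilbert"
  assumes S: "open S" and f: "hholomorphic_on f S"
  shows "hholomorphic_on (hderiv f) S"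
  unfolding hholomorphic_on_def
proof
  fix z assume "z \<in> S"
  then obtain R where R: "R > 0" "cball z R \<subseteq> S" using S open_contains_cball by blast
  have "compact (f ` cball z R)"
    using hholomorphic_on_continuous_on[OF f] R(2) continuous_on_subset
    by (intro compact_continuous_image) auto
  then obtain M where M: "\<And>w. w \<in> cball z R \<Longrightarrow> norm (f w) \<le> M"
    using compact_imp_bounded bounded_iff by (metis imageI)
  have M0: "M \<ge> 0" using M[of z] R(1) norm_ge_zero order_trans by (metis centre_in_cball less_imp_le)
  define r where "r = R / 2"
  have r: "r > 0" using R by (simp add: r_def)
  \<comment> \<open>Cauchy bound for the third derivative of a component: expanding the first
    derivative to first order leaves the third one in the remainder.\<close>
  define C where "C = fact 3 * M / r ^ 3"
  have C0: "C \<ge> 0" using M0 r by (simp add: C_def)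
  define q where "q w = inverse (w - z) \<cdot>\<^sub>C (hderiv f w - hderiv f z)" for w
  have sub: "cball w r \<subseteq> cball z R" if "w \<in> ball z r" for w
  proof
    fix u assume "u \<in> cball w r"
    then show "u \<in> cball z R" using that dist_triangle[of z u w] by (simp add: r_def)
  qed
  have taylor: "cmod (cinner (q w) k - (deriv ^^ 2) (\<lambda>w. cinner (f w) k) z) \<le> C * norm k * dist w z"
    if w: "w \<in> ball z r" "w \<noteq> z" for w k
  proof -
    let ?g = "\<lambda>w. cinner (f w) k"
    have g: "?g holomorphic_on S" using holomorphic_on_cinner[OF f] .
    have bd: "cmod ((deriv ^^ 3) ?g x) \<le> C * norm k" if x: "x \<in> ball z r" for x
    proof -
      have "cmod ((deriv ^^ 3) ?g x) \<le> fact 3 * (M * norm k) / r ^ 3"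
      proof (rule Cauchy_inequality)
        show "?g holomorphic_on ball x r"
          using g sub[OF x] R(2) by (meson ball_subset_cball holomorphic_on_subset order_trans)
        show "continuous_on (cball x r) ?g"
          using g sub[OF x] R(2) by (meson holomorphic_on_imp_continuous_on holomorphic_on_subset order_trans)
        fix y assume "cmod (x - y) = r"
        then have "y \<in> cball z R" using sub[OF x] by (auto simp: dist_norm)
        then show "cmod (?g y) \<le> M * norm k"
          using cinner_cauchy_schwarz[of "f y" k] mult_right_mono[OF M, of y "norm k"] by simp
      qed (use r in auto)
      then show ?thesis by (simp add: C_def)
    qed
    have "cmod ((deriv ^^ Suc 0) ?g w - (\<Sum>i\<le>1. (deriv ^^ Suc i) ?g z * (w - z) ^ i / fact i))
        \<le> (C * norm k) * cmod (w - z) ^ Suc 1 / fact 1"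
    proof (rule complex_Taylor[of "ball z r" 1 "\<lambda>i. (deriv ^^ Suc i) ?g"])
      show "((deriv ^^ Suc i) ?g has_field_derivative (deriv ^^ Suc (Suc i)) ?g x) (at x within ball z r)"
        if "x \<in> ball z r" for i x
      proof -
        have hol: "(deriv ^^ Suc i) ?g holomorphic_on S" by (rule holomorphic_higher_deriv[OF g S])
        have "x \<in> S" using that R by (auto simp: r_def)
        from holomorphic_derivI[OF hol S this]
        have "((deriv ^^ Suc i) ?g has_field_derivative deriv ((deriv ^^ Suc i) ?g) x) (at x)" .
        then show ?thesis by (simp add: has_field_derivative_at_within)
      qed
      show "cmod ((deriv ^^ Suc (Suc 1)) ?g x) \<le> C * norm k" if "x \<in> ball z r" for x
        using bd[OF that] by (simp add: numeral_3_eq_3)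
    qed (use w r in auto)
    moreover have "z \<in> S" "w \<in> S" using w(1) R by (auto simp: r_def)
    ultimately have "cmod (cinner (hderiv f w) k - cinner (hderiv f z) k - (deriv ^^ 2) ?g z * (w - z))
        \<le> C * norm k * (cmod (w - z))\<^sup>2"
      by (simp add: deriv_cinner[OF f] numeral_2_eq_2 algebra_simps)
    moreover have "(w - z) * cinner (q w) k = cinner (hderiv f w) k - cinner (hderiv f z) k"
      using w(2) by (simp add: q_def cinner_simps)
    then have "cinner (hderiv f w) k - cinner (hderiv f z) k - (deriv ^^ 2) ?g z * (w - z)
        = (w - z) * (cinner (q w) k - (deriv ^^ 2) ?g z)"
      by (simp only: right_diff_distrib mult.commute)
    ultimately have "cmod (w - z) * cmod (cinner (q w) k - (deriv ^^ 2) ?g z)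
        \<le> cmod (w - z) * (C * norm k * cmod (w - z))"
      by (simp add: norm_mult power2_eq_square mult_ac)
    then show ?thesis using w(2) by (simp add: dist_norm)
  qed
  have q: "norm (q w - q w') \<le> C * (dist w z + dist w' z)"
    if "w \<in> ball z r" "w \<noteq> z" "w' \<in> ball z r" "w' \<noteq> z" for w w'
  proof (rule norm_le_cinnerI)
    fix k
    show "cmod (cinner (q w - q w') k) \<le> C * (dist w z + dist w' z) * norm k"
      using taylor[OF that(1,2), of k] taylor[OF that(3,4), of k]
        norm_triangle_ineq4[of "cinner (q w) k - (deriv ^^ 2) (\<lambda>w. cinner (f w) k) z"
          "cinner (q w') k - (deriv ^^ 2) (\<lambda>w. cinner (f w) k) z"]
      by (simp add: cinner_simps algebra_simps)
  qed (use C0 in simp)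
  \<comment> \<open>A concrete sequence used to produce the limit by completeness; the denominator
    starts at 2, so that all points lie strictly inside \<open>ball z r\<close>.\<close>
  define t where "t n = z + complex_of_real (r / real (Suc (Suc n)))" for n
  have dt: "dist (t n) z = r / real (Suc (Suc n))" for n
    unfolding t_def dist_norm add_diff_cancel_left' norm_of_real using r by simp
  have t: "t n \<in> ball z r" "t n \<noteq> z" for n
  proof -
    have "r / real (Suc (Suc n)) < r / 1" using r by (intro divide_strict_left_mono) auto
    then have "r / real (Suc (Suc n)) < r" by simp
    then show "t n \<in> ball z r" using dt[of n] by (simp add: dist_commute)
    show "t n \<noteq> z" using dt[of n] r by auto
  qed
  have dt0: "(\<lambda>n. dist (t n) z) \<longlonglongrightarrow> 0"
    unfolding dt using LIMSEQ_Suc[OF LIMSEQ_Suc[OF lim_const_over_n[of r]]] by simp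
  have "Cauchy (\<lambda>n. q (t n))"
  proof (rule metric_CauchyI)
    fix e :: real assume e: "e > 0"
    have "eventually (\<lambda>n. dist (t n) z < e / (2 * (C + 1))) sequentially"
      using order_tendstoD(2)[OF dt0] e C0 by simp
    then obtain N where N: "\<And>n. n \<ge> N \<Longrightarrow> dist (t n) z < e / (2 * (C + 1))"
      unfolding eventually_sequentially by blast
    have "dist (q (t m)) (q (t n)) < e" if "m \<ge> N" "n \<ge> N" for m n
    proof -
      have "dist (q (t m)) (q (t n)) \<le> C * (dist (t m) z + dist (t n) z)"
        using q[OF t t] by (simp add: dist_norm)
      also have "\<dots> \<le> (C + 1) * (dist (t m) z + dist (t n) z)" by (intro mult_right_mono) auto
      also have "\<dots> < (C + 1) * (e / (2 * (C + 1)) + e / (2 * (C + 1)))"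
        using N[OF that(1)] N[OF that(2)] C0 by (intro mult_strict_left_mono) auto
      finally have lt: "dist (q (t m)) (q (t n)) < (C + 1) * (e / (2 * (C + 1)) + e / (2 * (C + 1)))" .
      have K: "K * (e / (2 * K) + e / (2 * K)) = e" if "K > 0" for K :: real
        using that by (simp add: field_simps)
      have "C + 1 > 0" using C0 by simp
      from lt[unfolded K[OF this]] show ?thesis .
    qed
    then show "\<exists>N. \<forall>m\<ge>N. \<forall>n\<ge>N. dist (q (t m)) (q (t n)) < e" by blast
  qed
  then obtain v where v: "(\<lambda>n. q (t n)) \<longlonglongrightarrow> v" using Cauchy_convergent_iff convergent_def by metis
  have qv: "norm (q w - v) \<le> C * dist w z" if w: "w \<in> ball z r" "w \<noteq> z" for w
  proof (rule tendsto_le[OF sequentially_bot])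
    show "(\<lambda>n. norm (q w - q (t n))) \<longlonglongrightarrow> norm (q w - v)" by (intro tendsto_intros v)
    have "(\<lambda>n. C * (dist w z + dist (t n) z)) \<longlonglongrightarrow> C * (dist w z + 0)" by (intro tendsto_intros dt0)
    then show "(\<lambda>n. C * (dist w z + dist (t n) z)) \<longlonglongrightarrow> C * dist w z" by simp
    show "eventually (\<lambda>n. norm (q w - q (t n)) \<le> C * (dist w z + dist (t n) z)) sequentially"
      using q[OF w t] by (intro always_eventually) blast
  qed
  have "((\<lambda>w. q w - v) \<longlongrightarrow> 0) (at z)"
  proof (rule Lim_null_comparison)
    show "eventually (\<lambda>w. norm (q w - v) \<le> C * dist w z) (at z)"
      unfolding eventually_at using qv r by (intro exI[of _ r]) (auto simp: dist_commute)
    have "((\<lambda>w. C * dist w z) \<longlongrightarrow> C * dist z z) (at z)" by (intro tendsto_intros)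
    then show "((\<lambda>w. C * dist w z) \<longlongrightarrow> 0) (at z)" by simp
  qed
  then have "(q \<longlongrightarrow> v) (at z)" by (rule Lim_null[THEN iffD2])
  then show "\<exists>v. ((\<lambda>w. inverse (w - z) \<cdot>\<^sub>C (hderiv f w - hderiv f z)) \<longlongrightarrow> v) (at z)"
    unfolding q_def by blast
qed

lemma hderivs_hholomorphic_on:
  fixes f :: "complex \<Rightarrow> 'h::chilbert"
  assumes "open S" "hholomorphic_on f S"
  shows "hholomorphic_on (hderivs j f) S"
  by (induction j) (simp_all add: assms hderiv_hholomorphic_on)

text \<open>Reduces derivatives of Hilbert space valued functions to complex derivatives of their
  components, where sum rules and Cauchy estimates are at hand.\<close>

lemma higher_deriv_cinner:
  fixes f :: "complex \<Rightarrow> 'h::chilbert"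
  assumes S: "open S" and f: "hholomorphic_on f S" and z: "z \<in> S"
  shows "(deriv ^^ j) (\<lambda>w. cinner (f w) k) z = cinner (hderivs j f z) k"
  using z
proof (induction j arbitrary: z)
  case (Suc j)
  have "eventually (\<lambda>w. w \<in> S) (nhds z)" using S Suc.prems by (rule eventually_nhds_in_open)
  then have "eventually (\<lambda>w. (deriv ^^ j) (\<lambda>w. cinner (f w) k) w = cinner (hderivs j f w) k) (nhds z)"
    by eventually_elim (rule Suc.IH)
  then have "deriv ((deriv ^^ j) (\<lambda>w. cinner (f w) k)) z = deriv (\<lambda>w. cinner (hderivs j f w) k) z"
    by (rule deriv_cong_ev) simp
  then show ?case
    using deriv_cinner[OF hderivs_hholomorphic_on[OF S f] Suc.prems] by simp
qed simp

lemma hderivs_add: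
  fixes f g :: "complex \<Rightarrow> 'h::chilbert"
  assumes S: "open S" and f: "hholomorphic_on f S" and g: "hholomorphic_on g S" and z: "z \<in> S"
  shows "hderivs j (\<lambda>w. f w + g w) z = hderivs j f z + hderivs j g z"
proof (rule cinner_eqI)
  fix k
  have fg: "hholomorphic_on (\<lambda>w. f w + g w) S"
    by (rule hholomorphic_onI[OF has_hderiv_add[OF hholomorphic_onD[OF f] hholomorphic_onD[OF g]]])
  have "cinner (hderivs j (\<lambda>w. f w + g w) z) k = (deriv ^^ j) (\<lambda>w. cinner (f w) k + cinner (g w) k) z"
    using higher_deriv_cinner[OF S fg z, of j k] by (simp add: cinner_simps)
  also have "\<dots> = (deriv ^^ j) (\<lambda>w. cinner (f w) k) z + (deriv ^^ j) (\<lambda>w. cinner (g w) k) z"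
    by (rule higher_deriv_add[OF holomorphic_on_cinner[OF f] holomorphic_on_cinner[OF g] S z])
  also have "\<dots> = cinner (hderivs j f z + hderivs j g z) k"
    by (simp add: higher_deriv_cinner[OF S f z] higher_deriv_cinner[OF S g z] cinner_simps)
  finally show "cinner (hderivs j (\<lambda>w. f w + g w) z) k = cinner (hderivs j f z + hderivs j g z) k" .
qed

lemma norm_hderivs_le:
  fixes f :: "complex \<Rightarrow> 'h::chilbert"
  assumes S: "open S" and f: "hholomorphic_on f S" and r: "r > 0" "cball z r \<subseteq> S"
    and B: "\<And>w. w \<in> cball z r \<Longrightarrow> norm (f w) \<le> B"
  shows "norm (hderivs j f z) \<le> fact j * B / r ^ j"
proof (rule norm_le_cinnerI)
  have "B \<ge> 0" using B[of z] r(1) norm_ge_zero order_trans by (metis centre_in_cball less_imp_le)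
  then show "0 \<le> fact j * B / r ^ j" using r(1) by simp
  fix k
  have z: "z \<in> S" using r by auto
  let ?g = "\<lambda>w. cinner (f w) k"
  have g: "?g holomorphic_on S" using holomorphic_on_cinner[OF f] .
  have "cmod ((deriv ^^ j) ?g z) \<le> fact j * (B * norm k) / r ^ j"
  proof (rule Cauchy_inequality)
    show "?g holomorphic_on ball z r"
      using g r(2) by (meson ball_subset_cball holomorphic_on_subset order_trans)
    show "continuous_on (cball z r) ?g"
      using g r(2) by (meson holomorphic_on_imp_continuous_on holomorphic_on_subset)
    fix y assume "cmod (z - y) = r"
    then have "y \<in> cball z r" by (auto simp: dist_norm)
    then show "cmod (?g y) \<le> B * norm k"
      using cinner_cauchy_schwarz[of "f y" k] mult_right_mono[OF B, of y "norm k"] by simp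
  qed (use r in auto)
  then show "cmod (cinner (hderivs j f z) k) \<le> fact j * B / r ^ j * norm k"
    by (simp add: higher_deriv_cinner[OF S f z])
qed

text \<open>A disc of radius \<open>Im z / 2\<close> around a point of a Stolz angle lies in a larger Stolz angle, so
  Cauchy's estimate lowers the nontangential vanishing order by one for each derivative.\<close>

lemma nontangential_hderivs_null:
  fixes f :: "complex \<Rightarrow> 'h::chilbert"
  assumes U: "open U" "complex_of_real \<alpha> \<in> U" and f: "hholomorphic_on f (U \<inter> {z. Im z > 0})"
    and lim: "\<And>c. c > 0 \<Longrightarrow>
      ((\<lambda>z. norm (f z) / cmod (z - \<alpha>) ^ m) \<longlongrightarrow> 0) (at (complex_of_real \<alpha>) within stolz \<alpha> c)"
    and j: "j \<le> m" and c: "c > 0"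
  shows "(hderivs j f \<longlongrightarrow> 0) (at (complex_of_real \<alpha>) within stolz \<alpha> c)"
proof (rule tendstoI)
  fix e :: real assume e: "e > 0"
  define S where "S = U \<inter> {z. Im z > 0}"
  have S: "open S" unfolding S_def using U(1) by (intro open_Int open_halfspace_Im_gt)
  obtain \<delta>0 where \<delta>0: "\<delta>0 > 0" "ball (complex_of_real \<alpha>) \<delta>0 \<subseteq> U" using U openE by blast
  \<comment> \<open>\<open>fact j\<close> is from Cauchy's inequality, \<open>2 ^ m\<close> from
    doubling the distance to \<alpha> on the disc, and the last factor from the radius
    \<open>Im z / 2\<close>, which is at least \<open>d / (2 * (c + 1))\<close>.\<close>
  define B where "B = fact j * 2 ^ m * (2 * (c + 1)) ^ j"
  have B: "B > 0" using c by (simp add: B_def)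
  define \<epsilon> where "\<epsilon> = e / (2 * B)"
  have \<epsilon>: "\<epsilon> > 0" using e B by (simp add: \<epsilon>_def)
  have "eventually (\<lambda>z. norm (f z) / cmod (z - \<alpha>) ^ m < \<epsilon>)
      (at (complex_of_real \<alpha>) within stolz \<alpha> (2 * c + 1))"
    using order_tendstoD(2)[OF lim \<epsilon>] c by simp
  then obtain \<delta>1 where \<delta>1: "\<delta>1 > 0" "\<And>w. w \<in> stolz \<alpha> (2 * c + 1) \<Longrightarrow> w \<noteq> complex_of_real \<alpha> \<Longrightarrow>
      dist w (complex_of_real \<alpha>) < \<delta>1 \<Longrightarrow> norm (f w) / cmod (w - \<alpha>) ^ m < \<epsilon>"
    unfolding eventually_at by blast
  define \<delta> where "\<delta> = min 1 (min (\<delta>0 / 2) (\<delta>1 / 2))"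
  have "\<delta> > 0" using \<delta>0 \<delta>1 by (simp add: \<delta>_def)
  moreover have "dist (hderivs j f z) 0 < e"
    if z: "z \<in> stolz \<alpha> c" "dist z (complex_of_real \<alpha>) < \<delta>" for z
  proof -
    define d where "d = cmod (z - \<alpha>)"
    have im: "Im z > 0" and re: "\<bar>Re z - \<alpha>\<bar> \<le> c * Im z" using z(1) by (auto simp: stolz_def)
    have imd: "Im z \<le> d" using abs_Im_le_cmod[of "z - \<alpha>"] im by (simp add: d_def)
    then have d0: "d > 0" using im by simp
    have d: "d < 1" "d < \<delta>0 / 2" "d < \<delta>1 / 2" using z(2) by (auto simp: \<delta>_def d_def dist_norm)
    have dle: "d \<le> (c + 1) * Im z"
      using cmod_le[of "z - \<alpha>"] re im by (simp add: d_def distrib_right)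
    \<comment> \<open>On the disc \<open>Im w\<close> is at least \<open>Im z / 2\<close>, so its
      points lie in the Stolz angle with constant \<open>2 * c + 1\<close>, at distance at most
      \<open>2 * d\<close> from \<alpha>.\<close>
    have w: "w \<in> S \<and> norm (f w) \<le> \<epsilon> * (2 * d) ^ m" if w: "w \<in> cball z (Im z / 2)" for w
    proof -
      have wz: "cmod (w - z) \<le> Im z / 2" using w by (simp add: dist_norm norm_minus_commute)
      then have imw: "Im w \<ge> Im z / 2" and rew: "\<bar>Re w - Re z\<bar> \<le> Im z / 2"
        using abs_Im_le_cmod[of "w - z"] abs_Re_le_cmod[of "w - z"] by auto
      have "(2 * c + 1) * (Im z / 2) = c * Im z + Im z / 2" by (simp add: algebra_simps)
      then have "\<bar>Re w - \<alpha>\<bar> \<le> (2 * c + 1) * (Im z / 2)" using re rew by linarith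
      also have "\<dots> \<le> (2 * c + 1) * Im w" using imw c by (intro mult_left_mono) auto
      finally have st: "w \<in> stolz \<alpha> (2 * c + 1)" using imw im by (simp add: stolz_def)
      have wd: "cmod (w - \<alpha>) \<le> 2 * d"
        using norm_triangle_ineq[of "w - z" "z - \<alpha>"] wz imd im by (simp add: d_def)
      have ne: "w \<noteq> complex_of_real \<alpha>" using imw im by auto
      have "norm (f w) / cmod (w - \<alpha>) ^ m < \<epsilon>"
        using \<delta>1(2)[OF st ne] wd d(3) by (simp add: dist_norm)
      then have "norm (f w) \<le> \<epsilon> * cmod (w - \<alpha>) ^ m" using ne by (simp add: field_simps)
      also have "\<dots> \<le> \<epsilon> * (2 * d) ^ m" using wd \<epsilon> by (intro mult_left_mono power_mono) auto
      finally have "norm (f w) \<le> \<epsilon> * (2 * d) ^ m" .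
      moreover have "w \<in> U" using \<delta>0(2) wd d(2) by (auto simp: dist_norm norm_minus_commute)
      ultimately show ?thesis using imw im by (simp add: S_def)
    qed
    have "norm (hderivs j f z) \<le> fact j * (\<epsilon> * (2 * d) ^ m) / (Im z / 2) ^ j"
      by (rule norm_hderivs_le[OF S f[folded S_def]]) (use w im in auto)
    also have "\<dots> \<le> fact j * (\<epsilon> * (2 * d) ^ m) / (d / (2 * (c + 1))) ^ j"
    proof (rule divide_left_mono)
      show "(d / (2 * (c + 1))) ^ j \<le> (Im z / 2) ^ j"
        using dle c d0 by (intro power_mono) (auto simp: field_simps)
    qed (use \<epsilon> d0 c im in auto)
    also have "\<dots> = \<epsilon> * B * (d ^ m / d ^ j)"
      using c d0 by (simp add: B_def power_divide power_mult_distrib field_simps)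
    also have "d ^ m / d ^ j = d ^ (m - j)" using j d0 by (simp add: power_diff)
    also have "\<epsilon> * B * d ^ (m - j) \<le> \<epsilon> * B * 1"
      using \<epsilon> B d0 d(1) by (intro mult_left_mono power_le_one) auto
    also have "\<dots> < e" using e B by (simp add: \<epsilon>_def)
    finally show ?thesis by simp
  qed
  ultimately show "eventually (\<lambda>z. dist (hderivs j f z) 0 < e) (at (complex_of_real \<alpha>) within stolz \<alpha> c)"
    unfolding eventually_at by blast
qed

lemma (in selfadjoint_rel) has_hderiv_resolvent:
  assumes S: "open S" "S \<subseteq> resolvent_set A" "z \<in> S"
  shows "has_hderiv (\<lambda>z. resolvent A z y) (resolvent A z (resolvent A z y)) z"
proof -
  have z: "z \<in> resolvent_set A" using S by blast
  obtain e M where M: "e > 0" "M \<ge> 0"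
    "\<And>w y. w \<in> resolvent_set A \<Longrightarrow> dist w z < e \<Longrightarrow> norm (resolvent A w y) \<le> M * norm y"
    using resolvent_locally_bounded[OF z] by metis
  have ev: "eventually (\<lambda>w. w \<in> S) (at z)" using eventually_at_in_open'[OF S(1,3)] .
  have ev2: "eventually (\<lambda>w. dist w z < e) (at z)" using M(1) unfolding eventually_at by blast
  define u where "u = resolvent A z y"
  have "((\<lambda>w. resolvent A w u - resolvent A z u) \<longlongrightarrow> 0) (at z)"
  proof (rule Lim_null_comparison)
    show "eventually (\<lambda>w. norm (resolvent A w u - resolvent A z u) \<le> dist w z * (M * norm (resolvent A z u))) (at z)"
      using ev ev2
    proof eventually_elim
      case (elim w)
      then have w: "w \<in> resolvent_set A" using S by blast
      show ?case unfolding resolvent_identity[OF w z] norm_scaleC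
        using M(3)[OF w elim(2), of "resolvent A z u"] by (simp add: dist_norm mult_left_mono)
    qed
    have "((\<lambda>w. dist w z * (M * norm (resolvent A z u))) \<longlongrightarrow> dist z z * (M * norm (resolvent A z u))) (at z)"
      by (intro tendsto_intros)
    then show "((\<lambda>w. dist w z * (M * norm (resolvent A z u))) \<longlongrightarrow> 0) (at z)" by simp
  qed
  then have "((\<lambda>w. resolvent A w u) \<longlongrightarrow> resolvent A z u) (at z)" by (rule Lim_null[THEN iffD2])
  moreover have "eventually (\<lambda>w. resolvent A w u = inverse (w - z) \<cdot>\<^sub>C (resolvent A w y - resolvent A z y)) (at z)"
    using ev eventually_neq_at_within[of z z UNIV]
  proof eventually_elim
    case (elim w)
    then have w: "w \<in> resolvent_set A" using S by blast
    show ?case unfolding resolvent_identity[OF w z] u_def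
      using elim(2) by (simp add: scaleC_scaleC scaleC_one)
  qed
  ultimately show ?thesis unfolding has_hderiv_def u_def by (rule Lim_transform_eventually)
qed

lemma hholomorphic_on_const: "hholomorphic_on (\<lambda>_. c) S"
  by (rule hholomorphic_onI[OF has_hderiv_const])

lemma hholomorphic_on_add:
  "hholomorphic_on f S \<Longrightarrow> hholomorphic_on g S \<Longrightarrow> hholomorphic_on (\<lambda>z. f z + g z) S"
  by (rule hholomorphic_onI[OF has_hderiv_add[OF hholomorphic_onD hholomorphic_onD]])

lemma hholomorphic_on_cbounded:
  "cbounded T \<Longrightarrow> hholomorphic_on f S \<Longrightarrow> hholomorphic_on (\<lambda>z. T (f z)) S"
  by (rule hholomorphic_onI[OF has_hderiv_cbounded[OF _ hholomorphic_onD]])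

lemma hholomorphic_on_scaleC:
  assumes "open S" "c holomorphic_on S" "hholomorphic_on f S"
  shows "hholomorphic_on (\<lambda>z. c z \<cdot>\<^sub>C f z) S"
  by (rule hholomorphic_onI[OF has_hderiv_scaleC[OF holomorphic_derivI[OF assms(2,1)]
        hholomorphic_onD[OF assms(3)]]])

lemma hholomorphic_on_sum:
  "(\<And>i. i \<in> I \<Longrightarrow> hholomorphic_on (f i) S) \<Longrightarrow> hholomorphic_on (\<lambda>z. \<Sum>i\<in>I. f i z) S"
  by (induction I rule: infinite_finite_induct)
    (simp_all add: hholomorphic_on_const hholomorphic_on_add)

lemmas hholomorphic_intros = hholomorphic_on_const hholomorphic_on_add
  hholomorphic_on_scaleC hholomorphic_on_sum holomorphic_intros

section \<open>Nontangential limits\<close>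

lemma eventually_stolz:
  assumes "open U" "complex_of_real \<alpha> \<in> U"
  shows "eventually (\<lambda>z. z \<in> U \<inter> {z. Im z > 0}) (at (complex_of_real \<alpha>) within stolz \<alpha> c)"
  unfolding eventually_at_topological using assms by (auto simp: stolz_def)

lemma cmod_stolz_le: "z \<in> stolz \<alpha> c \<Longrightarrow> cmod (z - complex_of_real \<alpha>) \<le> (c + 1) * Im z"
  using cmod_le[of "z - complex_of_real \<alpha>"] by (simp add: stolz_def distrib_right)

lemma nt_wlimI:
  "(\<And>c. c > 0 \<Longrightarrow> (f \<longlongrightarrow> v) (at (complex_of_real \<alpha>) within stolz \<alpha> c)) \<Longrightarrow> nt_wlim f \<alpha> v"
  unfolding nt_wlim_def by (auto intro: tendsto_cinner)

text \<open>Since \<open>s\<close> may be unbounded, only \<open>(z - \<alpha>) s z\<close> is known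
  to vanish in the limit. One factor is spent on this, so the available order is
  \<open>m = l - 1\<close>, exactly enough for all \<open>j < l\<close>.\<close>

lemma nontangential_hderivs_power_null:
  fixes s :: "complex \<Rightarrow> 'h::chilbert"
  assumes U: "open U" "complex_of_real \<alpha> \<in> U"
    and s: "hholomorphic_on s (U \<inter> {z. Im z > 0})"
    and lim: "\<And>c. c > 0 \<Longrightarrow>
      ((\<lambda>z. (z - \<alpha>) \<cdot>\<^sub>C s z) \<longlongrightarrow> 0) (at (complex_of_real \<alpha>) within stolz \<alpha> c)"
    and j: "j < l" and c: "c > 0"
  shows "(hderivs j (\<lambda>z. (z - \<alpha>) ^ l \<cdot>\<^sub>C s z) \<longlongrightarrow> 0) (at (complex_of_real \<alpha>) within stolz \<alpha> c)"
proof (rule nontangential_hderivs_null[OF U, where m = "l - 1"])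
  have "open (U \<inter> {z. Im z > 0})" using U(1) by (intro open_Int open_halfspace_Im_gt)
  then show "hholomorphic_on (\<lambda>z. (z - \<alpha>) ^ l \<cdot>\<^sub>C s z) (U \<inter> {z. Im z > 0})"
    by (intro hholomorphic_intros s)
  fix c :: real assume "c > 0"
  from tendsto_norm_zero[OF lim[OF this]]
  show "((\<lambda>z. norm ((z - \<alpha>) ^ l \<cdot>\<^sub>C s z) / cmod (z - \<alpha>) ^ (l - 1)) \<longlongrightarrow> 0)
      (at (complex_of_real \<alpha>) within stolz \<alpha> c)"
  proof (rule Lim_transform_eventually)
    have "norm ((z - \<alpha>) \<cdot>\<^sub>C s z) = norm ((z - \<alpha>) ^ l \<cdot>\<^sub>C s z) / cmod (z - \<alpha>) ^ (l - 1)"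
      if "z \<noteq> complex_of_real \<alpha>" for z
    proof -
      have "cmod (z - \<alpha>) ^ l = cmod (z - \<alpha>) ^ (l - 1) * cmod (z - \<alpha>)"
        using j power_Suc2[of "cmod (z - \<alpha>)" "l - 1"] by simp
      then show ?thesis using that by (simp add: norm_scaleC norm_power)
    qed
    then show "eventually (\<lambda>z. norm ((z - \<alpha>) \<cdot>\<^sub>C s z)
        = norm ((z - \<alpha>) ^ l \<cdot>\<^sub>C s z) / cmod (z - \<alpha>) ^ (l - 1)) (at (complex_of_real \<alpha>) within stolz \<alpha> c)"
      by (simp add: eventually_at_filter)
  qed
qed (use j c in auto)

text \<open>The conjugates in \<open>mixed_deriv\<close> make the dependence on \<open>w\<close>
  holomorphic. In each variable \<open>J\<close> is moved onto the vector held fixed, so that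
  \<open>higher_deriv_cinner\<close> applies.\<close>

lemma mixed_deriv_kinner:
  fixes y :: "complex \<Rightarrow> 'k::chilbert"
  assumes J: "fund_symmetry J" and S: "open S" and y: "hholomorphic_on y S"
    and F: "\<And>z w. z \<in> S \<Longrightarrow> w \<in> S \<Longrightarrow> F z w = kinner J (y z) (y w)"
    and z: "z \<in> S" and w: "w \<in> S"
  shows "mixed_deriv j F z w = kinner J (hderivs j y z) (hderivs j y w)"
proof -
  interpret pontryagin_space J by unfold_locales (rule J)
  have nhd: "eventually (\<lambda>t. t \<in> S) (nhds t)" if "t \<in> S" for t
    using S that by (rule eventually_nhds_in_open)
  have inner: "cnj ((deriv ^^ j) (\<lambda>w'. cnj (F z' w')) w) = cinner (y z') (J (hderivs j y w))"
    if z': "z' \<in> S" for z'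
  proof -
    have "eventually (\<lambda>w'. cnj (F z' w') = cinner (y w') (J (y z'))) (nhds w)"
      using nhd[OF w]
    proof eventually_elim
      case (elim w')
      then show ?case by (simp add: F[OF z'] kinner_commute[symmetric] cinner_eq_kinner J)
    qed
    then have "(deriv ^^ j) (\<lambda>w'. cnj (F z' w')) w = (deriv ^^ j) (\<lambda>w'. cinner (y w') (J (y z'))) w"
      by (rule higher_deriv_cong_ev) simp
    also have "\<dots> = cinner (hderivs j y w) (J (y z'))" by (rule higher_deriv_cinner[OF S y w])
    finally have "(deriv ^^ j) (\<lambda>w'. cnj (F z' w')) w = cinner (hderivs j y w) (J (y z'))" .
    then show ?thesis by (metis J(3) cinner_commute)
  qed
  have "eventually (\<lambda>z'. cnj ((deriv ^^ j) (\<lambda>w'. cnj (F z' w')) w) = cinner (y z') (J (hderivs j y w))) (nhds z)"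
    using nhd[OF z] by eventually_elim (rule inner)
  then have "mixed_deriv j F z w = (deriv ^^ j) (\<lambda>z'. cinner (y z') (J (hderivs j y w))) z"
    unfolding mixed_deriv_def by (rule higher_deriv_cong_ev) simp
  then show ?thesis
    by (simp add: higher_deriv_cinner[OF S y z] kinner_def J)
qed

section \<open>Resolvents in Stolz angles and Jordan chains\<close>

context selfadjoint_rel
begin

text \<open>In a Stolz angle \<open>z - \<alpha>\<close> is at most \<open>c + 1\<close> times
  \<open>Im z\<close>, which compensates the growth \<open>4 / |Im z|\<close>. The bound is uniform
  in \<open>y\<close>, as the density argument for the limit requires.\<close>

lemma resolvent_nontangential_bounded:
  assumes ne: "\<not> is_eigenvalue A (complex_of_real \<alpha>)" and c: "c > 0"
  obtains M where "M \<ge> 0" "eventually (\<lambda>z. \<forall>y\<in>UNIV. z \<in> resolvent_set A \<longrightarrow>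
      norm ((z - \<alpha>) \<cdot>\<^sub>C resolvent A z y) \<le> M * norm y) (at (complex_of_real \<alpha>) within stolz \<alpha> c)"
proof -
  obtain e C where e: "e > 0" "C \<ge> 0"
    "\<And>z x y. dist z (complex_of_real \<alpha>) < e \<Longrightarrow> Im z \<noteq> 0 \<Longrightarrow> (x, y + z \<cdot>\<^sub>C x) \<in> A \<Longrightarrow>
       norm x \<le> (4 / \<bar>Im z\<bar> + C) * norm y" using resolvent_growth[OF ne] by metis
  define M where "M = 4 * (c + 1) + e * C"
  have "norm ((z - \<alpha>) \<cdot>\<^sub>C resolvent A z y) \<le> M * norm y"
    if z: "z \<in> stolz \<alpha> c" "dist z (complex_of_real \<alpha>) < e" "z \<in> resolvent_set A" for z y
  proof -
    have im: "Im z > 0" using z(1) by (simp add: stolz_def)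
    have "cmod (z - \<alpha>) * (4 / \<bar>Im z\<bar>) \<le> ((c + 1) * Im z) * (4 / \<bar>Im z\<bar>)"
      using cmod_stolz_le[OF z(1)] by (intro mult_right_mono) auto
    then have "cmod (z - \<alpha>) * (4 / \<bar>Im z\<bar>) \<le> 4 * (c + 1)" using im by (simp add: field_simps)
    moreover have "cmod (z - \<alpha>) * C \<le> e * C" using z(2) e(2) by (intro mult_right_mono) (auto simp: dist_norm)
    ultimately have le: "cmod (z - \<alpha>) * (4 / \<bar>Im z\<bar> + C) \<le> M" by (simp add: M_def distrib_left)
    have "norm ((z - \<alpha>) \<cdot>\<^sub>C resolvent A z y) \<le> cmod (z - \<alpha>) * ((4 / \<bar>Im z\<bar> + C) * norm y)"
      unfolding norm_scaleC using e(3)[OF z(2) _ resolvent_mem[OF z(3)], of y] im by (intro mult_left_mono) auto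
    also have "\<dots> \<le> M * norm y" using mult_right_mono[OF le, of "norm y"] by (simp add: mult.assoc)
    finally show ?thesis .
  qed
  then have "eventually (\<lambda>z. \<forall>y\<in>UNIV. z \<in> resolvent_set A \<longrightarrow>
      norm ((z - \<alpha>) \<cdot>\<^sub>C resolvent A z y) \<le> M * norm y) (at (complex_of_real \<alpha>) within stolz \<alpha> c)"
    unfolding eventually_at using e(1) by blast
  moreover have "M \<ge> 0" using c e by (simp add: M_def)
  ultimately show ?thesis using that by blast
qed

text \<open>For \<open>u = a' - \<alpha> a\<close> in the range of \<open>A - \<alpha>\<close> the
  resolvent is \<open>a + (z - \<alpha>) \<cdot>\<^sub>C resolvent A z a\<close>, which stays
  bounded, so multiplication by \<open>z - \<alpha>\<close> sends it to 0. This range is dense, and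
  the uniform bound covers the approximation error.\<close>

lemma resolvent_nontangential_null:
  assumes ne: "\<not> is_eigenvalue A (complex_of_real \<alpha>)" and c: "c > 0"
    and ev: "eventually (\<lambda>z. z \<in> resolvent_set A) (at (complex_of_real \<alpha>) within stolz \<alpha> c)"
  shows "((\<lambda>z. (z - \<alpha>) \<cdot>\<^sub>C resolvent A z y) \<longlongrightarrow> 0) (at (complex_of_real \<alpha>) within stolz \<alpha> c)"
    (is "(_ \<longlongrightarrow> 0) ?F")
proof (rule tendstoI)
  fix e :: real assume e: "e > 0"
  obtain M where M: "M \<ge> 0" and Mb: "eventually (\<lambda>z. \<forall>y\<in>UNIV. z \<in> resolvent_set A \<longrightarrow>
      norm ((z - \<alpha>) \<cdot>\<^sub>C resolvent A z y) \<le> M * norm y) ?F"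
    using resolvent_nontangential_bounded[OF ne c] by blast
  have "y \<in> closure {a' - cnj (complex_of_real \<alpha>) \<cdot>\<^sub>C a | a a'. (a, a') \<in> A}"
    unfolding range_dense[OF ne] by simp
  then have "\<exists>u\<in>{a' - cnj (complex_of_real \<alpha>) \<cdot>\<^sub>C a | a a'. (a, a') \<in> A}. dist u y < e / (2 * (M + 1))"
    using e M by (intro closure_approachable[THEN iffD1, rule_format]) auto
  then obtain a a' where a: "(a, a') \<in> A" "dist (a' - complex_of_real \<alpha> \<cdot>\<^sub>C a) y < e / (2 * (M + 1))"
    by auto
  define u where "u = a' - complex_of_real \<alpha> \<cdot>\<^sub>C a"
  have "((\<lambda>z. cmod (z - \<alpha>) * ((1 + M) * norm a)) \<longlongrightarrow> cmod (complex_of_real \<alpha> - complex_of_real \<alpha>) * ((1 + M) * norm a)) ?F"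
    by (intro tendsto_intros)
  then have small: "eventually (\<lambda>z. cmod (z - \<alpha>) * ((1 + M) * norm a) < e / 2) ?F"
    using e by (intro order_tendstoD(2)) auto
  from ev Mb small show "eventually (\<lambda>z. dist ((z - \<alpha>) \<cdot>\<^sub>C resolvent A z y) 0 < e) ?F"
  proof eventually_elim
    case (elim z)
    note R = cbounded_clinear[OF resolvent_cbounded[OF elim(1)]]
    have Mz: "norm ((z - \<alpha>) \<cdot>\<^sub>C resolvent A z y) \<le> M * norm y" for y using elim by blast
    have "resolvent A z (a' - z \<cdot>\<^sub>C a) = a" by (rule resolvent_eqI[OF elim(1)]) (simp add: a(1))
    moreover have "u = (a' - z \<cdot>\<^sub>C a) + (z - \<alpha>) \<cdot>\<^sub>C a" by (simp add: u_def cvs.scale_left_diff_distrib)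
    ultimately have "resolvent A z u = a + (z - \<alpha>) \<cdot>\<^sub>C resolvent A z a" by (simp add: clinearD[OF R])
    then have "norm ((z - \<alpha>) \<cdot>\<^sub>C resolvent A z u) \<le> cmod (z - \<alpha>) * (norm a + M * norm a)"
      using norm_triangle_ineq[of a "(z - \<alpha>) \<cdot>\<^sub>C resolvent A z a"] Mz[of a]
      unfolding norm_scaleC[of "z - \<alpha>" "resolvent A z u"] by (intro mult_left_mono) auto
    then have 1: "norm ((z - \<alpha>) \<cdot>\<^sub>C resolvent A z u) < e / 2" using elim(3) by (simp add: distrib_right)
    have "norm ((z - \<alpha>) \<cdot>\<^sub>C resolvent A z (y - u)) \<le> M * norm (y - u)" by (rule Mz)
    also have "\<dots> \<le> (M + 1) * norm (y - u)" by (simp add: mult_right_mono)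
    also have "\<dots> \<le> (M + 1) * (e / (2 * (M + 1)))"
      using a(2) M by (intro mult_left_mono) (auto simp: u_def dist_norm norm_minus_commute)
    also have "\<dots> = e / 2"
    proof -
      have K: "K * (e / (2 * K)) = e / 2" if "K > 0" for K :: real using that by simp
      show ?thesis by (rule K) (use M in simp)
    qed
    finally have 2: "norm ((z - \<alpha>) \<cdot>\<^sub>C resolvent A z (y - u)) \<le> e / 2" .
    have "resolvent A z y = resolvent A z u + resolvent A z (y - u)" by (simp add: clinearD[OF R])
    then have "norm ((z - \<alpha>) \<cdot>\<^sub>C resolvent A z y) < e"
      using 1 2 norm_triangle_ineq[of "(z - \<alpha>) \<cdot>\<^sub>C resolvent A z u" "(z - \<alpha>) \<cdot>\<^sub>C resolvent A z (y - u)"]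
      by (simp add: scaleC_add_right)
    then show ?case by simp
  qed
qed

text \<open>Adding \<open>(z - a) ^ Suc n\<close> times the next pair of the chain cancels the
  current defect and leaves one of the next order.\<close>

lemma jordan_chain_polynomial:
  assumes chain: "jordan_chain A a x l" and n: "n < l"
  shows "((\<Sum>i<Suc n. (z - a) ^ i \<cdot>\<^sub>C x i),
    z \<cdot>\<^sub>C (\<Sum>i<Suc n. (z - a) ^ i \<cdot>\<^sub>C x i) - (z - a) ^ Suc n \<cdot>\<^sub>C x n) \<in> A"
  using n
proof (induction n)
  case 0
  have "z \<cdot>\<^sub>C x 0 - (z - a) \<cdot>\<^sub>C x 0 = a \<cdot>\<^sub>C x 0" by (simp add: cvs.scale_left_diff_distrib)
  then show ?case using chain by (simp add: jordan_chain_def scaleC_one)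
next
  case (Suc n)
  define X where "X = (\<Sum>i<Suc n. (z - a) ^ i \<cdot>\<^sub>C x i)"
  define b where "b = (z - a) ^ Suc n"
  have IH: "(X, z \<cdot>\<^sub>C X - b \<cdot>\<^sub>C x n) \<in> A" using Suc by (simp add: X_def b_def)
  have "(x (Suc n), a \<cdot>\<^sub>C x (Suc n) + x n) \<in> A" using chain Suc.prems by (auto simp: jordan_chain_def)
  from A_add[OF IH A_scaleC[OF this, of b]]
  have "(X + b \<cdot>\<^sub>C x (Suc n), z \<cdot>\<^sub>C X + (b * a) \<cdot>\<^sub>C x (Suc n)) \<in> A"
    by (simp add: scaleC_add_right scaleC_scaleC)
  moreover have "z \<cdot>\<^sub>C X + (b * a) \<cdot>\<^sub>C x (Suc n)
      = z \<cdot>\<^sub>C (X + b \<cdot>\<^sub>C x (Suc n)) - ((z - a) * b) \<cdot>\<^sub>C x (Suc n)"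
  proof -
    have "b * a = z * b - (z - a) * b" by (simp add: algebra_simps)
    then show ?thesis by (simp add: scaleC_add_right scaleC_scaleC cvs.scale_left_diff_distrib)
  qed
  moreover have "(\<Sum>i<Suc (Suc n). (z - a) ^ i \<cdot>\<^sub>C x i) = X + b \<cdot>\<^sub>C x (Suc n)"
    by (simp add: X_def b_def)
  moreover have "(z - a) ^ Suc (Suc n) = (z - a) * b" by (simp add: b_def)
  ultimately show ?case by (simp only:)
qed

end

section \<open>The pole cancellation function\<close>

context nev_pair
begin

lemma clinear_V: "clinear V"
  by (simp add: clinear_def V_add V_scaleC)

text \<open>The pair is an eigenpair at \<open>z\<close> up to the error \<open>b y\<close>, as
  \<open>jordan_chain_polynomial\<close> supplies it. \<open>V_resolvent\<close> and
  \<open>V_Gp\<close> are applied to it, and \<open>r\<close> collects what the error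
  contributes.\<close>

lemma pole_cancellation_expansion:
  assumes XA: "(X, z \<cdot>\<^sub>C X - b \<cdot>\<^sub>C y) \<in> A" and z: "z \<in> Dhat Q D"
  defines "r \<equiv> resolvent A2 z (V y) + \<gamma>2 z (Gp y)"
  shows "\<gamma>2 z ((z - cnj z0) \<cdot>\<^sub>C Gp X) = V X + b \<cdot>\<^sub>C r"
    and "(z - cnj z0) \<cdot>\<^sub>C inv_into UNIV (Q z) (Gp X)
      = b \<cdot>\<^sub>C (- (Qhat Q (cnj z2) (Gp y) + Gp2 (V y) + (z - cnj z2) \<cdot>\<^sub>C Gp2 r))"
proof -
  note G = clinearD[OF cbounded_clinear[OF Gp_cbounded]]
  note G2 = clinearD[OF cbounded_clinear[OF inv.Gp_cbounded]]
  note Vl = clinearD[OF clinear_V]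
  note g2 = clinearD[OF cbounded_clinear[OF inv.\<gamma>_cbounded[OF inv.D_resolvent[OF z]]]]
  note R2 = clinearD[OF cbounded_clinear[OF resolvent_cbounded[OF inv.D_resolvent[OF z]]]]
  note q = clinearD[OF cbounded_clinear[OF inv.Q_cbounded[OF inv.D_cnj[OF inv.z0_D]]]]
  note qz = clinearD[OF cbounded_clinear[OF inv.Q_cbounded[OF z]]]
  have e0: "z \<cdot>\<^sub>C X - b \<cdot>\<^sub>C y - c \<cdot>\<^sub>C X = (z - c) \<cdot>\<^sub>C X - b \<cdot>\<^sub>C y" for c
    by (simp add: cvs.scale_left_diff_distrib)
  define p where "p = (z - cnj z0) \<cdot>\<^sub>C Gp X"
  have g: "Gp (z \<cdot>\<^sub>C X - b \<cdot>\<^sub>C y - cnj z0 \<cdot>\<^sub>C X) = p - b \<cdot>\<^sub>C Gp y" unfolding e0 by (simp add: G p_def)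
  have "resolvent A2 z (- (b \<cdot>\<^sub>C V y)) = V X - (\<gamma>2 z p - b \<cdot>\<^sub>C \<gamma>2 z (Gp y))"
    using V_resolvent[OF XA z, unfolded g] by (simp add: Vl g2)
  then have exp1: "\<gamma>2 z p = V X + b \<cdot>\<^sub>C r"
    by (simp add: R2 r_def scaleC_add_right algebra_simps)
  then show "\<gamma>2 z ((z - cnj z0) \<cdot>\<^sub>C Gp X) = V X + b \<cdot>\<^sub>C r" by (simp add: p_def)
  have "Gp2 ((z - cnj z2) \<cdot>\<^sub>C V X - b \<cdot>\<^sub>C V y) = - Qhat Q (cnj z2) (p - b \<cdot>\<^sub>C Gp y)"
    using V_Gp[OF XA, unfolded g] by (simp add: Vl cvs.scale_left_diff_distrib algebra_simps)
  then have "Qhat Q (cnj z2) p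
      = b \<cdot>\<^sub>C Qhat Q (cnj z2) (Gp y) - (z - cnj z2) \<cdot>\<^sub>C Gp2 (V X) + b \<cdot>\<^sub>C Gp2 (V y)"
    by (simp add: q G2 algebra_simps)
  \<comment> \<open>The term \<open>Gp2 (V X)\<close> from the base point value cancels the one
    coming from \<open>\<gamma>2 z p\<close>, so that only multiples of \<open>b\<close>
    survive.\<close>
  then have e1: "Qhat Q z p = b \<cdot>\<^sub>C (Qhat Q (cnj z2) (Gp y) + Gp2 (V y) + (z - cnj z2) \<cdot>\<^sub>C Gp2 r)"
    unfolding inv.Q_formula[OF z] exp1
    by (simp add: G2 scaleC_add_right scaleC_scaleC mult.commute algebra_simps)
  have e2: "(z - cnj z0) \<cdot>\<^sub>C inv_into UNIV (Q z) (Gp X) = - Qhat Q z p"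
    by (simp add: p_def qz) (simp add: Qhat_def)
  show "(z - cnj z0) \<cdot>\<^sub>C inv_into UNIV (Q z) (Gp X)
      = b \<cdot>\<^sub>C (- (Qhat Q (cnj z2) (Gp y) + Gp2 (V y) + (z - cnj z2) \<cdot>\<^sub>C Gp2 r))"
    unfolding e2 e1 by (rule cvs.scale_minus_right[symmetric])
qed

lemma strong_pcf_jordan_chain:
  assumes ne: "\<not> is_eigenvalue A2 (complex_of_real \<alpha>)"
    and chain: "jordan_chain A (complex_of_real \<alpha>) x l"
  shows "strong_pcf Q D
           (\<lambda>z. (z - cnj z0) \<cdot>\<^sub>C inv_into UNIV (Q z)
                  (Gp (\<Sum>i<l. ((z - complex_of_real \<alpha>) ^ i) \<cdot>\<^sub>C x i))) \<alpha> l"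
proof -
  have l: "l > 0" using chain by (simp add: jordan_chain_def)
  define a where "a = complex_of_real \<alpha>"
  define X where "X z = (\<Sum>i<l. (z - a) ^ i \<cdot>\<^sub>C x i)" for z
  define \<eta> where "\<eta> z = (z - cnj z0) \<cdot>\<^sub>C inv_into UNIV (Q z) (Gp (X z))" for z
  define p where "p z = (z - cnj z0) \<cdot>\<^sub>C Gp (X z)" for z
  define u where "u = x (l - 1)"
  define r where "r z = resolvent A2 z (V u) + \<gamma>2 z (Gp u)" for z
  define s where "s z = - (Qhat Q (cnj z2) (Gp u) + Gp2 (V u) + (z - cnj z2) \<cdot>\<^sub>C Gp2 (r z))" for z
  define y where "y z = \<gamma>2 z (p z)" for z
  obtain F where F: "finite F" "F \<subseteq> {z. Im z > 0}" "{z. Im z > 0} - F \<subseteq> Dhat Q D"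
    using Dhat_cofinite by metis
  \<comment> \<open>\<open>F\<close> is finite and lies in the open upper half plane, so this is an
    open set containing the real point \<alpha>.\<close>
  define U where "U = - F"
  define S where "S = U \<inter> {z. Im z > 0}"
  have U: "open U" "complex_of_real \<alpha> \<in> U"
    using F(1,2) by (auto simp: U_def finite_imp_closed open_Compl)
  have S: "open S" unfolding S_def using U(1) by (intro open_Int open_halfspace_Im_gt)
  have SD: "S \<subseteq> Dhat Q D" using F(3) by (auto simp: S_def U_def)
  have S2: "S \<subseteq> resolvent_set A2" using SD inv.D_resolvent by blast
  have evS: "eventually (\<lambda>z. z \<in> S) (at (complex_of_real \<alpha>) within stolz \<alpha> c)" for c
    unfolding S_def by (rule eventually_stolz[OF U])
  have XA: "(X z, z \<cdot>\<^sub>C X z - (z - a) ^ l \<cdot>\<^sub>C u) \<in> A" for z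
    using jordan_chain_polynomial[OF chain, of "l - 1" z] l unfolding X_def u_def a_def by simp
  have y_eq: "y z = V (X z) + (z - a) ^ l \<cdot>\<^sub>C r z"
    and \<eta>_eq: "\<eta> z = (z - a) ^ l \<cdot>\<^sub>C s z" if "z \<in> S" for z
    using pole_cancellation_expansion[OF XA subsetD[OF SD that]]
    by (simp_all add: y_def p_def r_def s_def \<eta>_def)
  have VX: "V (X z) = (\<Sum>i<l. (z - a) ^ i \<cdot>\<^sub>C V (x i))" for z
    by (simp add: X_def clinear_sum[OF clinear_V] V_scaleC)
  have hVX: "hholomorphic_on (\<lambda>z. V (X z)) UNIV"
    unfolding VX by (intro hholomorphic_intros open_UNIV)
  have hp: "hholomorphic_on p UNIV"
    unfolding p_def X_def by (intro hholomorphic_intros open_UNIV hholomorphic_on_cbounded[OF Gp_cbounded])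
  have hR: "hholomorphic_on (\<lambda>z. resolvent A2 z v) S" for v
    by (rule hholomorphic_onI[OF inv.has_hderiv_resolvent[OF S S2]])
  have hr: "hholomorphic_on r S"
    unfolding r_def inv.\<gamma>_def by (intro hholomorphic_intros hR S)
  have s_alt: "s = (\<lambda>z. (-1) \<cdot>\<^sub>C (Qhat Q (cnj z2) (Gp u) + Gp2 (V u) + (z - cnj z2) \<cdot>\<^sub>C Gp2 (r z)))"
    by (simp add: s_def fun_eq_iff)
  have hs: "hholomorphic_on s S"
    unfolding s_alt by (intro hholomorphic_intros hr S hholomorphic_on_cbounded[OF inv.Gp_cbounded])
  have rlim: "((\<lambda>z. (z - a) \<cdot>\<^sub>C r z) \<longlongrightarrow> 0) (at (complex_of_real \<alpha>) within stolz \<alpha> c)" (is "(_ \<longlongrightarrow> 0) ?F")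
    and slim: "((\<lambda>z. (z - a) \<cdot>\<^sub>C s z) \<longlongrightarrow> 0) (at (complex_of_real \<alpha>) within stolz \<alpha> c)"
    if c: "c > 0" for c
  proof -
    have "eventually (\<lambda>z. z \<in> resolvent_set A2) ?F"
      using evS by (rule eventually_mono) (use S2 in blast)
    then have R0: "((\<lambda>z. (z - a) \<cdot>\<^sub>C resolvent A2 z v) \<longlongrightarrow> 0) ?F" for v
      unfolding a_def by (rule inv.resolvent_nontangential_null[OF ne c])
    have za: "((\<lambda>z. z - a) \<longlongrightarrow> 0) ?F" unfolding a_def by (rule LIM_zero) (rule tendsto_ident_at)
    have "((\<lambda>z. (z - a) \<cdot>\<^sub>C resolvent A2 z (V u) + ((z - a) \<cdot>\<^sub>C \<Gamma>2 (Gp u)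
        + (z - z2) \<cdot>\<^sub>C ((z - a) \<cdot>\<^sub>C resolvent A2 z (\<Gamma>2 (Gp u)))))
      \<longlongrightarrow> 0 + (0 \<cdot>\<^sub>C \<Gamma>2 (Gp u) + (complex_of_real \<alpha> - z2) \<cdot>\<^sub>C 0)) ?F"
      by (intro tendsto_add tendsto_scaleC R0 za tendsto_const tendsto_diff tendsto_ident_at)
    then show r0: "((\<lambda>z. (z - a) \<cdot>\<^sub>C r z) \<longlongrightarrow> 0) ?F"
      by (simp add: r_def inv.\<gamma>_def scaleC_add_right scaleC_scaleC mult.commute)
    have "((\<lambda>z. - ((z - a) \<cdot>\<^sub>C (Qhat Q (cnj z2) (Gp u) + Gp2 (V u))
        + (z - cnj z2) \<cdot>\<^sub>C Gp2 ((z - a) \<cdot>\<^sub>C r z)))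
      \<longlongrightarrow> - (0 \<cdot>\<^sub>C (Qhat Q (cnj z2) (Gp u) + Gp2 (V u)) + (complex_of_real \<alpha> - cnj z2) \<cdot>\<^sub>C Gp2 0)) ?F"
      by (intro tendsto_minus tendsto_add tendsto_scaleC r0 za tendsto_const tendsto_diff tendsto_ident_at
          cbounded_tendsto[OF inv.Gp_cbounded])
    then show "((\<lambda>z. (z - a) \<cdot>\<^sub>C s z) \<longlongrightarrow> 0) ?F"
      by (simp add: s_def scaleC_add_right cvs.scale_right_diff_distrib scaleC_scaleC mult.commute
          cboundedD[OF inv.Gp_cbounded])
  qed
  have hpow: "hholomorphic_on (\<lambda>z. (z - a) ^ l \<cdot>\<^sub>C r z) S" "hholomorphic_on (\<lambda>z. (z - a) ^ l \<cdot>\<^sub>C s z) S"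
    by (intro hholomorphic_intros hr hs S)+
  have hVXS: "hholomorphic_on (\<lambda>z. V (X z)) S" using hVX by (simp add: hholomorphic_on_def)
  have hy: "hholomorphic_on y S"
    using hholomorphic_on_add[OF hVXS hpow(1)] hholomorphic_on_cong[OF S y_eq] by simp
  have h\<eta>: "hholomorphic_on \<eta> S"
    using hpow(2) hholomorphic_on_cong[OF S \<eta>_eq] by simp
  have entire: "(hderivs j f \<longlongrightarrow> hderivs j f (complex_of_real \<alpha>)) (at (complex_of_real \<alpha>) within stolz \<alpha> c)"
    if "hholomorphic_on f UNIV" for f :: "complex \<Rightarrow> 'd::chilbert" and j c
    using hholomorphic_on_continuous_on[OF hderivs_hholomorphic_on[OF open_UNIV that]]
    unfolding continuous_on_def by (meson UNIV_I subset_UNIV tendsto_within_subset)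
  have \<eta>_lim: "(hderivs j \<eta> \<longlongrightarrow> 0) (at (complex_of_real \<alpha>) within stolz \<alpha> c)" if "j < l" "c > 0" for j c
  proof (rule Lim_transform_eventually)
    show "(hderivs j (\<lambda>z. (z - a) ^ l \<cdot>\<^sub>C s z) \<longlongrightarrow> 0) (at (complex_of_real \<alpha>) within stolz \<alpha> c)"
      unfolding a_def
      by (rule nontangential_hderivs_power_null[OF U hs[unfolded S_def] slim[unfolded a_def] that])
    show "eventually (\<lambda>z. hderivs j (\<lambda>z. (z - a) ^ l \<cdot>\<^sub>C s z) z = hderivs j \<eta> z)
        (at (complex_of_real \<alpha>) within stolz \<alpha> c)"
      using evS
    proof eventually_elim
      case (elim z)
      have "hderivs j \<eta> z = hderivs j (\<lambda>z. (z - a) ^ l \<cdot>\<^sub>C s z) z"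
        by (rule hderivs_cong[OF S _ elim]) (rule \<eta>_eq)
      then show ?case by simp
    qed
  qed
  \<comment> \<open>\<open>V (X z)\<close> is a polynomial in \<open>z\<close>, so its derivatives
    have limits at \<alpha>; the derivatives of the remainder contribute nothing to the
    limit.\<close>
  define L where "L j = hderivs j (\<lambda>z. V (X z)) (complex_of_real \<alpha>)" for j
  have y_lim: "(hderivs j y \<longlongrightarrow> L j) (at (complex_of_real \<alpha>) within stolz \<alpha> c)" if "j < l" "c > 0" for j c
  proof (rule Lim_transform_eventually)
    have "(hderivs j (\<lambda>z. (z - a) ^ l \<cdot>\<^sub>C r z) \<longlongrightarrow> 0) (at (complex_of_real \<alpha>) within stolz \<alpha> c)"
      unfolding a_def
      by (rule nontangential_hderivs_power_null[OF U hr[unfolded S_def] rlim[unfolded a_def] that])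
    from tendsto_add[OF entire[OF hVX, of j c] this]
    show "((\<lambda>z. hderivs j (\<lambda>z. V (X z)) z + hderivs j (\<lambda>z. (z - a) ^ l \<cdot>\<^sub>C r z) z) \<longlongrightarrow> L j)
        (at (complex_of_real \<alpha>) within stolz \<alpha> c)" by (simp add: L_def)
    show "eventually (\<lambda>z. hderivs j (\<lambda>z. V (X z)) z + hderivs j (\<lambda>z. (z - a) ^ l \<cdot>\<^sub>C r z) z = hderivs j y z)
        (at (complex_of_real \<alpha>) within stolz \<alpha> c)"
      using evS
    proof eventually_elim
      case (elim z)
      have "hderivs j y z = hderivs j (\<lambda>z. V (X z) + (z - a) ^ l \<cdot>\<^sub>C r z) z"
        by (rule hderivs_cong[OF S _ elim]) (rule y_eq)
      then show ?case using hderivs_add[OF S hVXS hpow(1) elim, of j] by simp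
    qed
  qed
  have Q\<eta>: "Q z (\<eta> z) = p z" if "z \<in> S" for z
  proof -
    have "bdd_invertible (Q z)" using SD that by (auto simp: Dhat_def)
    then show ?thesis by (simp add: \<eta>_def p_def cboundedD bdd_invertibleD)
  qed
  have pcf: "pcf_form Q \<eta> z w = kinner J2 (y z) (y w)" if z: "z \<in> S" and w: "w \<in> S" for z w
  proof -
    have inv: "bdd_invertible (Q z)" "bdd_invertible (Q w)" and zw: "z \<in> Dhat Q D" "w \<in> Dhat Q D"
      using SD z w by (auto simp: Dhat_def)
    \<comment> \<open>Both points lie in the upper half plane, so this also holds on the diagonal
      \<open>z = w\<close>, where boundedness is required.\<close>
    have "z \<noteq> cnj w" using z w by (auto simp: S_def complex_eq_iff)
    then have "kinner J2 (y z) (y w) = nev_kernel (Qhat Q) z w (p z) (p w)"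
      unfolding y_def by (rule inv.kinner_\<gamma>_\<gamma>[OF zw])
    moreover have "Qhat Q t (p t) = - \<eta> t" if "bdd_invertible (Q t)" for t
      using that by (simp add: Qhat_def p_def \<eta>_def cboundedD[OF bdd_invertibleD(2)])
    ultimately show ?thesis
      using inv by (simp add: pcf_form_def nev_kernel_def Q\<eta>[OF z] Q\<eta>[OF w] cinner_simps)
  qed
  have mixed: "mixed_deriv j (pcf_form Q \<eta>) z w = kinner J2 (hderivs j y z) (hderivs j y w)"
    if "z \<in> S" "w \<in> S" for j z w
    by (rule mixed_deriv_kinner[OF inv.fund S hy pcf that])
  have "strong_pcf Q D \<eta> \<alpha> l"
    unfolding strong_pcf_def
  proof (intro exI[of _ U] conjI allI impI)
    show "open U" "complex_of_real \<alpha> \<in> U" by (rule U)+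
    show "U \<inter> {z. Im z > 0} \<subseteq> D" using SD Dhat_D unfolding S_def by blast
    show "hholomorphic_on \<eta> (U \<inter> {z. Im z > 0})" using h\<eta> by (simp add: S_def)
    fix j assume j: "j < l"
    show "nt_wlim (hderivs j \<eta>) \<alpha> 0" by (rule nt_wlimI[OF \<eta>_lim[OF j]])
    show "\<exists>v. nt_wlim (hderivs j (\<lambda>z. Q z (\<eta> z))) \<alpha> v \<and> (j = 0 \<longrightarrow> v \<noteq> 0)"
    proof (intro exI[of _ "hderivs j p (complex_of_real \<alpha>)"] conjI impI nt_wlimI)
      fix c :: real
      show "(hderivs j (\<lambda>z. Q z (\<eta> z)) \<longlongrightarrow> hderivs j p (complex_of_real \<alpha>))
          (at (complex_of_real \<alpha>) within stolz \<alpha> c)"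
      proof (rule Lim_transform_eventually[OF entire[OF hp]])
        show "eventually (\<lambda>z. hderivs j p z = hderivs j (\<lambda>z. Q z (\<eta> z)) z)
            (at (complex_of_real \<alpha>) within stolz \<alpha> c)"
          using evS
        proof eventually_elim
          case (elim z)
          have "hderivs j (\<lambda>z. Q z (\<eta> z)) z = hderivs j p z"
            by (rule hderivs_cong[OF S _ elim]) (rule Q\<eta>)
          then show ?case by simp
        qed
      qed
    next
      assume "j = 0"
      have "X a = x 0"
      proof -
        have "{..<l} = insert 0 {1..<l}" using l by auto
        then show ?thesis by (simp add: X_def scaleC_one sum.neutral)
      qed
      then have "Gp (X a) \<noteq> 0"
        using Gp_eigenvector_nonzero[of "x 0" a] chain by (simp add: jordan_chain_def a_def)
      moreover have "a - cnj z0 \<noteq> 0" using z0_upper by (auto simp: a_def complex_eq_iff)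
      ultimately show "hderivs j p (complex_of_real \<alpha>) \<noteq> 0"
        using \<open>j = 0\<close> by (simp add: p_def a_def cvs.scale_eq_0_iff)
    qed
    show "nt_bounded (\<lambda>z. mixed_deriv j (pcf_form Q \<eta>) z z) \<alpha>"
      unfolding nt_bounded_def
    proof (intro allI impI)
      fix c :: real assume c: "c > 0"
      have "((\<lambda>z. cmod (kinner J2 (hderivs j y z) (hderivs j y z))) \<longlongrightarrow> cmod (kinner J2 (L j) (L j)))
          (at (complex_of_real \<alpha>) within stolz \<alpha> c)"
        by (intro tendsto_norm inv.tendsto_kinner y_lim[OF j c])
      then have "eventually (\<lambda>z. cmod (kinner J2 (hderivs j y z) (hderivs j y z)) < cmod (kinner J2 (L j) (L j)) + 1)
          (at (complex_of_real \<alpha>) within stolz \<alpha> c)"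
        by (rule order_tendstoD(2)) simp
      with evS have "eventually (\<lambda>z. norm (mixed_deriv j (pcf_form Q \<eta>) z z) \<le> cmod (kinner J2 (L j) (L j)) + 1)
          (at (complex_of_real \<alpha>) within stolz \<alpha> c)"
        by eventually_elim (simp add: mixed)
      then show "\<exists>M. eventually (\<lambda>z. norm (mixed_deriv j (pcf_form Q \<eta>) z z) \<le> M)
          (at (complex_of_real \<alpha>) within stolz \<alpha> c)" by blast
    qed
    show "nt_lim2_exists (mixed_deriv j (pcf_form Q \<eta>)) \<alpha>"
      unfolding nt_lim2_exists_def
    proof (intro exI[of _ "kinner J2 (L j) (L j)"] allI impI)
      fix c :: real assume c: "c > 0"
      let ?P = "at (complex_of_real \<alpha>, complex_of_real \<alpha>) within stolz \<alpha> c \<times> stolz \<alpha> c"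
      \<comment> \<open>The limit over pairs only excludes the pair with both entries \<alpha>. As
        the Stolz angle omits its vertex, each coordinate differs from \<alpha>, and the limits in
        one variable can be composed with the projections.\<close>
      have notin: "complex_of_real \<alpha> \<notin> stolz \<alpha> c" by (simp add: stolz_def)
      have inside: "eventually (\<lambda>q. q \<in> stolz \<alpha> c \<times> stolz \<alpha> c) ?P"
        by (simp add: eventually_at_filter)
      have id: "((\<lambda>q. q) \<longlongrightarrow> (complex_of_real \<alpha>, complex_of_real \<alpha>)) ?P"
        by (rule tendsto_ident_at)
      have F1: "filterlim fst (at (complex_of_real \<alpha>) within stolz \<alpha> c) ?P"
        unfolding filterlim_at
      proof
        show "eventually (\<lambda>q. fst q \<in> stolz \<alpha> c \<and> fst q \<noteq> complex_of_real \<alpha>) ?P"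
          using inside by (rule eventually_mono) (use notin in auto)
        show "(fst \<longlongrightarrow> complex_of_real \<alpha>) ?P" using tendsto_fst[OF id] by simp
      qed
      have F2: "filterlim snd (at (complex_of_real \<alpha>) within stolz \<alpha> c) ?P"
        unfolding filterlim_at
      proof
        show "eventually (\<lambda>q. snd q \<in> stolz \<alpha> c \<and> snd q \<noteq> complex_of_real \<alpha>) ?P"
          using inside by (rule eventually_mono) (use notin in auto)
        show "(snd \<longlongrightarrow> complex_of_real \<alpha>) ?P" using tendsto_snd[OF id] by simp
      qed
      note fs = filterlim_compose[OF y_lim[OF j c] F1] filterlim_compose[OF y_lim[OF j c] F2]
      have ev: "eventually (\<lambda>q. fst q \<in> S) ?P" "eventually (\<lambda>q. snd q \<in> S) ?P"
        using F1[unfolded filterlim_iff, rule_format, OF evS] F2[unfolded filterlim_iff, rule_format, OF evS]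
        by simp_all
      have "((\<lambda>q. kinner J2 (hderivs j y (fst q)) (hderivs j y (snd q))) \<longlongrightarrow> kinner J2 (L j) (L j)) ?P"
        by (intro inv.tendsto_kinner fs)
      then show "((\<lambda>(z, w). mixed_deriv j (pcf_form Q \<eta>) z w) \<longlongrightarrow> kinner J2 (L j) (L j)) ?P"
      proof (rule Lim_transform_eventually)
        show "eventually (\<lambda>q. kinner J2 (hderivs j y (fst q)) (hderivs j y (snd q))
            = (case q of (z, w) \<Rightarrow> mixed_deriv j (pcf_form Q \<eta>) z w)) ?P"
          using ev by eventually_elim (simp add: mixed case_prod_beta)
      qed
    qed
  qed
  then show ?thesis unfolding \<eta>_def X_def a_def .
qed

end

theorem theorem3p5:
  fixes Q :: "complex \<Rightarrow> 'h::chilbert \<Rightarrow> 'h"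
    and D :: "complex set"
    and \<kappa> :: nat
    and J :: "'k::chilbert \<Rightarrow> 'k"
    and A :: "('k \<times> 'k) set"
    and z0 :: complex
    and \<Gamma> :: "'h \<Rightarrow> 'k"
    and Gp :: "'k \<Rightarrow> 'h"
    and \<alpha> :: real
    and x :: "nat \<Rightarrow> 'k"
    and l :: nat
  assumes nev: "gen_nevanlinna \<kappa> Q D"
    and reg: "regular_fn Q D"
    and real: "min_realization Q D J A z0 \<Gamma> Gp"
    and nozero: "\<not> gen_zero TYPE('k2::chilbert) Q D \<alpha>"
    and pole: "is_eigenvalue A (complex_of_real \<alpha>)"
    and chain: "jordan_chain A (complex_of_real \<alpha>) x l"
  shows "strong_pcf Q D
           (\<lambda>z. (z - cnj z0) \<cdot>\<^sub>C inv_into UNIV (Q z)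
                  (Gp (\<Sum>i<l. ((z - complex_of_real \<alpha>) ^ i) \<cdot>\<^sub>C x i)))
           \<alpha> l"
proof -
  \<comment> \<open>\<open>gen_pole\<close> quantifies over all minimal realizations, so its
    negation provides one for the inverse function in which \<alpha> is not an eigenvalue.\<close>
  from nozero obtain J2 :: "'k2 \<Rightarrow> 'k2" and A2 z2 \<Gamma>2 Gp2
    where real2: "min_realization (Qhat Q) (Dhat Q D) J2 A2 z2 \<Gamma>2 Gp2"
      and ne: "\<not> is_eigenvalue A2 (complex_of_real \<alpha>)"
    unfolding gen_zero_def gen_pole_def by blast
  have mer: "op_meromorphic_nonreal Q D" using nev by (simp add: gen_nevanlinna_def)
  then have cb: "\<And>z. z \<in> D \<Longrightarrow> cbounded (Q z)"
    by (simp add: op_meromorphic_nonreal_def op_holomorphic_on_def)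
  interpret nev_pair Q D J A z0 \<Gamma> Gp J2 A2 z2 \<Gamma>2 Gp2
  proof unfold_locales
    show "min_realization Q D J A z0 \<Gamma> Gp" by (rule real)
    show "min_realization (Qhat Q) (Dhat Q D) J2 A2 z2 \<Gamma>2 Gp2" by (rule real2)
    show "op_meromorphic_nonreal Q D" by (rule mer)
    fix z assume z: "z \<in> D"
    show "cnj z \<in> D" "cbounded (Q z)" "\<And>x y. cinner (Q z x) y = cinner x (Q (cnj z) y)"
      using nev z cb by (auto simp: gen_nevanlinna_def)
  qed
  show ?thesis by (rule strong_pcf_jordan_chain[OF ne chain])
qed

end
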